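(* Let $G=\mathbb Z^2$ and let $\mu$ be a symmetric probability measure on $\mathbb{Z}^2$ whose (finite, generating) support $S$ is such that the Cayley graph $X(\mathbb Z^2,S)$ is the square lattice or the triangular lattice. Then for any finite group $H$ with $|H|\ge2$, the associated switch-walk-switch random walk on $H\wr\mathbb Z^2$ (with law $\widetilde\mu=\nu*\mu*\nu$) has pure point spectrum, i.e. the operator $F\mapsto F*\widetilde\mu$ on $\ell^2(H\wr\mathbb Z^2)$ has pure point spectrum.
   Context: For a group $G$ with identity $e$ and a finite group $H$ with identity $o$, let $\mathcal{L}=\bigoplus_G H$ be the group (under pointwise multiplication) of functions $\eta:G\to H$ with finite support $\{x:\eta(x)\ne o\}$; its identity is $\iota\equiv o$. $G$ acts on $\mathcal L$ by $L_g\eta(x)=\eta(g^{-1}x)$, and the lamplighter group is $H\wr G=\mathcal{L}\rtimes G$ with $(\eta,g)(\eta',g')=(\eta\cdot L_g\eta',gg')$. $G$ and $H$ embed into $H\wr G$ via $g\mapsto(\iota,g)$ and $h\mapsto(\eta_e^h,e)$, where $\eta_e^h(e)=h$ and $\eta_e^h(x)=o$ for $x\neq e$; measures on $G$ and $H$ are regarded as measures on $H\wr G$ via these embeddings. $\nu$ is the uniform distribution on $H$. The Cayley graph $X(G,S)$ has vertex set $G$ and unoriented edges $[x,xs]$, $x\in G$, $s\in S$. The switch-walk-switch random walk associated with $\mu$ is the random walk on $H\wr G$ with law $\widetilde\mu=\nu*\mu*\nu$; its transition operator is the self-adjoint operator $F\mapsto F*\widetilde\mu$ on $\ell^2(H\wr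 G)$. The spectrum of a self-adjoint operator is called pure point if the Hilbert space has a complete orthonormal system of eigenvectors. *)

theory Defs
  imports
    "HOL-Probability.Probability_Mass_Function"
    "HOL-Algebra.Product_Groups"
    "HOL-Algebra.Elementary_Groups"
begin

section \<open>Lamplighter groups\<close>

abbreviation configurations ::
  "('h, 'm) monoid_scheme \<Rightarrow> ('g, 'n) monoid_scheme \<Rightarrow> ('g \<Rightarrow> 'h) monoid"
  where "configurations H G \<equiv> sum_group (carrier G) (\<lambda>_. H)"

definition shift :: "('g, 'n) monoid_scheme \<Rightarrow> 'g \<Rightarrow> ('g \<Rightarrow> 'h) \<Rightarrow> 'g \<Rightarrow> 'h"
  where "shift G g \<eta> = (\<lambda>x\<in>carrier G. \<eta> (inv\<^bsub>G\<^esub> g \<otimes>\<^bsub>G\<^esub> x))"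

definition lamplighter_group ::
  "('h, 'm) monoid_scheme \<Rightarrow> ('g, 'n) monoid_scheme \<Rightarrow> (('g \<Rightarrow> 'h) \<times> 'g) monoid"
  where "lamplighter_group H G =
    \<lparr>carrier = carrier (configurations H G) \<times> carrier G,
     monoid.mult = (\<lambda>(\<eta>, g) (\<eta>', g'). (\<eta> \<otimes>\<^bsub>configurations H G\<^esub> shift G g \<eta>', g \<otimes>\<^bsub>G\<^esub> g')),
     one = (\<one>\<^bsub>configurations H G\<^esub>, \<one>\<^bsub>G\<^esub>)\<rparr>"

definition embed_base ::
  "('h, 'm) monoid_scheme \<Rightarrow> ('g, 'n) monoid_scheme \<Rightarrow> 'g \<Rightarrow> ('g \<Rightarrow> 'h) \<times> 'g"
  where "embed_base H G g = (\<one>\<^bsub>configurations H G\<^esub>, g)"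

definition embed_lamp ::
  "('h, 'm) monoid_scheme \<Rightarrow> ('g, 'n) monoid_scheme \<Rightarrow> 'h \<Rightarrow> ('g \<Rightarrow> 'h) \<times> 'g"
  where "embed_lamp H G h =
    ((\<lambda>x\<in>carrier G. if x = \<one>\<^bsub>G\<^esub> then h else \<one>\<^bsub>H\<^esub>), \<one>\<^bsub>G\<^esub>)"

lemma carrier_configurations:
  assumes "group H"
  shows "carrier (configurations H G) =
    {\<eta> \<in> carrier G \<rightarrow>\<^sub>E carrier H. finite {x \<in> carrier G. \<eta> x \<noteq> \<one>\<^bsub>H\<^esub>}}"
  using assms by (simp add: carrier_sum_group)

lemma shift_closed:
  assumes G: "group G" and H: "group H" and g: "g \<in> carrier G"
    and \<eta>: "\<eta> \<in> carrier (configurations H G)"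
  shows "shift G g \<eta> \<in> carrier (configurations H G)"
proof -
  interpret G: group G by fact
  let ?A = "{x \<in> carrier G. \<eta> x \<noteq> \<one>\<^bsub>H\<^esub>}"
  have "{x \<in> carrier G. shift G g \<eta> x \<noteq> \<one>\<^bsub>H\<^esub>} \<subseteq> (\<lambda>x. g \<otimes>\<^bsub>G\<^esub> x) ` ?A"
  proof
    fix x assume x: "x \<in> {x \<in> carrier G. shift G g \<eta> x \<noteq> \<one>\<^bsub>H\<^esub>}"
    then have "inv\<^bsub>G\<^esub> g \<otimes>\<^bsub>G\<^esub> x \<in> ?A" using g by (auto simp: shift_def)
    moreover have "x = g \<otimes>\<^bsub>G\<^esub> (inv\<^bsub>G\<^esub> g \<otimes>\<^bsub>G\<^esub> x)"
      using x g by (simp add: G.inv_solve_left G.m_assoc[symmetric])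
    ultimately show "x \<in> (\<lambda>x. g \<otimes>\<^bsub>G\<^esub> x) ` ?A" by blast
  qed
  moreover have "finite ?A" using \<eta> by (simp add: carrier_configurations[OF H])
  ultimately have "finite {x \<in> carrier G. shift G g \<eta> x \<noteq> \<one>\<^bsub>H\<^esub>}"
    by (meson finite_imageI finite_subset)
  then show ?thesis
    using \<eta> g by (auto simp: carrier_configurations[OF H] shift_def PiE_iff)
qed

lemma group_lamplighter_group:
  assumes G: "group G" and H: "group H"
  shows "group (lamplighter_group H G)"
proof -
  interpret G: group G by fact
  interpret H: group H by fact
  interpret L: group "configurations H G" by (simp add: H)
  have mult: "\<eta> \<otimes>\<^bsub>configurations H G\<^esub> \<zeta> = (\<lambda>x\<in>carrier G. \<eta> x \<otimes>\<^bsub>H\<^esub> \<zeta> x)" for \<eta> \<zeta>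
    by simp
  have closed: "\<eta> x \<in> carrier H"
    if "\<eta> \<in> carrier (configurations H G)" "x \<in> carrier G" for \<eta> x
    using that by (auto simp: carrier_configurations[OF H])
  have shift_mult: "shift G g (\<eta> \<otimes>\<^bsub>configurations H G\<^esub> \<zeta>)
      = shift G g \<eta> \<otimes>\<^bsub>configurations H G\<^esub> shift G g \<zeta>" if "g \<in> carrier G" for g \<eta> \<zeta>
    unfolding mult using that by (auto simp: shift_def fun_eq_iff restrict_def)
  have shift_shift: "shift G g (shift G g' \<eta>) = shift G (g \<otimes>\<^bsub>G\<^esub> g') \<eta>"
    if "g \<in> carrier G" "g' \<in> carrier G" for g g' \<eta>
    using that by (auto simp: shift_def fun_eq_iff restrict_def G.inv_mult_group G.m_assoc)
  have shift_one: "shift G \<one>\<^bsub>G\<^esub> \<eta> = \<eta>" if "\<eta> \<in> carrier (configurations H G)" for \<eta>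
    using that by (auto simp: shift_def fun_eq_iff restrict_def carrier_configurations[OF H]
        PiE_iff extensional_def)
  note sh = shift_closed[OF G H]
  show ?thesis
  proof (rule groupI)
    fix x y assume "x \<in> carrier (lamplighter_group H G)" "y \<in> carrier (lamplighter_group H G)"
    then show "x \<otimes>\<^bsub>lamplighter_group H G\<^esub> y \<in> carrier (lamplighter_group H G)"
      using L.m_closed sh by (auto simp: lamplighter_group_def simp del: mult_sum_group)
  next
    show "\<one>\<^bsub>lamplighter_group H G\<^esub> \<in> carrier (lamplighter_group H G)"
      using L.one_closed by (auto simp: lamplighter_group_def simp del: one_sum_group)
  next
    fix x y z
    assume "x \<in> carrier (lamplighter_group H G)" "y \<in> carrier (lamplighter_group H G)"
      "z \<in> carrier (lamplighter_group H G)"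
    then show "x \<otimes>\<^bsub>lamplighter_group H G\<^esub> y \<otimes>\<^bsub>lamplighter_group H G\<^esub> z
        = x \<otimes>\<^bsub>lamplighter_group H G\<^esub> (y \<otimes>\<^bsub>lamplighter_group H G\<^esub> z)"
      by (auto simp: lamplighter_group_def shift_mult shift_shift L.m_assoc sh G.m_assoc
          simp del: mult_sum_group)
  next
    fix x assume "x \<in> carrier (lamplighter_group H G)"
    then show "\<one>\<^bsub>lamplighter_group H G\<^esub> \<otimes>\<^bsub>lamplighter_group H G\<^esub> x = x"
      by (auto simp: lamplighter_group_def shift_one simp del: mult_sum_group one_sum_group)
  next
    fix x assume x: "x \<in> carrier (lamplighter_group H G)"
    obtain \<eta> g where [simp]: "x = (\<eta>, g)" by (cases x)
    have m: "\<eta> \<in> carrier (configurations H G)" "g \<in> carrier G"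
      using x by (auto simp: lamplighter_group_def)
    let ?\<zeta> = "inv\<^bsub>configurations H G\<^esub> (shift G (inv\<^bsub>G\<^esub> g) \<eta>)"
    have "(?\<zeta>, inv\<^bsub>G\<^esub> g) \<in> carrier (lamplighter_group H G)"
      using m sh L.inv_closed by (auto simp: lamplighter_group_def)
    moreover have "(?\<zeta>, inv\<^bsub>G\<^esub> g) \<otimes>\<^bsub>lamplighter_group H G\<^esub> x = \<one>\<^bsub>lamplighter_group H G\<^esub>"
      using m L.l_inv[OF sh] by (simp add: lamplighter_group_def del: mult_sum_group one_sum_group inv_sum_group)
    ultimately show "\<exists>y\<in>carrier (lamplighter_group H G).
        y \<otimes>\<^bsub>lamplighter_group H G\<^esub> x = \<one>\<^bsub>lamplighter_group H G\<^esub>" by blast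
  qed
qed


section \<open>The switch-walk-switch random walk\<close>

definition convolution :: "('a, 'm) monoid_scheme \<Rightarrow> 'a pmf \<Rightarrow> 'a pmf \<Rightarrow> 'a pmf"
  where "convolution W p q = map_pmf (\<lambda>(x, y). x \<otimes>\<^bsub>W\<^esub> y) (pair_pmf p q)"

definition switch_walk_switch ::
  "('h, 'm) monoid_scheme \<Rightarrow> ('g, 'n) monoid_scheme \<Rightarrow> 'g pmf \<Rightarrow> (('g \<Rightarrow> 'h) \<times> 'g) pmf"
  where "switch_walk_switch H G \<mu> =
    (let W = lamplighter_group H G;
         \<nu> = map_pmf (embed_lamp H G) (pmf_of_set (carrier H))
     in convolution W (convolution W \<nu> (map_pmf (embed_base H G) \<mu>)) \<nu>)"

definition symmetric_pmf :: "('a, 'm) monoid_scheme \<Rightarrow> 'a pmf \<Rightarrow> bool"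
  where "symmetric_pmf G \<mu> \<longleftrightarrow> (\<forall>x\<in>carrier G. pmf \<mu> (inv\<^bsub>G\<^esub> x) = pmf \<mu> x)"


section \<open>Square-summable functions and pure point spectrum\<close>

text \<open>Elements of \<open>\<ell>\<^sup>2(X)\<close> are represented by functions that vanish outside \<open>X\<close>, so that equality
  in \<open>\<ell>\<^sup>2(X)\<close> is equality of functions.\<close>

definition ell2 :: "'a set \<Rightarrow> ('a \<Rightarrow> complex) set"
  where "ell2 X = {F. (\<forall>x. x \<notin> X \<longrightarrow> F x = 0) \<and> (\<lambda>x. (cmod (F x))\<^sup>2) summable_on X}"

definition ell2_inner :: "'a set \<Rightarrow> ('a \<Rightarrow> complex) \<Rightarrow> ('a \<Rightarrow> complex) \<Rightarrow> complex"
  where "ell2_inner X F F' = (\<Sum>\<^sub>\<infinity>x\<in>X. F x * cnj (F' x))"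

definition ell2_norm :: "'a set \<Rightarrow> ('a \<Rightarrow> complex) \<Rightarrow> real"
  where "ell2_norm X F = sqrt (\<Sum>\<^sub>\<infinity>x\<in>X. (cmod (F x))\<^sup>2)"

definition orthonormal_system :: "'a set \<Rightarrow> ('a \<Rightarrow> complex) set \<Rightarrow> bool"
  where "orthonormal_system X B \<longleftrightarrow> B \<subseteq> ell2 X \<and>
    (\<forall>F\<in>B. \<forall>F'\<in>B. ell2_inner X F F' = (if F = F' then 1 else 0))"

text \<open>Completeness: the finite linear combinations of elements of \<open>B\<close> are dense in \<open>\<ell>\<^sup>2(X)\<close>.\<close>

definition complete_system :: "'a set \<Rightarrow> ('a \<Rightarrow> complex) set \<Rightarrow> bool"
  where "complete_system X B \<longleftrightarrow>
    (\<forall>F\<in>ell2 X. \<forall>\<epsilon>>0. \<exists>A c. finite A \<and> A \<subseteq> B \<and>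
       ell2_norm X (\<lambda>x. F x - (\<Sum>b\<in>A. c b * b x)) < \<epsilon>)"

definition eigenvector_on ::
  "'a set \<Rightarrow> (('a \<Rightarrow> complex) \<Rightarrow> 'a \<Rightarrow> complex) \<Rightarrow> ('a \<Rightarrow> complex) \<Rightarrow> bool"
  where "eigenvector_on X T F \<longleftrightarrow> F \<in> ell2 X \<and> F \<noteq> (\<lambda>_. 0) \<and> (\<exists>c. T F = (\<lambda>x. c * F x))"

definition pure_point_spectrum ::
  "'a set \<Rightarrow> (('a \<Rightarrow> complex) \<Rightarrow> 'a \<Rightarrow> complex) \<Rightarrow> bool"
  where "pure_point_spectrum X T \<longleftrightarrow>
    (\<exists>B. orthonormal_system X B \<and> complete_system X B \<and> (\<forall>F\<in>B. eigenvector_on X T F))"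

definition convolution_operator ::
  "('a, 'm) monoid_scheme \<Rightarrow> 'a pmf \<Rightarrow> ('a \<Rightarrow> complex) \<Rightarrow> 'a \<Rightarrow> complex"
  where "convolution_operator W p F = (\<lambda>x.
    if x \<in> carrier W
    then \<Sum>\<^sub>\<infinity>y\<in>carrier W. F y * of_real (pmf p (inv\<^bsub>W\<^esub> y \<otimes>\<^bsub>W\<^esub> x))
    else 0)"


section \<open>Cayley graphs and planar lattices\<close>

text \<open>A graph is a pair of a vertex set and a set of unoriented edges; a loop at \<open>x\<close> is the
  edge \<open>{x}\<close>.\<close>

type_synonym 'a graph = "'a set \<times> 'a set set"

definition cayley_graph :: "('a, 'm) monoid_scheme \<Rightarrow> 'a set \<Rightarrow> 'a graph"
  where "cayley_graph G S = (carrier G, {{x, x \<otimes>\<^bsub>G\<^esub> s} | x s. x \<in> carrier G \<and> s \<in> S})"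

definition graph_isomorphic :: "'a graph \<Rightarrow> 'b graph \<Rightarrow> bool"
  where "graph_isomorphic \<Gamma> \<Gamma>' \<longleftrightarrow>
    (\<exists>f. bij_betw f (fst \<Gamma>) (fst \<Gamma>') \<and> (\<lambda>e. f ` e) ` snd \<Gamma> = snd \<Gamma>')"

text \<open>The lattice \<open>\<int> + \<int>\<omega>\<close> in the plane, with edges between points at distance 1: the square
  lattice for \<open>\<omega> = \<i>\<close>, the triangular lattice for \<open>\<omega> = exp(\<i>\<pi>/3)\<close>.\<close>

definition unit_distance_lattice :: "complex \<Rightarrow> complex graph"
  where "unit_distance_lattice \<omega> =
    (let V = {of_int a + of_int b * \<omega> | a b. True}
     in (V, {{u, v} | u v. u \<in> V \<and> v \<in> V \<and> dist u v = 1}))"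

definition square_lattice :: "complex graph"
  where "square_lattice = unit_distance_lattice \<i>"

definition triangular_lattice :: "complex graph"
  where "triangular_lattice = unit_distance_lattice (cis (pi / 3))"

abbreviation Z2 :: "(int \<times> int) monoid"
  where "Z2 \<equiv> integer_group \<times>\<times> integer_group"

end

theory Submission
  imports Defs "HOL-Computational_Algebra.Fundamental_Theorem_Algebra"
begin

text \<open>Let \<open>n = |H|\<close>. The walk averages the lamp at its position, so a vector that is mean-free in the lamp at a
  site cannot be carried there. Splitting the point mass at every lamp of a finite set \<open>A\<close> into its mean
  (squared norm \<open>1/n\<close>) and the mean-free rest writes a basis vector as an orthogonal sum over \<open>S \<subseteq> A\<close>, the
  squared norms being the weights of site percolation with density \<open>1/n\<close>. If the open cluster of the walker
  does not reach the boundary of \<open>A\<close>, the summand lies in a finite-dimensional invariant space of finitely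
  supported functions, hence is a sum of eigenvectors. So the spectrum is pure point as soon as the
  cluster of a site is almost surely finite at density \<open>1/n \<le> 1/2\<close>.

  By monotonicity it is enough to treat density \<open>1/2\<close> on the triangular lattice. If clusters could be infinite
  there, a zero-one argument in finite volume makes a large hexagon connected to infinity with probability
  close to 1. Harris' inequality (square-root trick), the sixfold symmetry and the symmetry between open and
  closed sites then give six alternating open and closed arms with probability at least \<open>1/2\<close>. In the plane the
  closed arms separate the three open ones, so hexagons with positive density are trifurcations, which
  contradicts the Burton--Keane bound by the size of the boundary.\<close>

section \<open>Expectations over random subsets\<close>

text \<open>Every probability is the finite weighted sum \<open>bexp\<close>, so no infinite-volume
  measure and no infinite cluster appears: percolation means that the chance to leave a finite
  region stays above a positive bound. The classical route proves uniqueness of the infinite cluster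
  first and then contradicts it with four arms; here six arms produce three separated branches
  directly, so uniqueness needs no proof of its own. The triangular lattice serves both graphs: in
  coordinates the unit vectors of the square lattice are four of its six directions, and extra edges
  can only help an escape. At density 1/2, and only there, open and closed sites may be exchanged,
  hence the reduction to that density. Planarity enters only through \<open>paths_cross\<close>,
  where a signed crossing count replaces a Jordan curve theorem. The bound \<open>1/12\<close> per
  missing arm makes six failures sum to 1/2; the square-root trick over six sides turns it into
  \<open>(1/12) ^ 6\<close>. Since all eigenvectors found are finitely supported, the spectral part
  is linear algebra plus an approximation of point masses.\<close>

definition bexp :: "real \<Rightarrow> 'a set \<Rightarrow> ('a set \<Rightarrow> real) \<Rightarrow> real"
  where "bexp p A f = (\<Sum>S\<in>Pow A. p ^ card S * (1 - p) ^ card (A - S) * f S)"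

lemma bexp_empty [simp]: "bexp p {} f = f {}"
  by (simp add: bexp_def)

text \<open>Conditioning on the state of one site. The inductions on \<open>A\<close> below, Harris'
  inequality among them, run through this recursion.\<close>

lemma bexp_insert:
  assumes "finite A" "x \<notin> A"
  shows "bexp p (insert x A) f = p * bexp p A (\<lambda>S. f (insert x S)) + (1 - p) * bexp p A f"
proof -
  have inj: "inj_on (insert x) (Pow A)"
    using assms by (auto simp: inj_on_def)
  have disj: "Pow A \<inter> insert x ` Pow A = {}"
    using assms by auto
  have 1: "p ^ card (insert x S) * (1 - p) ^ card (insert x A - insert x S) * f (insert x S)
      = p * (p ^ card S * (1 - p) ^ card (A - S) * f (insert x S))" if "S \<in> Pow A" for S
  proof -
    have "insert x A - insert x S = A - S" "x \<notin> S" "finite S"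
      using that assms by (auto intro: finite_subset)
    then show ?thesis by simp
  qed
  have 2: "p ^ card S * (1 - p) ^ card (insert x A - S) * f S
      = (1 - p) * (p ^ card S * (1 - p) ^ card (A - S) * f S)" if "S \<in> Pow A" for S
  proof -
    have "insert x A - S = insert x (A - S)" "x \<notin> A - S" "finite (A - S)"
      using that assms by auto
    then show ?thesis by simp
  qed
  have "bexp p (insert x A) f
      = (\<Sum>S\<in>Pow A. p ^ card S * (1 - p) ^ card (insert x A - S) * f S)
      + (\<Sum>S\<in>Pow A. p ^ card (insert x S) * (1 - p) ^ card (insert x A - insert x S) * f (insert x S))"
    unfolding bexp_def Pow_insert
    using assms disj by (subst sum.union_disjoint) (auto simp: sum.reindex[OF inj] o_def)
  also have "\<dots> = (1 - p) * bexp p A f + p * bexp p A (\<lambda>S. f (insert x S))"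
    unfolding bexp_def sum_distrib_left
    by (intro arg_cong2[where f = "(+)"] sum.cong refl) (fact 2, fact 1)
  finally show ?thesis by simp
qed

lemma bexp_cong:
  assumes "\<And>S. S \<subseteq> A \<Longrightarrow> f S = g S"
  shows "bexp p A f = bexp p A g"
  unfolding bexp_def using assms by (intro sum.cong) auto

lemma bexp_diff: "bexp p A (\<lambda>S. f S - g S) = bexp p A f - bexp p A g"
  by (simp add: bexp_def algebra_simps sum_subtractf)

lemma bexp_cmult: "bexp p A (\<lambda>S. c * f S) = c * bexp p A f"
  by (simp add: bexp_def sum_distrib_left algebra_simps)

lemma bexp_sum: "bexp p A (\<lambda>S. \<Sum>i\<in>I. f i S) = (\<Sum>i\<in>I. bexp p A (f i))"
  unfolding bexp_def sum_distrib_left by (rule sum.swap)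

lemma bexp_const [simp]:
  assumes "finite A" shows "bexp p A (\<lambda>_. c) = c"
  using assms by (induction A) (auto simp: bexp_insert algebra_simps)

lemma bexp_mono:
  assumes "0 \<le> p" "p \<le> 1" "\<And>S. S \<subseteq> A \<Longrightarrow> f S \<le> g S"
  shows "bexp p A f \<le> bexp p A g"
  unfolding bexp_def using assms by (intro sum_mono mult_left_mono) auto

text \<open>Sites outside \<open>A\<close> are averaged out one at a time, since the integrand does
  not see them.\<close>

lemma bexp_restrict:
  assumes "finite B" "A \<subseteq> B"
  shows "bexp p B (\<lambda>S. f (S \<inter> A)) = bexp p A f"
proof -
  have "finite C \<Longrightarrow> A \<inter> C = {} \<Longrightarrow> bexp p (C \<union> A) (\<lambda>S. f (S \<inter> A)) = bexp p A f" for C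
  proof (induction C rule: finite_induct)
    case empty
    then show ?case by (auto intro!: bexp_cong simp: Int_absorb2)
  next
    case (insert x C)
    then have "insert x S \<inter> A = S \<inter> A" for S by auto
    moreover have "x \<notin> C \<union> A" "finite (C \<union> A)"
      using insert assms by (auto intro: finite_subset)
    ultimately show ?case
      using insert by (simp add: bexp_insert algebra_simps)
  qed
  moreover have "B - A \<union> A = B" using assms by auto
  ultimately show ?thesis using assms by (metis Diff_disjoint finite_Diff)
qed

lemma bexp_indep:
  assumes "finite A" "finite B" "A \<inter> B = {}"
  shows "bexp p (A \<union> B) (\<lambda>S. f (S \<inter> A) * g (S \<inter> B)) = bexp p A f * bexp p B g"
  using assms
proof (induction A arbitrary: f rule: finite_induct)
  case empty
  have "bexp p B (\<lambda>S. f {} * g (S \<inter> B)) = f {} * bexp p B g"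
    unfolding bexp_cmult by (simp add: bexp_restrict empty)
  then show ?case by simp
next
  case (insert x A)
  have x: "x \<notin> A \<union> B" "finite (A \<union> B)" using insert by auto
  have "bexp p (insert x (A \<union> B)) (\<lambda>S. f (S \<inter> insert x A) * g (S \<inter> B))
     = p * bexp p (A \<union> B) (\<lambda>S. f (insert x (S \<inter> A)) * g (S \<inter> B))
     + (1 - p) * bexp p (A \<union> B) (\<lambda>S. f (S \<inter> A) * g (S \<inter> B))"
  proof -
    have "bexp p (A \<union> B) (\<lambda>S. f (insert x S \<inter> insert x A) * g (insert x S \<inter> B))
        = bexp p (A \<union> B) (\<lambda>S. f (insert x (S \<inter> A)) * g (S \<inter> B))"
    proof (rule bexp_cong)
      fix S assume "S \<subseteq> A \<union> B"
      then have "insert x S \<inter> insert x A = insert x (S \<inter> A)" "insert x S \<inter> B = S \<inter> B"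
        using x insert.prems by auto
      then show "f (insert x S \<inter> insert x A) * g (insert x S \<inter> B) = f (insert x (S \<inter> A)) * g (S \<inter> B)"
        by simp
    qed
    moreover have "bexp p (A \<union> B) (\<lambda>S. f (S \<inter> insert x A) * g (S \<inter> B))
        = bexp p (A \<union> B) (\<lambda>S. f (S \<inter> A) * g (S \<inter> B))"
    proof (rule bexp_cong)
      fix S assume "S \<subseteq> A \<union> B"
      then have "S \<inter> insert x A = S \<inter> A" using x by auto
      then show "f (S \<inter> insert x A) * g (S \<inter> B) = f (S \<inter> A) * g (S \<inter> B)" by simp
    qed
    ultimately show ?thesis by (simp add: bexp_insert[OF x(2,1)])
  qed
  also have "\<dots> = bexp p (insert x A) f * bexp p B g"
    using insert.IH[of "\<lambda>S. f (insert x S)"] insert.IH[of f] insert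
    by (simp add: bexp_insert algebra_simps)
  finally show ?case by simp
qed

lemma bexp_mono_insert:
  assumes "0 \<le> p" "p \<le> 1" "mono f"
  shows "bexp p A f \<le> bexp p A (\<lambda>S. f (insert x S))"
  using assms by (intro bexp_mono) (auto intro: monoD)

text \<open>Conditioning on \<open>x\<close> splits the covariance into the two conditional
  covariances, nonnegative by induction, and \<open>p * (1 - p)\<close> times the product of the
  increments caused by opening \<open>x\<close>, nonnegative by monotonicity.\<close>

lemma harris:
  fixes f g :: "'a set \<Rightarrow> real"
  assumes "finite A" "0 \<le> p" "p \<le> 1" "mono f" "mono g"
  shows "bexp p A f * bexp p A g \<le> bexp p A (\<lambda>S. f S * g S)"
  using assms
proof (induction A arbitrary: f g rule: finite_induct)
  case empty
  then show ?case by simp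
next
  case (insert x A)
  let ?f = "\<lambda>S. f (insert x S)" and ?g = "\<lambda>S. g (insert x S)"
  have m: "mono ?f" "mono ?g"
    using insert.prems by (auto intro!: monoI elim!: monoD[OF _ insert_mono])
  have 1: "p * (bexp p A ?f * bexp p A ?g) \<le> p * bexp p A (\<lambda>S. ?f S * ?g S)"
    using insert m by (intro mult_left_mono) auto
  have 2: "(1 - p) * (bexp p A f * bexp p A g) \<le> (1 - p) * bexp p A (\<lambda>S. f S * g S)"
    using insert by (intro mult_left_mono) auto
  have "0 \<le> p * (1 - p) * ((bexp p A ?f - bexp p A f) * (bexp p A ?g - bexp p A g))"
    using insert.prems by (intro mult_nonneg_nonneg) (auto intro!: bexp_mono_insert)
  with 1 2 show ?case
    using insert by (simp add: bexp_insert algebra_simps)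
qed

text \<open>One site at a time: the induction hypothesis changes the density on \<open>A\<close> in
  both branches, then weight moves from \<open>x\<close> closed to \<open>x\<close> open, where the
  mean is no smaller.\<close>

lemma bexp_mono_prob:
  fixes f :: "'a set \<Rightarrow> real"
  assumes "finite A" "0 \<le> p" "p \<le> q" "q \<le> 1" "mono f"
  shows "bexp p A f \<le> bexp q A f"
  using assms
proof (induction A arbitrary: f rule: finite_induct)
  case empty
  then show ?case by simp
next
  case (insert x A)
  let ?f = "\<lambda>S. f (insert x S)"
  have m: "mono ?f"
    using insert.prems by (auto intro!: monoI elim!: monoD[OF _ insert_mono])
  have "p * bexp p A ?f + (1 - p) * bexp p A f \<le> p * bexp q A ?f + (1 - p) * bexp q A f"
    using insert m by (intro add_mono mult_left_mono) auto
  also have "\<dots> = bexp q A f + p * (bexp q A ?f - bexp q A f)" by (simp add: algebra_simps)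
  also have "\<dots> \<le> bexp q A f + q * (bexp q A ?f - bexp q A f)"
    using insert.prems bexp_mono_insert[of q f A x] by (intro add_left_mono mult_right_mono) auto
  finally show ?case
    using insert by (simp add: bexp_insert algebra_simps)
qed

text \<open>At density 1/2 all subsets of \<open>A\<close> have the same weight, so exchanging open
  and closed sites preserves expectations.\<close>

lemma bexp_half_compl:
  assumes "finite A"
  shows "bexp (1/2) A (\<lambda>S. f (A - S)) = bexp (1/2) A f"
proof -
  have 1: "(1/2) ^ card S * (1 - 1/2) ^ card (A - S) = (1/2 :: real) ^ card A" if "S \<subseteq> A" for S
    using that assms
    by (simp add: power_add[symmetric] card_Diff_subset finite_subset card_mono)
  have "bexp (1/2) A f = (\<Sum>S\<in>Pow A. (1/2) ^ card A * f S)"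
    unfolding bexp_def using 1 by (intro sum.cong) auto
  also have "\<dots> = (\<Sum>S\<in>Pow A. (1/2) ^ card A * f (A - S))"
    by (rule sum.reindex_bij_witness[where i = "\<lambda>S. A - S" and j = "\<lambda>S. A - S"])
       (auto simp: double_diff)
  also have "\<dots> = bexp (1/2) A (\<lambda>S. f (A - S))"
    unfolding bexp_def using 1 by (intro sum.cong) auto
  finally show ?thesis by simp
qed

lemma bexp_image:
  assumes "inj_on h A"
  shows "bexp p (h ` A) f = bexp p A (\<lambda>S. f (h ` S))"
proof -
  have "bexp p (h ` A) f
      = (\<Sum>S\<in>Pow A. p ^ card (h ` S) * (1 - p) ^ card (h ` A - h ` S) * f (h ` S))"
    unfolding bexp_def image_Pow_surj[OF refl, symmetric]
    by (subst sum.reindex) (use assms in \<open>auto simp: o_def inj_on_image_Pow\<close>)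
  also have "\<dots> = bexp p A (\<lambda>S. f (h ` S))"
    unfolding bexp_def
  proof (intro sum.cong refl)
    fix S assume S: "S \<in> Pow A"
    then have "h ` A - h ` S = h ` (A - S)" using assms by (auto simp: inj_on_def)
    moreover have "inj_on h S" "inj_on h (A - S)"
      using assms S by (auto intro: inj_on_subset)
    ultimately show "p ^ card (h ` S) * (1 - p) ^ card (h ` A - h ` S) * f (h ` S)
        = p ^ card S * (1 - p) ^ card (A - S) * f (h ` S)"
      by (simp add: card_image)
  qed
  finally show ?thesis .
qed

section \<open>Connectivity and the Burton--Keane count\<close>

text \<open>The start is checked once and each step checks its target, so the whole path lies in
  \<open>S\<close>.\<close>

definition conn :: "('a \<Rightarrow> 'a \<Rightarrow> bool) \<Rightarrow> 'a set \<Rightarrow> 'a \<Rightarrow> 'a \<Rightarrow> bool"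
  where "conn R S x y \<longleftrightarrow> x \<in> S \<and> (\<lambda>u v. R u v \<and> v \<in> S)\<^sup>*\<^sup>* x y"

lemma conn_refl [simp]: "conn R S x x \<longleftrightarrow> x \<in> S"
  by (auto simp: conn_def)

lemma conn_left: "conn R S x y \<Longrightarrow> x \<in> S"
  by (simp add: conn_def)

lemma conn_trans [trans]: "conn R S x y \<Longrightarrow> conn R S y z \<Longrightarrow> conn R S x z"
  by (auto simp: conn_def)

lemma conn_induct [consumes 1, case_names refl step]:
  assumes "conn R S x y" and "x \<in> S \<Longrightarrow> P x"
    and "\<And>y z. conn R S x y \<Longrightarrow> P y \<Longrightarrow> R y z \<Longrightarrow> z \<in> S \<Longrightarrow> P z"
  shows "P y"
proof -
  have x: "x \<in> S" and "(\<lambda>u v. R u v \<and> v \<in> S)\<^sup>*\<^sup>* x y"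
    using assms(1) by (auto simp: conn_def)
  from this(2) show ?thesis
  proof induction
    case base
    then show ?case using assms(2) x by blast
  next
    case (step y z)
    then show ?case using assms(3)[of y z] x by (simp add: conn_def)
  qed
qed

lemma conn_step: "conn R S x y \<Longrightarrow> R y z \<Longrightarrow> z \<in> S \<Longrightarrow> conn R S x z"
  by (auto simp: conn_def intro: rtranclp.rtrancl_into_rtrancl)

lemma conn_right: "conn R S x y \<Longrightarrow> y \<in> S"
  by (induction rule: conn_induct)

lemma conn_edge: "x \<in> S \<Longrightarrow> R x y \<Longrightarrow> y \<in> S \<Longrightarrow> conn R S x y"
  by (rule conn_step) auto

lemma conn_sym:
  assumes "symp R" "conn R S x y" shows "conn R S y x"
  using assms(2)
  by (induction rule: conn_induct)
     (auto intro: conn_trans[OF conn_edge] conn_right sympD[OF assms(1)])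

lemma conn_mono: "conn R S x y \<Longrightarrow> S \<subseteq> T \<Longrightarrow> conn R T x y"
  by (induction rule: conn_induct) (auto intro: conn_step)

lemma conn_image:
  assumes "conn R S x y" "\<And>u v. R u v \<Longrightarrow> R' (h u) (h v)"
  shows "conn R' (h ` S) (h x) (h y)"
  using assms(1) by (induction rule: conn_induct) (auto intro: conn_step assms(2))

text \<open>The path is cut after its last visit to \<open>B\<close>: whenever the induction steps
  out of \<open>B\<close>, the recorded tail starts afresh.\<close>

lemma conn_last_exit:
  assumes "conn R S x y" "x \<in> B" "y \<notin> B"
  shows "\<exists>u v. u \<in> B \<and> u \<in> S \<and> R u v \<and> conn R (S - B) v y"
  using assms(1,3)
proof (induction rule: conn_induct)
  case refl
  then show ?case using assms by simp
next
  case (step y z)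
  show ?case
  proof (cases "y \<in> B")
    case True
    then show ?thesis
      using step conn_right[OF step(1)] by (intro exI[of _ y] exI[of _ z]) auto
  next
    case False
    then show ?thesis using step by (meson DiffI conn_step)
  qed
qed

lemma conn_first_hit:
  assumes "conn R S x y" "x \<notin> B" "y \<in> B"
  shows "\<exists>u v. conn R (S - B) x u \<and> R u v \<and> v \<in> B \<and> v \<in> S"
proof -
  have "conn R (S - B) x y \<or> (\<exists>u v. conn R (S - B) x u \<and> R u v \<and> v \<in> B \<and> v \<in> S)"
    using assms(1)
    by (induction rule: conn_induct) (use assms(2) in \<open>auto intro: conn_step\<close>)
  then show ?thesis using assms(3) conn_right by fastforce
qed

text \<open>A path can enter or leave the component \<open>D\<close> of \<open>W - A\<close> only
  through \<open>A\<close>. As \<open>A\<close> is connected and misses both \<open>B\<close> and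
  \<open>D\<close>, each excursion into \<open>D\<close> is replaced by a path inside
  \<open>A\<close>. The induction remembers, while inside \<open>D\<close>, a point of
  \<open>A\<close> already reached outside \<open>D\<close>.\<close>

lemma conn_reroute:
  assumes "symp R" "conn R (W - B) x z" "x \<notin> D" "z \<notin> D"
    and D: "D = {w. conn R (W - A) y w}"
    and A: "A \<subseteq> W - B" "\<And>a b. a \<in> A \<Longrightarrow> b \<in> A \<Longrightarrow> conn R A a b"
  shows "conn R (W - B - D) x z"
proof -
  have AD: "A \<inter> D = {}" using D conn_right by fastforce
  have enter: "w' \<in> A" if "w \<in> D" "w' \<in> W" "w' \<notin> D" "R w w'" for w w'
    using that D conn_step by fastforce
  have "(z \<notin> D \<longrightarrow> conn R (W - B - D) x z) \<and> (z \<in> D \<longrightarrow> (\<exists>a\<in>A. conn R (W - B - D) x a))"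
    using assms(2)
  proof (induction rule: conn_induct)
    case refl
    then show ?case using assms(3) by simp
  next
    case (step w w')
    show ?case
    proof (cases "w \<in> D")
      case True
      then obtain a where a: "a \<in> A" "conn R (W - B - D) x a" using step by blast
      have "conn R (W - B - D) x w'" if "w' \<notin> D"
      proof -
        have "w' \<in> A" using enter[OF True _ that] step by auto
        then have "conn R A a w'" using a A by blast
        then have "conn R (W - B - D) a w'" by (rule conn_mono) (use A AD in auto)
        with a show ?thesis by (blast intro: conn_trans)
      qed
      then show ?thesis using a by blast
    next
      case False
      then have c: "conn R (W - B - D) x w" using step by blast
      have "w \<in> A" if "w' \<in> D"
        using enter[OF that _ False] conn_right[OF c] \<open>symp R\<close> step by (auto dest: sympD)
      then show ?thesis using c step by (auto intro: conn_step)
    qed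
  qed
  then show ?thesis using assms(4) by blast
qed

section \<open>Trifurcating sets and their number\<close>

definition touches :: "('a \<Rightarrow> 'a \<Rightarrow> bool) \<Rightarrow> 'a set \<Rightarrow> 'a set \<Rightarrow> 'a \<Rightarrow> bool"
  where "touches R W B y \<longleftrightarrow> (\<exists>u x. u \<in> B \<and> R u x \<and> conn R (W - B) x y)"

text \<open>The classical trifurcation point is widened to a set \<open>B\<close>: its removal
  leaves three different branches attached to \<open>B\<close>, each containing a point of the
  target set \<open>Y\<close>, later the boundary of a large hexagon.\<close>

definition trifurcates :: "('a \<Rightarrow> 'a \<Rightarrow> bool) \<Rightarrow> 'a set \<Rightarrow> 'a set \<Rightarrow> 'a set \<Rightarrow> bool"
  where "trifurcates R W Y B \<longleftrightarrow> (\<exists>y1 y2 y3. {y1, y2, y3} \<subseteq> Y \<and>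
    (\<forall>y\<in>{y1, y2, y3}. touches R W B y) \<and>
    \<not> conn R (W - B) y1 y2 \<and> \<not> conn R (W - B) y1 y3 \<and> \<not> conn R (W - B) y2 y3)"

text \<open>Each of \<open>a\<close> and \<open>b\<close> lies in at most one of the three branches,
  so some branch contains neither.\<close>

lemma trifurcates_avoid:
  assumes "symp R" "trifurcates R W Y B"
  obtains y where "y \<in> Y" "touches R W B y" "\<not> conn R (W - B) y a" "\<not> conn R (W - B) y b"
proof -
  note sym = conn_sym[OF assms(1)]
  obtain y1 y2 y3 where y: "{y1, y2, y3} \<subseteq> Y" "\<forall>y\<in>{y1, y2, y3}. touches R W B y"
    "\<not> conn R (W - B) y1 y2" "\<not> conn R (W - B) y1 y3" "\<not> conn R (W - B) y2 y3"
    using assms(2) unfolding trifurcates_def by blast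
  have "\<not> (conn R (W - B) u a \<and> conn R (W - B) v a)" if "\<not> conn R (W - B) u v" for u v a
    using that sym conn_trans[of R "W - B" u a v] by blast
  then show ?thesis using y that by (metis insert_subset insertI1 insertCI)
qed

text \<open>Walk inside \<open>B\<close> from \<open>b\<close> to the vertex where the branch is
  attached, then inside the branch to \<open>w\<close>; both pieces lie in \<open>T\<close>.\<close>

lemma touch_connected:
  assumes "touches R W B y" "B \<subseteq> T" "W - B \<subseteq> T \<or> {w. conn R (W - B) y w} \<subseteq> T"
    and "symp R" "\<And>a b. a \<in> B \<Longrightarrow> b \<in> B \<Longrightarrow> conn R B a b" "b \<in> B" "conn R (W - B) y w"
  shows "conn R T b w"
proof -
  obtain u x where ux: "u \<in> B" "R u x" "conn R (W - B) x y"
    using assms(1) unfolding touches_def by blast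
  let ?D = "{w. conn R (W - B) y w}"
  have yx: "conn R (W - B) y x" using conn_sym[OF assms(4) ux(3)] .
  have D: "conn R ?D y v" if "conn R (W - B) y v" for v
    using that
  proof (induction rule: conn_induct)
    case refl then show ?case by simp
  next
    case (step v z)
    then show ?case by (auto intro: conn_step)
  qed
  have DT: "?D \<subseteq> T" using assms(3) conn_right by fastforce
  have "conn R T b u" using assms(5)[OF assms(6) ux(1)] assms(2) by (rule conn_mono)
  also have "conn R T u x" using ux assms(2) DT yx by (intro conn_edge) auto
  also have "conn R T x y"
    using conn_mono[OF conn_sym[OF assms(4) D[OF yx]] DT] .
  also have "conn R T y w"
    using conn_mono[OF D[OF assms(7)] DT] .
  finally show ?thesis .
qed

text \<open>Induction on \<open>I\<close>: take a component \<open>E\<close> of some \<open>W - B i\<close> of least size. It contains no other \<open>B j\<close>,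
  so deleting \<open>E\<close> together with the index \<open>i\<close> loses a point of \<open>Y\<close> and keeps the other trifurcations.\<close>

lemma card_trifurcations_le:
  assumes R: "symp R" and "finite W" "finite I" "finite Y"
    and B: "\<And>i. i \<in> I \<Longrightarrow> B i \<noteq> {}" "\<And>i. i \<in> I \<Longrightarrow> B i \<subseteq> W"
      "\<And>i a b. i \<in> I \<Longrightarrow> a \<in> B i \<Longrightarrow> b \<in> B i \<Longrightarrow> conn R (B i) a b"
      "\<And>i j. i \<in> I \<Longrightarrow> j \<in> I \<Longrightarrow> i \<noteq> j \<Longrightarrow> B i \<inter> B j = {}"
    and "\<And>i. i \<in> I \<Longrightarrow> trifurcates R W Y (B i)"
  shows "card I \<le> card Y"
  using assms(3,2,4-)
proof (induction "card I" arbitrary: I W Y)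
  case 0
  then show ?case by simp
next
  case (Suc n)
  note sym = conn_sym[OF R]
  note B = Suc.prems(4-7) and tri = Suc.prems(8)
  define D where "D = (\<lambda>(i, y). {w. conn R (W - B i) y w})"
  have finD: "finite (D p)" for p
    unfolding D_def using \<open>finite W\<close>
    by (cases p) (auto dest: conn_right intro: finite_subset[of _ W])
  define Q where "Q = (\<lambda>(i, y). i \<in> I \<and> y \<in> Y \<and> touches R W (B i) y)"
  obtain i0 where "i0 \<in> I" using Suc by fastforce
  then have "\<exists>p. Q p"
    using trifurcates_avoid[OF R tri] unfolding Q_def by (metis (mono_tags, lifting) case_prodI)
  \<comment> \<open>Minimality ranges over the branches at all indices, which is what excludes a
    smaller branch at some other \<open>j\<close> below.\<close>
  then obtain p where p: "Q p" "\<And>q. Q q \<Longrightarrow> card (D p) \<le> card (D q)"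
    using ex_has_least_nat[of Q _ "\<lambda>p. card (D p)"] by blast
  obtain i y where iy: "p = (i, y)" by fastforce
  define E where "E = D p"
  have E: "E = {w. conn R (W - B i) y w}" by (simp add: E_def D_def iy)
  have i: "i \<in> I" "y \<in> Y" "touches R W (B i) y" using p(1) by (auto simp: Q_def iy)
  have yE: "y \<in> E" using i(3) by (auto simp: E touches_def dest: conn_right)
  have in_E: "v \<in> E" if "u \<in> E" "conn R (W - B i) u v" for u v
    using that unfolding E by (auto intro: conn_trans)
  \<comment> \<open>If \<open>B j\<close> met \<open>E\<close> it would lie inside \<open>E\<close>.
    A branch at \<open>j\<close> avoiding \<open>B i\<close> would then be a proper subset of
    \<open>E\<close>, since it omits \<open>B j\<close>, against minimality.\<close>
  have sep: "B j \<inter> E = {}" if j: "j \<in> I" for j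
  proof (rule ccontr)
    assume "B j \<inter> E \<noteq> {}"
    then obtain b where b: "b \<in> B j" "b \<in> E" by blast
    have "j \<noteq> i" using b unfolding E by (auto dest: conn_right)
    then have disj: "B j \<inter> B i = {}" using B(4) i j by blast
    have BjE: "B j \<subseteq> E"
      using in_E[OF b(2)] B(3)[OF j b(1)] conn_mono[of R "B j" b _ "W - B i"] B(2)[OF j] disj
      by blast
    obtain a where a: "a \<in> B i" using B(1) i by blast
    obtain y' where y': "y' \<in> Y" "touches R W (B j) y'" "\<not> conn R (W - B j) y' a"
      using trifurcates_avoid[OF R tri[OF j]] by metis
    let ?E = "{w. conn R (W - B j) y' w}"
    have Ei: "?E \<inter> B i = {}"
    proof -
      have "conn R (W - B j) c a" if "c \<in> B i" for c
        by (rule conn_mono[OF B(3)[OF i(1) that a]]) (use B(2)[OF i(1)] disj in blast)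
      then show ?thesis using y'(3) by (auto intro: conn_trans)
    qed
    have "?E \<subseteq> E"
    proof
      fix w assume "w \<in> ?E"
      then have w: "conn R (W - B j) y' w" by simp
      have "conn R (W - B i) b w"
      proof (rule touch_connected[OF y'(2) _ disjI2 R B(3)[OF j] b(1) w])
        show "B j \<subseteq> W - B i" using B(2)[OF j] disj by blast
        show "?E \<subseteq> W - B i" using Ei by (auto dest: conn_right)
      qed
      then show "w \<in> E" using in_E b by blast
    qed
    moreover have "b \<notin> ?E" using b(1) by (auto dest: conn_right)
    ultimately have "?E \<subset> E" using b by blast
    then have "card ?E < card E" using finD[of p] unfolding E_def by (rule psubset_card_mono[rotated])
    moreover have "card E \<le> card ?E"
      using p(2)[of "(j, y')"] y' j unfolding E_def by (simp add: Q_def D_def)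
    ultimately show False by simp
  qed
  have "card (I - {i}) \<le> card (Y - E)"
  proof (rule Suc.hyps(1))
    show "n = card (I - {i})" using Suc i by simp
    show "finite (I - {i})" "finite (W - E)" "finite (Y - E)" using Suc.prems by auto
    show "B j \<noteq> {}" "B j \<subseteq> W - E" "\<And>a b. a \<in> B j \<Longrightarrow> b \<in> B j \<Longrightarrow> conn R (B j) a b"
      if "j \<in> I - {i}" for j
      using that B sep by blast+
    show "B j \<inter> B k = {}" if "j \<in> I - {i}" "k \<in> I - {i}" "j \<noteq> k" for j k
      using that B(4) by blast
    show "trifurcates R (W - E) (Y - E) (B j)" if "j \<in> I - {i}" for j
    proof -
      have j: "j \<in> I" "j \<noteq> i" using that by auto
      have disj: "B j \<inter> B i = {}" using B(4) i j by blast
      have WE: "W - E - B j = W - B j - E" by blast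
      have Bi: "B i \<subseteq> W - B j" using B(2)[OF i(1)] disj by blast
      have rer: "conn R (W - B j - E) u v" if "conn R (W - B j) u v" "u \<notin> E" "v \<notin> E" for u v
        by (rule conn_reroute[OF R that E Bi B(3)[OF i(1)]])
      obtain b where b: "b \<in> B j" using B(1) j by blast
      \<comment> \<open>A substitute for points of \<open>Y\<close> lost with \<open>E\<close>:
        \<open>y0\<close> lies on another branch at \<open>i\<close>, one that avoids
        \<open>B j\<close>, and is joined through \<open>B i\<close> to all of \<open>E\<close>
        without meeting \<open>B j\<close>.\<close>
      obtain y0 where y0: "y0 \<in> Y" "touches R W (B i) y0"
          "\<not> conn R (W - B i) y0 y" "\<not> conn R (W - B i) y0 b"
        using trifurcates_avoid[OF R tri[OF i(1)]] by metis
      have y0E: "y0 \<notin> E" using y0(3) sym unfolding E by blast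
      have D0: "{w. conn R (W - B i) y0 w} \<subseteq> W - B j"
      proof -
        have "conn R (W - B i) c b" if "c \<in> B j" for c
          by (rule conn_mono[OF B(3)[OF j(1) that b]]) (use B(2)[OF j(1)] disj in blast)
        then show ?thesis using y0(4) by (auto intro: conn_trans dest: conn_right)
      qed
      have i_y0: "conn R (W - B j) c y0" if "c \<in> B i" for c
      proof (rule touch_connected[OF y0(2) Bi disjI2[OF D0] R B(3)[OF i(1)] that])
        show "conn R (W - B i) y0 y0" using y0(2) by (auto simp: touches_def dest: conn_right)
      qed
      have i_y: "conn R (W - B j) c w" if "c \<in> B i" "w \<in> E" for c w
      proof (rule touch_connected[OF i(3) Bi _ R B(3)[OF i(1)] that(1)])
        show "W - B i \<subseteq> W - B j \<or> {w. conn R (W - B i) y w} \<subseteq> W - B j"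
          using sep[OF j(1)] unfolding E by (auto dest: conn_right)
        show "conn R (W - B i) y w" using that(2) by (simp add: E)
      qed
      \<comment> \<open>Each branch at \<open>j\<close> keeps a point of \<open>Y\<close> outside
        \<open>E\<close>: its own point, or \<open>y0\<close> if that point was in \<open>E\<close>.
        The connection is rerouted around \<open>E\<close> through \<open>B i\<close>.\<close>
      have move: "\<exists>y'\<in>Y - E. conn R (W - B j) z y' \<and> touches R (W - E) (B j) y'"
        if z: "z \<in> Y" "touches R W (B j) z" for z
      proof -
        obtain u x where ux: "u \<in> B j" "R u x" "conn R (W - B j) x z"
          using z(2) unfolding touches_def by blast
        have xE: "x \<notin> E"
        proof
          assume "x \<in> E"
          then have "conn R (W - B i) x u"
            using ux(1,2) B(2)[OF j(1)] disj R
            by (intro conn_edge) (auto simp: E dest: conn_right sympD)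
          then show False using in_E[OF \<open>x \<in> E\<close>] sep[OF j(1)] ux(1) by blast
        qed
        obtain y' where y': "y' \<in> Y - E" "conn R (W - B j) z y'"
        proof (cases "z \<in> E")
          case False
          then show ?thesis using that z ux by (auto dest: conn_right)
        next
          case True
          obtain c where c: "c \<in> B i" using B(1) i by blast
          have "conn R (W - B j) z y0" using sym[OF i_y[OF c True]] i_y0[OF c] by (rule conn_trans)
          then show ?thesis using that y0 y0E by blast
        qed
        have "conn R (W - B j - E) x y'"
          using rer[OF conn_trans[OF ux(3) y'(2)] xE] y'(1) by blast
        then show ?thesis using y' ux unfolding touches_def WE by blast
      qed
      obtain y1 y2 y3 where y: "{y1, y2, y3} \<subseteq> Y" "\<forall>y\<in>{y1, y2, y3}. touches R W (B j) y"
        "\<not> conn R (W - B j) y1 y2" "\<not> conn R (W - B j) y1 y3" "\<not> conn R (W - B j) y2 y3"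
        using tri[OF j(1)] unfolding trifurcates_def by blast
      obtain z1 where z1: "z1 \<in> Y - E" "conn R (W - B j) y1 z1" "touches R (W - E) (B j) z1"
        using move[of y1] y by auto
      obtain z2 where z2: "z2 \<in> Y - E" "conn R (W - B j) y2 z2" "touches R (W - E) (B j) z2"
        using move[of y2] y by auto
      obtain z3 where z3: "z3 \<in> Y - E" "conn R (W - B j) y3 z3" "touches R (W - E) (B j) z3"
        using move[of y3] y by auto
      \<comment> \<open>Separation survives because deleting \<open>E\<close> only removes
        connections and each new point lies in the old component of the point it replaces.\<close>
      have tr: "\<not> conn R (W - E - B j) v v'"
        if "\<not> conn R (W - B j) u u'" "conn R (W - B j) u v" "conn R (W - B j) u' v'" for u u' v v'
      proof
        assume "conn R (W - E - B j) v v'"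
        then have "conn R (W - B j) v v'" by (rule conn_mono) auto
        then have "conn R (W - B j) u u'" using that(2,3) sym conn_trans by metis
        then show False using that(1) by simp
      qed
      show ?thesis unfolding trifurcates_def
        using z1 z2 z3 tr[OF y(3) z1(2) z2(2)] tr[OF y(4) z1(2) z3(2)] tr[OF y(5) z2(2) z3(2)]
        by (intro exI[of _ z1] exI[of _ z2] exI[of _ z3]) auto
    qed
  qed
  also have "card (Y - E) < card Y"
    using \<open>finite Y\<close> i yE by (intro psubset_card_mono) auto
  finally show ?case using i Suc by simp
qed

section \<open>The triangular lattice\<close>

text \<open>Coordinates are taken with respect to 1 and \<open>cis (pi / 3)\<close>; the six
  differences are then the unit vectors of the triangular lattice.\<close>

definition tadj :: "int \<times> int \<Rightarrow> int \<times> int \<Rightarrow> bool"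
  where "tadj u v \<longleftrightarrow> v - u \<in> {(1, 0), (-1, 0), (0, 1), (0, -1), (1, -1), (-1, 1)}"

text \<open>The forms are listed in cyclic order, so that \<open>lf k w = n\<close> cuts out side
  \<open>k\<close> of the hexagon of radius \<open>n\<close>. Corners belong to two sides.\<close>

definition lf :: "nat \<Rightarrow> int \<times> int \<Rightarrow> int"
  where "lf k w = [fst w, fst w + snd w, snd w, - fst w, - fst w - snd w, - snd w] ! k"

text \<open>The maximum of the six forms \<open>lf k\<close>, a norm whose balls are
  hexagons.\<close>

definition hnorm :: "int \<times> int \<Rightarrow> int"
  where "hnorm w = max \<bar>fst w\<bar> (max \<bar>snd w\<bar> \<bar>fst w + snd w\<bar>)"

definition hexagon :: "int \<times> int \<Rightarrow> nat \<Rightarrow> (int \<times> int) set"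
  where "hexagon z n = {w. hnorm (w - z) \<le> int n}"

text \<open>Multiplication by \<open>cis (pi / 3)\<close> in these coordinates: a turn by 60
  degrees, taking side \<open>k\<close> to the next one.\<close>

definition rot :: "int \<times> int \<Rightarrow> int \<times> int"
  where "rot w = (- snd w, fst w + snd w)"

lemma less_6: "k < (6::nat) \<longleftrightarrow> k = 0 \<or> k = 1 \<or> k = 2 \<or> k = 3 \<or> k = 4 \<or> k = 5"
  by auto

lemma lf_simps [simp]:
  "lf 0 w = fst w" "lf 1 w = fst w + snd w" "lf (Suc 0) w = fst w + snd w" "lf 2 w = snd w"
  "lf 3 w = - fst w" "lf 4 w = - fst w - snd w" "lf 5 w = - snd w"
  by (simp_all add: lf_def eval_nat_numeral)

lemma tadj_iff:
  "tadj (a, b) w \<longleftrightarrow> w = (a + 1, b) \<or> w = (a - 1, b) \<or> w = (a, b + 1) \<or> w = (a, b - 1)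
    \<or> w = (a + 1, b - 1) \<or> w = (a - 1, b + 1)"
  by (cases w) (simp add: tadj_def diff_eq_eq add.commute)

lemma tadj_cases [consumes 1]:
  assumes "tadj u w"
  obtains a b where "u = (a, b)" "w = (a + 1, b)" | a b where "u = (a, b)" "w = (a - 1, b)"
  | a b where "u = (a, b)" "w = (a, b + 1)" | a b where "u = (a, b)" "w = (a, b - 1)"
  | a b where "u = (a, b)" "w = (a + 1, b - 1)" | a b where "u = (a, b)" "w = (a - 1, b + 1)"
  using assms by (cases u) (auto simp: tadj_iff)

lemma tadj_sym: "tadj u v \<Longrightarrow> tadj v u"
  by (erule tadj_cases) (simp_all add: tadj_iff)

lemma symp_tadj: "symp tadj"
  by (auto intro: sympI tadj_sym)

lemma tadj_translate [simp]: "tadj (u + z) (v + z) \<longleftrightarrow> tadj u v" "tadj (u - z) (v - z) \<longleftrightarrow> tadj u v"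
  by (simp_all add: tadj_def)

lemma tadj_rot: "tadj u v \<Longrightarrow> tadj (rot u) (rot v)"
  by (erule tadj_cases) (simp_all add: tadj_iff rot_def)

lemma lf_rot: "k < 6 \<Longrightarrow> lf (Suc k mod 6) (rot w) = lf k w"
  by (elim less_6[THEN iffD1, elim_format] disjE) (simp_all add: rot_def numeral_2_eq_2[symmetric])

lemma lf_le_hnorm: "k < 6 \<Longrightarrow> lf k w \<le> hnorm w"
  by (auto simp: less_6 hnorm_def)

lemma hnorm_le_iff:
  "hnorm w \<le> c \<longleftrightarrow> fst w \<le> c \<and> - fst w \<le> c \<and> snd w \<le> c \<and> - snd w \<le> c
    \<and> fst w + snd w \<le> c \<and> - fst w - snd w \<le> c"
  by (auto simp: hnorm_def abs_le_iff)

lemma hnorm_attained: "\<exists>k<6. lf k w = hnorm w"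
proof -
  have "\<exists>k\<in>{0, 1, 2, 3, 4, 5}. lf k w = hnorm w"
    by (simp add: hnorm_def) linarith
  then obtain k where "k \<in> {0, 1, 2, 3, 4, 5}" "lf k w = hnorm w" by blast
  then show ?thesis by (intro exI[of _ k]) auto
qed

lemma hnorm_nonneg [simp]: "0 \<le> hnorm w" by (simp add: hnorm_def)

lemma hnorm_eq_0 [simp]: "hnorm w = 0 \<longleftrightarrow> w = 0"
  by (cases w) (simp add: hnorm_def zero_prod_def, arith)

lemma hnorm_0 [simp]: "hnorm 0 = 0" by simp

lemma hnorm_minus [simp]: "hnorm (- w) = hnorm w"
proof -
  have "\<bar>- fst w - snd w\<bar> = \<bar>fst w + snd w\<bar>" by arith
  then show ?thesis by (simp add: hnorm_def)
qed

lemma hnorm_triangle: "hnorm (u + v) \<le> hnorm u + hnorm v"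
  using order_refl[of "hnorm u"] order_refl[of "hnorm v"] unfolding hnorm_le_iff by simp

lemma hnorm_rot [simp]: "hnorm (rot w) = hnorm w"
  by (simp add: hnorm_def rot_def max.commute max.left_commute)

lemma hnorm_tadj:
  assumes "tadj u v" shows "hnorm v \<le> hnorm u + 1"
  using assms order_refl[of "hnorm u"] unfolding hnorm_le_iff
  by (cases rule: tadj_cases) simp_all

lemma hnorm_tadj': "tadj u v \<Longrightarrow> hnorm (v - z) \<le> hnorm (u - z) + 1"
  using hnorm_tadj[of "u - z" "v - z"] by simp

lemma ex_outward:
  assumes "k < 6" shows "\<exists>v. tadj u v \<and> (\<forall>z. lf k (v - z) = lf k (u - z) + 1)"
proof -
  define D :: "(int \<times> int) list" where
    "D = [(1, 0), (1, 0), (0, 1), (- 1, 0), (- 1, 0), (0, - 1)]"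
  have "tadj u (u + D ! k) \<and> (\<forall>z. lf k (u + D ! k - z) = lf k (u - z) + 1)"
    using assms unfolding less_6 by (elim disjE) (simp_all add: D_def tadj_def)
  then show ?thesis by blast
qed

lemma center_in_hexagon [simp]: "z \<in> hexagon z n"
  by (simp add: hexagon_def)

lemma finite_hexagon [simp]: "finite (hexagon z n)"
proof -
  have "hexagon z n \<subseteq> {fst z - int n..fst z + int n} \<times> {snd z - int n..snd z + int n}"
    by (auto simp: hexagon_def hnorm_def)
  then show ?thesis by (rule finite_subset) auto
qed

lemma hexagon_translate: "hexagon z n = (\<lambda>w. w + z) ` hexagon 0 n"
  unfolding hexagon_def by (force simp: image_iff intro: exI[of _ "_ - z"])

lemma hexagon_subset: "hnorm (z - z') + int n \<le> int m \<Longrightarrow> hexagon z n \<subseteq> hexagon z' m"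
proof
  fix w assume "hnorm (z - z') + int n \<le> int m" "w \<in> hexagon z n"
  then show "w \<in> hexagon z' m"
    using hnorm_triangle[of "z - z'" "w - z"] by (simp add: hexagon_def)
qed

lemma hexagon_disjoint: "int n + int m < hnorm (z - z') \<Longrightarrow> hexagon z n \<inter> hexagon z' m = {}"
proof (rule equals0I)
  fix w assume "int n + int m < hnorm (z - z')" "w \<in> hexagon z n \<inter> hexagon z' m"
  then show False
    using hnorm_triangle[of "- (w - z)" "w - z'"] hnorm_minus[of "w - z"]
    by (simp add: hexagon_def)
qed

lemma hexagon_connected:
  assumes "u \<in> hexagon z n" "v \<in> hexagon z n"
  shows "conn tadj (hexagon z n) u v"
proof -
  have 1: "conn tadj (hexagon z n) u z" if "u \<in> hexagon z n" for u
    using that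
  proof (induction "nat (\<bar>fst (u - z)\<bar> + \<bar>snd (u - z)\<bar>)" arbitrary: u rule: less_induct)
    case less
    define a b where "a = fst (u - z)" and "b = snd (u - z)"
    \<comment> \<open>A step towards the centre. With opposite signs the diagonal step shrinks both
      coordinates and keeps their sum, otherwise an axis step is taken; \<open>hnorm\<close> never
      grows.\<close>
    define d where "d = (if a > 0 \<and> b < 0 then (-1, 1) else if a < 0 \<and> b > 0 then (1, -1)
      else if a > 0 then (-1, 0) else if a < 0 then (1, 0) else if b > 0 then (0, -1)
      else (0, 1 :: int) :: int \<times> int)"
    show ?case
    proof (cases "u = z")
      case False
      then have ne: "a \<noteq> 0 \<or> b \<noteq> 0" by (auto simp: a_def b_def prod_eq_iff)
      then have "\<bar>a + fst d\<bar> + \<bar>b + snd d\<bar> < \<bar>a\<bar> + \<bar>b\<bar>"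
        by (simp add: d_def) linarith
      moreover have "hnorm (a + fst d, b + snd d) \<le> hnorm (a, b)"
        using ne order_refl[of "hnorm (a, b)"] unfolding hnorm_le_iff
        by (auto simp: d_def)
      moreover have "tadj u (u + d)"
        by (simp add: d_def tadj_def)
      moreover have "u - z = (a, b)" "u + d - z = (a + fst d, b + snd d)"
        by (simp_all add: a_def b_def prod_eq_iff)
      ultimately have "tadj u (u + d)" "u + d \<in> hexagon z n"
        and "nat (\<bar>fst (u + d - z)\<bar> + \<bar>snd (u + d - z)\<bar>) < nat (\<bar>fst (u - z)\<bar> + \<bar>snd (u - z)\<bar>)"
        using less.prems by (simp_all add: hexagon_def)
      moreover from this have "conn tadj (hexagon z n) (u + d) z"
        using less.hyps by blast
      ultimately have "conn tadj (hexagon z n) (u + d) z" "tadj u (u + d)" "u + d \<in> hexagon z n"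
        by blast+
      then show ?thesis using less.prems by (auto intro: conn_trans[OF conn_edge])
    qed (use less in auto)
  qed
  show ?thesis using conn_trans[OF 1[OF assms(1)] conn_sym[OF symp_tadj 1[OF assms(2)]]] .
qed

section \<open>Planarity: crossing paths in a hexagon\<close>

lemma conn_column:
  assumes "s \<le> t" "\<And>r. s \<le> r \<Longrightarrow> r \<le> t \<Longrightarrow> (c, r) \<in> T"
  shows "conn tadj T (c, s) (c, t)"
  using assms
proof (induction t rule: int_ge_induct)
  case (step t)
  then have "conn tadj T (c, s) (c, t)" by simp
  then show ?case by (rule conn_step) (use step in \<open>auto simp: tadj_def\<close>)
qed simp

text \<open>\<open>up\<close> and \<open>down\<close> count, with sign, the crossings of an edge with the ray going left from \<open>(a, b)\<close>,
  pushed slightly above or below row \<open>b\<close>. Summed over a path that avoids \<open>(a, b)\<close> and has its ends in other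
  rows they agree, so the crossing number is constant along a second path disjoint from the first.\<close>

definition up :: "int \<Rightarrow> int \<Rightarrow> int \<times> int \<Rightarrow> int \<times> int \<Rightarrow> int"
  where "up a b u w = of_bool (snd u = b \<and> fst u < a \<and> snd w = b + 1)
    - of_bool (snd w = b \<and> fst w < a \<and> snd u = b + 1)"

definition down :: "int \<Rightarrow> int \<Rightarrow> int \<times> int \<Rightarrow> int \<times> int \<Rightarrow> int"
  where "down a b u w = of_bool (snd w = b \<and> fst w < a \<and> snd u = b - 1)
    - of_bool (snd u = b \<and> fst u < a \<and> snd w = b - 1)"

text \<open>Both sides count how the edge enters or leaves the ray in row \<open>b\<close> left of
  \<open>a\<close>. It can do so only from above or below, because moving along the row past its end
  would pass through \<open>(a, b)\<close>.\<close>

lemma up_down: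
  assumes "tadj u w" "u \<noteq> (a, b)" "w \<noteq> (a, b)"
  shows "down a b u w - up a b u w
    = of_bool (snd w = b \<and> fst w < a) - of_bool (snd u = b \<and> fst u < a)"
proof -
  consider "snd u = b" | "snd u = b + 1" | "snd u = b - 1" | "snd u \<notin> {b - 1, b, b + 1}" by auto
  then show ?thesis
    using assms by cases (cases rule: tadj_cases; simp add: up_def down_def of_bool_def; linarith?)+
qed

text \<open>Lengthening the ray by one site changes the count only for edges at
  \<open>(a, b)\<close>, and the ray just above row \<open>b\<close> is the ray just below row
  \<open>b + 1\<close>. Together with the sign-reversed moves this covers all six directions of
  \<open>tadj\<close>.\<close>

lemma up_move:
  assumes "tadj u w" "u \<noteq> (a, b)" "w \<noteq> (a, b)"
  shows "up (a + 1) b u w = up a b u w"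
    and "u \<noteq> (a, b + 1) \<Longrightarrow> w \<noteq> (a, b + 1) \<Longrightarrow> down a (b + 1) u w = up a b u w"
    and "u \<noteq> (a - 1, b + 1) \<Longrightarrow> w \<noteq> (a - 1, b + 1) \<Longrightarrow> down (a - 1) (b + 1) u w = up a b u w"
  using assms by (cases rule: tadj_cases; simp add: up_def down_def of_bool_def; presburger)+

lemma conn_path:
  assumes "conn R S x y"
  obtains f :: "nat \<Rightarrow> 'a" and m where "f 0 = x" "f m = y" "\<And>i. i \<le> m \<Longrightarrow> f i \<in> S"
    "\<And>i. i < m \<Longrightarrow> R (f i) (f (Suc i))"
proof -
  obtain m where "((\<lambda>u v. R u v \<and> v \<in> S) ^^ m) x y"
    using assms rtranclp_imp_relpowp unfolding conn_def by metis
  then obtain f where f: "f 0 = x" "f m = y" "\<forall>i<m. R (f i) (f (Suc i)) \<and> f (Suc i) \<in> S"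
    unfolding relpowp_fun_conv by blast
  then have "f i \<in> S" if "i \<le> m" for i
    using that conn_left[OF assms] by (cases i) auto
  then show ?thesis using that f by blast
qed

text \<open>\<open>\<phi> v\<close> is the signed number of crossings of the \<open>X\<close> path
  with the ray going left from \<open>v\<close>, and it is constant along \<open>Y\<close>. At
  \<open>y\<close> the path has nothing to its left, so the count is 0; at \<open>y'\<close> the
  path is entirely to the left in that row, so the count is the net passage from below to above,
  which is 1.\<close>

lemma paths_cross:
  assumes X: "conn tadj X x x'" and Y: "conn tadj Y y y'" and disj: "X \<inter> Y = {}"
    and rows: "\<And>v. v \<in> Y \<Longrightarrow> snd x < snd v \<and> snd v < snd x'"
    and left: "\<And>v. v \<in> X \<Longrightarrow> snd v = snd y \<Longrightarrow> fst y < fst v"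
    and right: "\<And>v. v \<in> X \<Longrightarrow> snd v = snd y' \<Longrightarrow> fst v < fst y'"
  shows False
proof -
  obtain f m where f: "f 0 = x" "f m = x'" "\<And>i. i \<le> m \<Longrightarrow> f i \<in> X"
    "\<And>i. i < m \<Longrightarrow> tadj (f i) (f (Suc i))"
    using conn_path[OF X] by metis
  define \<phi> where "\<phi> v = (\<Sum>i<m. up (fst v) (snd v) (f i) (f (Suc i)))" for v
  have ne: "f i \<noteq> v" "f (Suc i) \<noteq> v" if "v \<in> Y" "i < m" for i v
    using that f(3)[of i] f(3)[of "Suc i"] disj by auto
  have \<phi>': "\<phi> v = (\<Sum>i<m. down (fst v) (snd v) (f i) (f (Suc i)))" if v: "v \<in> Y" for v
  proof -
    let ?U = "\<lambda>w. of_bool (snd w = snd v \<and> fst w < fst v) :: int"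
    have "(\<Sum>i<m. down (fst v) (snd v) (f i) (f (Suc i))) - \<phi> v
        = (\<Sum>i<m. ?U (f (Suc i)) - ?U (f i))"
      unfolding \<phi>_def sum_subtractf[symmetric]
      using up_down[OF f(4), of _ "fst v" "snd v"] ne[OF v] by (intro sum.cong) auto
    also have "\<dots> = ?U x' - ?U x"
      by (subst sum_lessThan_telescope) (simp add: f)
    also have "\<dots> = 0" using rows[OF v] by simp
    finally show ?thesis by simp
  qed
  have H: "\<phi> (a + 1, b) = \<phi> (a, b)" if "(a, b) \<in> Y" for a b
    unfolding \<phi>_def using up_move(1)[OF f(4)] ne[OF that] by (intro sum.cong) auto
  have V: "\<phi> (a, b + 1) = \<phi> (a, b)" if "(a, b) \<in> Y" "(a, b + 1) \<in> Y" for a b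
    unfolding \<phi>'[OF that(2)] using up_move(2)[OF f(4)] ne[OF that(1)] ne[OF that(2)]
    by (auto simp: \<phi>_def intro!: sum.cong)
  have D: "\<phi> (a - 1, b + 1) = \<phi> (a, b)" if "(a, b) \<in> Y" "(a - 1, b + 1) \<in> Y" for a b
    unfolding \<phi>'[OF that(2)] using up_move(3)[OF f(4)] ne[OF that(1)] ne[OF that(2)]
    by (auto simp: \<phi>_def intro!: sum.cong)
  have "\<phi> v = 0" if "conn tadj Y y v" for v
    using that
  proof (induction rule: conn_induct)
    case refl
    have "up (fst y) (snd y) (f i) (f (Suc i)) = 0" if "i < m" for i
      using that left[OF f(3)[of i]] left[OF f(3)[of "Suc i"]] by (auto simp: up_def)
    then show ?case by (simp add: \<phi>_def)
  next
    case (step v w)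
    have "v \<in> Y" using step(1) by (rule conn_right)
    obtain a b where v: "v = (a, b)" by fastforce
    consider "w = (a + 1, b)" | "w = (a - 1, b)" | "w = (a, b + 1)" | "w = (a, b - 1)"
      | "w = (a + 1, b - 1)" | "w = (a - 1, b + 1)"
      using \<open>tadj v w\<close> unfolding v tadj_iff by blast
    then have "\<phi> w = \<phi> v"
      using H[of a b] H[of "a - 1" b] V[of a b] V[of a "b - 1"] D[of a b] D[of "a + 1" "b - 1"]
        \<open>v \<in> Y\<close> \<open>w \<in> Y\<close>
      by cases (auto simp: v)
    then show ?case using step by simp
  qed
  then have "\<phi> y' = 0" using Y by blast
  have "\<phi> y' = (\<Sum>i<m. of_bool (snd (f (Suc i)) > snd y') - of_bool (snd (f i) > snd y'))"
    unfolding \<phi>_def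
  proof (intro sum.cong refl)
    fix i assume "i \<in> {..<m}"
    then have i: "i < m" by simp
    show "up (fst y') (snd y') (f i) (f (Suc i))
        = of_bool (snd (f (Suc i)) > snd y') - of_bool (snd (f i) > snd y')"
      using f(4)[OF i] right[OF f(3)[of i]] right[OF f(3)[of "Suc i"]] i
      by (cases rule: tadj_cases) (auto simp: up_def)
  qed
  also have "\<dots> = of_bool (snd x' > snd y') - of_bool (snd x > snd y')"
    by (subst sum_lessThan_telescope) (simp add: f)
  also have "\<dots> = 1" using rows[OF conn_right[OF Y]] by simp
  finally show False using \<open>\<phi> y' = 0\<close> by simp
qed

lemma hexagon_cross_0:
  assumes X: "conn tadj X x x'" "X \<subseteq> hexagon 0 n" "lf 0 x = int n" "lf 2 x' = int n"
    and Y: "conn tadj Y y y'" "Y \<subseteq> hexagon 0 n" "lf 1 y = int n" "lf 3 y' = int n"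
  shows "X \<inter> Y \<noteq> {}"
proof
  assume disj: "X \<inter> Y = {}"
  define N where "N = int n"
  define b where "b = snd x"
  define c where "c = fst x'"
  have x: "x = (N, b)" and x': "x' = (c, N)" using X by (auto simp: N_def b_def c_def prod_eq_iff)
  \<comment> \<open>\<open>X\<close> is prolonged outside the hexagon so that it starts below every
    row of the hexagon and ends above every row: from \<open>x\<close> right by one and down the
    column \<open>N + 1\<close>, from \<open>x'\<close> one step up.\<close>
  define T where "T = X \<union> {(c, N + 1)} \<union> {N + 1} \<times> {- N - 1..b}"
  have hexD: "\<bar>fst w\<bar> \<le> N" "\<bar>snd w\<bar> \<le> N" "\<bar>fst w + snd w\<bar> \<le> N" if "w \<in> hexagon 0 n" for w
    using that by (auto simp: hexagon_def hnorm_def N_def)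
  have xX: "x \<in> X" "x' \<in> X" "y \<in> Y" "y' \<in> Y"
    using X Y by (auto dest: conn_left conn_right)
  have b: "- N \<le> b" "b \<le> 0" using hexD[of x] X xX by (auto simp: x)
  have "conn tadj T (N + 1, - N - 1) (N + 1, b)"
    by (rule conn_column) (use b in \<open>auto simp: T_def\<close>)
  also have "conn tadj T (N + 1, b) x"
    by (rule conn_edge) (use b xX in \<open>auto simp: x T_def tadj_def\<close>)
  also have "conn tadj T x x'" using X(1) by (rule conn_mono) (auto simp: T_def)
  also have "conn tadj T x' (c, N + 1)"
    by (rule conn_edge) (use xX in \<open>auto simp: x' T_def tadj_def\<close>)
  finally have T: "conn tadj T (N + 1, - N - 1) (c, N + 1)" .
  have yN: "fst y + snd y = N" "fst y' = - N" using Y by (auto simp: N_def)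
  show False
  proof (rule paths_cross[OF T conn_sym[OF symp_tadj Y(1)]])
    show "T \<inter> Y = {}" using disj hexD Y(2) by (fastforce simp: T_def)
    show "snd (N + 1, - N - 1) < snd v \<and> snd v < snd (c, N + 1)" if "v \<in> Y" for v
      using hexD[of v] that Y(2) by auto
    show "fst y' < fst v" if v: "v \<in> T" "snd v = snd y'" for v
    proof (cases "v \<in> X")
      case True
      then have "v \<noteq> y'" using disj xX by auto
      then show ?thesis using hexD[of v] True X(2) v yN by (auto simp: prod_eq_iff)
    qed (use v yN hexD[of y'] xX Y(2) in \<open>auto simp: T_def\<close>)
    show "fst v < fst y" if v: "v \<in> T" "snd v = snd y" for v
    proof (cases "v \<in> X")
      case True
      then have "v \<noteq> y" using disj xX by auto
      then show ?thesis using hexD[of v] True X(2) v yN by (auto simp: prod_eq_iff)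
    next
      case False
      have y: "y \<in> hexagon 0 n" using xX Y(2) by auto
      \<comment> \<open>The added column reaches only rows up to \<open>b\<close>, which is at most
        0, while \<open>y\<close> on side 1 has a row of at least 0. A common row forces
        \<open>y = (N, 0) = x\<close>, which disjointness forbids.\<close>
      have "y \<noteq> x" using disj xX by auto
      then show ?thesis using v yN hexD[OF y] b False by (auto simp: T_def x prod_eq_iff)
    qed
  qed
qed

lemma hexagon_cross:
  assumes "k < 6"
    and "conn tadj X x x'" "X \<subseteq> hexagon 0 n" "lf k x = int n" "lf ((k + 2) mod 6) x' = int n"
    and "conn tadj Y y y'" "Y \<subseteq> hexagon 0 n" "lf ((k + 1) mod 6) y = int n"
      "lf ((k + 3) mod 6) y' = int n"
  shows "X \<inter> Y \<noteq> {}"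
  using assms
proof (induction k arbitrary: X Y x x' y y')
  case 0
  then show ?case using hexagon_cross_0[of X x x' n Y y y'] by (simp add: numeral_2_eq_2[symmetric] numeral_3_eq_3[symmetric])
next
  case (Suc k)
  \<comment> \<open>The inverse of \<open>rot\<close>, lowering the side index by one.\<close>
  define h where "h = rot ^^ 5"
  have hr: "h (rot w) = w" "rot (h w) = w" for w
    by (simp_all add: h_def rot_def numeral_eq_Suc prod_eq_iff)
  have hn: "hnorm (h w) = hnorm w" for w by (simp add: h_def numeral_eq_Suc)
  have ht: "tadj (h u) (h v)" if "tadj u v" for u v
    using that by (simp add: h_def numeral_eq_Suc tadj_rot)
  have lfh: "lf j (h w) = lf (Suc j mod 6) w" if "j < 6" for j w
    using lf_rot[OF that, of "h w"] by (simp add: hr)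
  have lfh': "lf ((k + i) mod 6) (h w) = lf ((Suc k + i) mod 6) w" for i w
    by (subst lfh) (simp_all add: mod_Suc_eq)
  have sub: "h ` A \<subseteq> hexagon 0 n" if "A \<subseteq> hexagon 0 n" for A
    using that by (auto simp: hexagon_def hn)
  have "h ` X \<inter> h ` Y \<noteq> {}"
  proof (rule Suc.IH)
    show "conn tadj (h ` X) (h x) (h x')" "conn tadj (h ` Y) (h y) (h y')"
      using Suc.prems ht by (auto intro: conn_image)
    show "h ` X \<subseteq> hexagon 0 n" "h ` Y \<subseteq> hexagon 0 n" using Suc.prems sub by auto
    show "lf k (h x) = int n" using Suc.prems lfh'[of 0 x] by simp
    show "lf ((k + 2) mod 6) (h x') = int n" "lf ((k + 1) mod 6) (h y) = int n"
      "lf ((k + 3) mod 6) (h y') = int n"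
      using Suc.prems unfolding lfh' by blast+
    show "k < 6" using Suc.prems by simp
  qed
  moreover have "inj h" using hr by (metis injI)
  ultimately show ?case by (auto simp: inj_eq)
qed

section \<open>Arms of hexagons\<close>

text \<open>Only sites of the annulus between the two hexagons are inspected, which makes arms
  independent of the state of the inner hexagon; \<open>u\<close> may be closed.\<close>

definition arm :: "int \<times> int \<Rightarrow> nat \<Rightarrow> nat \<Rightarrow> nat \<Rightarrow> (int \<times> int) set \<Rightarrow> bool"
  where "arm z n N k \<omega> \<longleftrightarrow> (\<exists>u x y. u \<in> hexagon z n \<and> tadj u x \<and>
    conn tadj (\<omega> \<inter> hexagon z N - hexagon z n) x y \<and> lf k (y - z) = int N)"

definition some_arm :: "int \<times> int \<Rightarrow> nat \<Rightarrow> nat \<Rightarrow> (int \<times> int) set \<Rightarrow> bool"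
  where "some_arm z n N \<omega> \<longleftrightarrow> (\<exists>k<6. arm z n N k \<omega>)"

lemma arm_mono: "arm z n N k \<omega> \<Longrightarrow> \<omega> \<subseteq> \<omega>' \<Longrightarrow> arm z n N k \<omega>'"
  unfolding arm_def by (meson Diff_mono Int_mono conn_mono order_refl)

lemma arm_cong:
  assumes "\<omega> \<inter> (hexagon z N - hexagon z n) = \<omega>' \<inter> (hexagon z N - hexagon z n)"
  shows "arm z n N k \<omega> \<longleftrightarrow> arm z n N k \<omega>'"
proof -
  have "\<omega> \<inter> hexagon z N - hexagon z n = \<omega>' \<inter> hexagon z N - hexagon z n" using assms by blast
  then show ?thesis by (simp add: arm_def)
qed

lemma some_arm_cong:
  assumes "\<omega> \<inter> (hexagon z N - hexagon z n) = \<omega>' \<inter> (hexagon z N - hexagon z n)"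
  shows "some_arm z n N \<omega> \<longleftrightarrow> some_arm z n N \<omega>'"
  using arm_cong[OF assms] by (simp add: some_arm_def)

lemma arm_image:
  assumes "arm z n N k \<omega>"
    and "inj h" "\<And>u v. tadj u v \<Longrightarrow> tadj (h u) (h v)" "\<And>w. hnorm (h w - h z) = hnorm (w - z)"
    and "\<And>w. lf k' (h w - h z) = lf k (w - z)"
  shows "arm (h z) n N k' (h ` \<omega>)"
proof -
  obtain u x y where *: "u \<in> hexagon z n" "tadj u x"
    "conn tadj (\<omega> \<inter> hexagon z N - hexagon z n) x y" "lf k (y - z) = int N"
    using assms(1) unfolding arm_def by blast
  have hex: "h w \<in> hexagon (h z) m \<longleftrightarrow> w \<in> hexagon z m" for w m
    by (simp add: hexagon_def assms)
  have "conn tadj (h ` (\<omega> \<inter> hexagon z N - hexagon z n)) (h x) (h y)"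
    using *(3) assms(3) by (rule conn_image)
  then have "conn tadj (h ` \<omega> \<inter> hexagon (h z) N - hexagon (h z) n) (h x) (h y)"
    by (rule conn_mono) (auto simp: hex)
  then show ?thesis
    unfolding arm_def using * assms(3,5) by (intro exI[of _ "h u"] exI[of _ "h x"] exI[of _ "h y"]) (simp add: hex)
qed

lemma rot_0 [simp]: "rot 0 = 0" by (simp add: rot_def zero_prod_def)

lemma inj_rot: "inj rot" by (rule injI) (auto simp: rot_def prod_eq_iff)

lemma arm_rot: "k < 6 \<Longrightarrow> arm 0 n N k \<omega> \<Longrightarrow> arm 0 n N (Suc k mod 6) (rot ` \<omega>)"
  using arm_image[of 0 n N k \<omega> rot "Suc k mod 6"]
  by (simp add: tadj_rot lf_rot inj_rot)

lemma arm_translate: "arm z n N k ((\<lambda>w. w + z) ` \<omega>) \<longleftrightarrow> arm 0 n N k \<omega>"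
proof
  show "arm 0 n N k \<omega> \<Longrightarrow> arm z n N k ((\<lambda>w. w + z) ` \<omega>)"
    using arm_image[of 0 n N k \<omega> "\<lambda>w. w + z" k] by (simp add: inj_def)
  assume "arm z n N k ((\<lambda>w. w + z) ` \<omega>)"
  then show "arm 0 n N k \<omega>"
    using arm_image[of z n N k "(\<lambda>w. w + z) ` \<omega>" "\<lambda>w. w - z" k] by (simp add: inj_def image_image)
qed

text \<open>Along an edge \<open>hnorm\<close> changes by at most one, so a path leaving the hexagon
  of radius \<open>R\<close> hits its boundary exactly.\<close>

lemma conn_truncate:
  assumes "conn tadj T x y" "hnorm (x - z) \<le> int R" "int R \<le> hnorm (y - z)"
  shows "\<exists>y'. hnorm (y' - z) = int R \<and> conn tadj (T \<inter> hexagon z R) x y'"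
proof (cases "hnorm (x - z) = int R")
  case True
  then show ?thesis using conn_left[OF assms(1)] by (intro exI[of _ x]) (auto simp: hexagon_def)
next
  case False
  let ?B = "{w. int R \<le> hnorm (w - z)}"
  obtain u v where uv: "conn tadj (T - ?B) x u" "tadj u v" "v \<in> ?B" "v \<in> T"
    using conn_first_hit[OF assms(1), of ?B] assms False by auto
  have "u \<notin> ?B" using conn_right[OF uv(1)] by blast
  then have v: "hnorm (v - z) = int R" using hnorm_tadj'[OF uv(2), of z] uv(3) by auto
  have "conn tadj (T \<inter> hexagon z R) x u"
    using uv(1) by (rule conn_mono) (auto simp: hexagon_def)
  then have "conn tadj (T \<inter> hexagon z R) x v"
    by (rule conn_step) (use uv v in \<open>auto simp: hexagon_def\<close>)
  with v show ?thesis by blast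
qed

text \<open>A site on a side of the outer hexagon has a neighbour beyond that side. Were the site
  strictly inside the inner hexagon, this neighbour would still belong to it.\<close>

lemma boundary_outside:
  assumes "k < 6" "lf k (y - z) = int N" "hexagon z' N' \<subseteq> hexagon z N"
  shows "int N' \<le> hnorm (y - z')"
proof (rule ccontr)
  assume *: "\<not> int N' \<le> hnorm (y - z')"
  obtain v where v: "tadj y v" "lf k (v - z) = lf k (y - z) + 1"
    using ex_outward[OF assms(1)] by blast
  have "v \<in> hexagon z' N'" using hnorm_tadj'[OF v(1), of z'] * by (simp add: hexagon_def)
  then have "hnorm (v - z) \<le> int N" using assms(3) by (auto simp: hexagon_def)
  then show False using v assms lf_le_hnorm[OF assms(1), of "v - z"] by simp
qed

text \<open>An arm between the extreme hexagons crosses every annulus nested between them: cut it at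
  its last exit from \<open>hexagon z' n'\<close> and truncate it at radius
  \<open>N'\<close>.\<close>

lemma some_arm_nested:
  assumes "some_arm z n N \<omega>" "hexagon z n \<subseteq> hexagon z' n'" "hexagon z' N' \<subseteq> hexagon z N" "n' < N'"
  shows "some_arm z' n' N' \<omega>"
proof -
  obtain k u x y where *: "k < 6" "u \<in> hexagon z n" "tadj u x"
    "conn tadj (\<omega> \<inter> hexagon z N - hexagon z n) x y" "lf k (y - z) = int N"
    using assms(1) unfolding some_arm_def arm_def by blast
  let ?S = "\<omega> \<inter> hexagon z N - hexagon z n" and ?B = "hexagon z' n'"
  have y: "int N' \<le> hnorm (y - z')" using boundary_outside * assms by blast
  \<comment> \<open>The foot \<open>u\<close> need not be open. It is added so that the path starts
    inside \<open>?B\<close>, and it vanishes again when \<open>?B\<close> is removed.\<close>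
  have "conn tadj (insert u ?S) u x"
    by (rule conn_edge) (use * conn_left in fastforce)+
  also have "conn tadj (insert u ?S) x y" using *(4) by (rule conn_mono) auto
  finally have "conn tadj (insert u ?S) u y" .
  then obtain u' v where uv: "u' \<in> ?B" "tadj u' v" "conn tadj (insert u ?S - ?B) v y"
  proof -
    have "u \<in> ?B" "y \<notin> ?B" using * assms y by (auto simp: hexagon_def)
    with \<open>conn tadj (insert u ?S) u y\<close> show ?thesis using conn_last_exit that by metis
  qed
  have "hnorm (v - z') \<le> int N'"
    using hnorm_tadj'[OF uv(2), of z'] uv(1) assms(4) by (simp add: hexagon_def)
  then obtain y' where y': "hnorm (y' - z') = int N'"
    "conn tadj ((insert u ?S - ?B) \<inter> hexagon z' N') v y'"
    using conn_truncate[OF uv(3) _ y] by blast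
  have "conn tadj (\<omega> \<inter> hexagon z' N' - ?B) v y'"
    using y'(2) by (rule conn_mono) (use * assms in auto)
  moreover obtain k' where "k' < 6" "lf k' (y' - z') = int N'"
    using hnorm_attained[of "y' - z'"] y'(1) by auto
  ultimately show ?thesis using uv unfolding some_arm_def arm_def by blast
qed

section \<open>Arm probabilities at density 1/2\<close>

abbreviation prob_half :: "'a set \<Rightarrow> ('a set \<Rightarrow> bool) \<Rightarrow> real"
  where "prob_half A P \<equiv> bexp (1/2) A (\<lambda>S. of_bool (P S))"

lemma prob_half_mono:
  "(\<And>S. S \<subseteq> A \<Longrightarrow> P S \<Longrightarrow> Q S) \<Longrightarrow> prob_half A P \<le> prob_half A Q"
  by (rule bexp_mono) auto

lemma prob_half_not: "finite A \<Longrightarrow> prob_half A (\<lambda>S. \<not> P S) = 1 - prob_half A P"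
  using bexp_diff[of "1/2" A "\<lambda>_. 1" "\<lambda>S. of_bool (P S)"] by (simp add: of_bool_not_iff)

lemma prob_half_le_1: "finite A \<Longrightarrow> prob_half A P \<le> 1"
  using bexp_mono[of "1/2" A "\<lambda>S. of_bool (P S)" "\<lambda>_. 1"] by simp

lemma prob_half_union_bound:
  assumes "\<And>S. S \<subseteq> A \<Longrightarrow> P S \<Longrightarrow> \<exists>i\<in>I. Q i S" "finite I"
  shows "prob_half A P \<le> (\<Sum>i\<in>I. prob_half A (Q i))"
  unfolding bexp_sum[symmetric]
proof (rule bexp_mono)
  fix S assume S: "S \<subseteq> A"
  show "(of_bool (P S) :: real) \<le> (\<Sum>i\<in>I. of_bool (Q i S))"
  proof (cases "P S")
    case True
    then obtain i where "i \<in> I" "Q i S" using assms S by blast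
    then show ?thesis using member_le_sum[of i I "\<lambda>i. of_bool (Q i S) :: real"] assms True by simp
  qed (simp add: sum_nonneg)
qed auto

lemma prob_half_local:
  assumes "finite B" "A \<subseteq> B" "\<And>S. P (S \<inter> A) \<longleftrightarrow> P S"
  shows "prob_half B P = prob_half A P"
  using bexp_restrict[OF assms(1,2), of "1/2" "\<lambda>S. of_bool (P S)"] assms(3) by simp

lemma harris_antimono:
  fixes f g :: "'a set \<Rightarrow> real"
  assumes "finite A" "0 \<le> p" "p \<le> 1" "antimono f" "antimono g"
  shows "bexp p A f * bexp p A g \<le> bexp p A (\<lambda>S. f S * g S)"
proof -
  have "mono (\<lambda>S. - f S)" "mono (\<lambda>S. - g S)" using assms by (auto simp: antimono_def mono_def)
  then show ?thesis
    using harris[OF assms(1-3), of "\<lambda>S. - f S" "\<lambda>S. - g S"]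
      bexp_cmult[of p A "-1" f] bexp_cmult[of p A "-1" g] by simp
qed

lemma harris_prod:
  fixes f :: "'i \<Rightarrow> 'a set \<Rightarrow> real"
  assumes "finite A" "0 \<le> p" "p \<le> 1" "finite I"
    and "\<And>i. i \<in> I \<Longrightarrow> antimono (f i)" "\<And>i S. i \<in> I \<Longrightarrow> 0 \<le> f i S"
  shows "(\<Prod>i\<in>I. bexp p A (f i)) \<le> bexp p A (\<lambda>S. \<Prod>i\<in>I. f i S)"
  using assms(4-)
proof (induction I rule: finite_induct)
  case empty
  then show ?case using assms by simp
next
  case (insert i I)
  have am: "antimono (\<lambda>S. \<Prod>i\<in>I. f i S)"
    using insert.prems by (auto simp: antimono_def intro!: prod_mono)
  have "0 \<le> bexp p A (f i)"
    using bexp_mono[of p A "\<lambda>_. 0" "f i"] assms insert.prems by simp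
  then have "bexp p A (f i) * (\<Prod>i\<in>I. bexp p A (f i)) \<le> bexp p A (f i) * bexp p A (\<lambda>S. \<Prod>i\<in>I. f i S)"
    using insert by (intro mult_left_mono) auto
  also have "\<dots> \<le> bexp p A (\<lambda>S. f i S * (\<Prod>i\<in>I. f i S))"
    using insert.prems am assms by (intro harris_antimono) auto
  finally show ?case using insert by simp
qed

text \<open>Finite-volume form of the zero-one law: with \<open>t\<close> the limiting probability of having no arm, two
  far apart hexagons are nearly independent, so \<open>t \<le> t\<^sup>2\<close>.\<close>

lemma zero_one_limit:
  fixes r :: "nat \<Rightarrow> nat \<Rightarrow> real"
  assumes pos: "\<epsilon> > 0" "\<And>n N. n < N \<Longrightarrow> \<epsilon> \<le> r n N" and le1: "\<And>n N. r n N \<le> 1"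
    and decr: "\<And>n N N'. n < N \<Longrightarrow> N \<le> N' \<Longrightarrow> r n N' \<le> r n N"
    and two: "\<And>n M. n < M \<Longrightarrow> \<exists>m. \<forall>N>m. \<exists>N'>m. M \<le> N \<and> M \<le> N' \<and>
      1 - r m N \<le> (1 - r n M)\<^sup>2 + (r n M - r n N) + (r n M - r n N')"
    and "\<eta> > 0"
  shows "\<exists>n. \<forall>N>n. 1 - \<eta> \<le> r n N"
proof -
  define q where "q n = (INF N\<in>{n<..}. r n N)" for n
  have bdd: "bdd_below (r n ` {n<..})" for n using pos by (intro bdd_belowI2[of _ \<epsilon>]) auto
  have q_le: "q n \<le> r n N" if "n < N" for n N
    unfolding q_def using bdd that by (intro cINF_lower) auto
  have q_ge: "\<epsilon> \<le> q n" for n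
    unfolding q_def using pos by (intro cINF_greatest) auto
  have q_near: "\<exists>N>n. r n N < q n + \<delta>" if "\<delta> > 0" for n \<delta>
  proof -
    have "\<exists>N\<in>{n<..}. r n N < q n + \<delta>"
      using that cINF_less_iff[OF _ bdd, of n "q n + \<delta>"] unfolding q_def by simp
    then show ?thesis by auto
  qed
  have q_le1: "q n \<le> 1" for n using q_le[of n "Suc n"] le1[of n "Suc n"] by simp
  define Q where "Q = (SUP n. q n)"
  have bddQ: "bdd_above (range q)" using q_le1 by (intro bdd_aboveI2[of _ _ 1]) auto
  have qQ: "q n \<le> Q" for n unfolding Q_def using bddQ by (intro cSUP_upper) auto
  have Q: "\<epsilon> \<le> Q" "Q \<le> 1"
    using q_ge[of 0] qQ[of 0] q_le1 by (auto simp: Q_def intro: cSUP_least)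
  have nearQ: "\<exists>n. Q - \<delta> < q n" if "\<delta> > 0" for \<delta>
    using that less_cSUP_iff[OF _ bddQ, of "Q - \<delta>"] unfolding Q_def by auto
  \<comment> \<open>The choices are nested: \<open>n\<close> nearly attains the supremum,
    \<open>M\<close> nearly attains the limit for \<open>n\<close>, \<open>m\<close> comes from the
    hypothesis, and \<open>N\<close> nearly attains the limit for \<open>m\<close>. Both differences
    are then at most \<open>\<delta>\<close>.\<close>
  have main: "1 - Q - \<delta> \<le> (1 - Q + \<delta>)\<^sup>2 + 2 * \<delta>" if \<delta>: "\<delta> > 0" for \<delta>
  proof -
    obtain n where n: "Q - \<delta> < q n" using nearQ[OF \<delta>] by blast
    obtain M where M: "n < M" "r n M < q n + \<delta>" using q_near[OF \<delta>] by blast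
    obtain m where m: "\<And>N. N > m \<Longrightarrow> \<exists>N'>m. M \<le> N \<and> M \<le> N' \<and>
      1 - r m N \<le> (1 - r n M)\<^sup>2 + (r n M - r n N) + (r n M - r n N')"
      using two[OF M(1)] by blast
    obtain N where N: "N > m" "r m N < q m + \<delta>" using q_near[OF \<delta>] by blast
    obtain N' where N': "M \<le> N" "M \<le> N'"
      "1 - r m N \<le> (1 - r n M)\<^sup>2 + (r n M - r n N) + (r n M - r n N')"
      using m[OF N(1)] by blast
    have "(1 - r n M)\<^sup>2 \<le> (1 - Q + \<delta>)\<^sup>2"
      using n q_le[OF M(1)] le1[of n M] by (intro power_mono) auto
    moreover have "q n \<le> r n N" "q n \<le> r n N'" using q_le N' M by simp_all
    moreover have "q m \<le> Q" by (rule qQ)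
    ultimately show ?thesis using N' N M by simp
  qed
  have "1 - Q \<le> (1 - Q)\<^sup>2"
  proof (rule tendsto_le[OF trivial_limit_at_right_real[of "0::real"]])
    show "((\<lambda>\<delta>. (1 - Q + \<delta>)\<^sup>2 + 2 * \<delta>) \<longlongrightarrow> (1 - Q)\<^sup>2) (at_right 0)"
      by (auto intro!: tendsto_eq_intros)
    show "((\<lambda>\<delta>. 1 - Q - \<delta>) \<longlongrightarrow> 1 - Q) (at_right 0)"
      by (auto intro!: tendsto_eq_intros)
    show "\<forall>\<^sub>F \<delta> in at_right 0. 1 - Q - \<delta> \<le> (1 - Q + \<delta>)\<^sup>2 + 2 * \<delta>"
      using main by (auto simp: eventually_at_filter)
  qed
  then have "0 \<le> (1 - Q) * (- Q)" by (simp add: power2_eq_square algebra_simps)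
  then have "Q = 1" using Q pos(1) by (auto simp: zero_le_mult_iff mult_le_0_iff)
  then obtain n where "1 - \<eta> < q n" using nearQ[OF \<open>\<eta> > 0\<close>] by blast
  then show ?thesis using q_le by (meson less_eq_real_def less_le_trans order.trans)
qed

text \<open>Finite-volume stand-in for an infinite cluster: applied to \<open>S\<close> inside
  \<open>A\<close>, it says that the cluster of \<open>x\<close> has a neighbour outside
  \<open>A\<close>.\<close>

definition escapes :: "('a \<Rightarrow> 'a \<Rightarrow> bool) \<Rightarrow> 'a set \<Rightarrow> 'a \<Rightarrow> 'a set \<Rightarrow> bool"
  where "escapes R A x S \<longleftrightarrow> (\<exists>c v. conn R S x c \<and> R c v \<and> v \<notin> A)"

lemma escapes_some_arm:
  assumes "escapes tadj (hexagon 0 N) 0 S" "S \<subseteq> hexagon 0 N" "n < N"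
  shows "some_arm 0 n N S"
proof -
  obtain c v where c: "conn tadj S 0 c" "tadj c v" "v \<notin> hexagon 0 N"
    using assms unfolding escapes_def by blast
  have hc: "hnorm c = int N"
    using hnorm_tadj[OF c(2)] c(3) conn_right[OF c(1)] assms(2) by (auto simp: hexagon_def)
  obtain u w where "u \<in> hexagon 0 n" "tadj u w" "conn tadj (S - hexagon 0 n) w c"
    using conn_last_exit[OF c(1), of "hexagon 0 n"] hc assms(3) by (auto simp: hexagon_def)
  moreover have "S \<inter> hexagon 0 N = S" using assms by blast
  moreover obtain k where "k < 6" "lf k c = int N" using hnorm_attained[of c] hc by auto
  ultimately have "arm 0 n N k S"
    unfolding arm_def by (intro exI[of _ u] exI[of _ w] exI[of _ c]) simp
  with \<open>k < 6\<close> show ?thesis unfolding some_arm_def by blast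
qed

lemma prob_arm_translate:
  assumes "finite A" "hexagon z N \<subseteq> A"
  shows "prob_half A (arm z n N k) = prob_half (hexagon 0 N) (arm 0 n N k)"
    and "prob_half A (some_arm z n N) = prob_half (hexagon 0 N) (some_arm 0 n N)"
proof -
  have inj: "inj_on (\<lambda>w. w + z) B" for B by (simp add: inj_on_def)
  have "prob_half A (arm z n N k) = prob_half (hexagon z N) (arm z n N k)"
    by (rule prob_half_local[OF assms]) (rule arm_cong, blast)
  then show "prob_half A (arm z n N k) = prob_half (hexagon 0 N) (arm 0 n N k)"
    unfolding hexagon_translate[of z] bexp_image[OF inj] by (simp add: arm_translate)
  have "prob_half A (some_arm z n N) = prob_half (hexagon z N) (some_arm z n N)"
    by (rule prob_half_local[OF assms]) (rule some_arm_cong, blast)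
  then show "prob_half A (some_arm z n N) = prob_half (hexagon 0 N) (some_arm 0 n N)"
    unfolding hexagon_translate[of z] bexp_image[OF inj] by (simp add: some_arm_def arm_translate)
qed

text \<open>If a hexagon containing two disjoint copies of the small one has no far arm, neither
  copy has. Then either both copies already fail at distance \<open>M\<close>, which are independent
  events, or one reaches \<open>M\<close> but not its far boundary.\<close>

lemma prob_some_arm_two:
  assumes "n < M"
  defines "r \<equiv> \<lambda>n N. prob_half (hexagon 0 N) (some_arm 0 n N)"
  shows "\<exists>m. \<forall>N>m. \<exists>N'>m. M \<le> N \<and> M \<le> N' \<and>
      1 - r m N \<le> (1 - r n M)\<^sup>2 + (r n M - r n N) + (r n M - r n N')"
proof (rule exI[of _ "3 * M + 1"], intro allI impI)
  \<comment> \<open>Distance \<open>2 * M + 1\<close> makes the hexagons of radius \<open>M\<close>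
    disjoint; radius \<open>3 * M + 1\<close> contains both inner hexagons, since
    \<open>n < M\<close>.\<close>
  define z :: "int \<times> int" where "z = (2 * int M + 1, 0)"
  have z: "hnorm z = 2 * int M + 1" by (simp add: z_def hnorm_def)
  let ?m = "3 * M + 1"
  fix N assume N: "?m < N"
  \<comment> \<open>\<open>N\<close> plus the distance of \<open>z\<close>, so that the hexagon of
    radius \<open>?N\<close> around \<open>z\<close> contains the one of radius \<open>N\<close>
    around 0.\<close>
  let ?N = "N + 2 * M + 1"
  let ?A = "hexagon 0 M" and ?B = "hexagon z M"
  define \<Omega> where "\<Omega> = hexagon 0 N \<union> hexagon z ?N"
  have fin: "finite \<Omega>" by (simp add: \<Omega>_def)
  have sub: "hexagon 0 n \<subseteq> hexagon 0 ?m" "hexagon z n \<subseteq> hexagon 0 ?m"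
    "hexagon 0 N \<subseteq> hexagon z ?N" "?A \<subseteq> hexagon 0 N" "?B \<subseteq> hexagon z ?N"
    using z N \<open>n < M\<close> hnorm_minus[of z] by (intro hexagon_subset; simp)+
  have disj: "?A \<inter> ?B = {}"
    using hexagon_disjoint[of M M 0 z] z hnorm_minus[of z] by simp
  note tr = prob_arm_translate(2)[OF fin]
  have r: "prob_half \<Omega> (some_arm 0 n N) = r n N" "prob_half \<Omega> (some_arm 0 n M) = r n M"
    "prob_half \<Omega> (some_arm z n M) = r n M" "prob_half \<Omega> (some_arm z n ?N) = r n ?N"
    "prob_half \<Omega> (some_arm 0 ?m N) = r ?m N"
    unfolding r_def by (rule tr; use sub in \<open>simp add: \<Omega>_def; blast\<close>)+
  have diff: "prob_half \<Omega> (\<lambda>S. P S \<and> \<not> Q S) = prob_half \<Omega> P - prob_half \<Omega> Q"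
    if "\<And>S. Q S \<Longrightarrow> P S" for P Q
    unfolding bexp_diff[symmetric] using that by (intro bexp_cong) (auto simp: of_bool_def)
  have "1 - r ?m N = prob_half \<Omega> (\<lambda>S. \<not> some_arm 0 ?m N S)"
    using prob_half_not[OF fin] r by simp
  also have "\<dots> \<le> (\<Sum>i\<in>{0, 1, 2::nat}. prob_half \<Omega> ([\<lambda>S. \<not> some_arm 0 n M S \<and> \<not> some_arm z n M S,
      \<lambda>S. some_arm 0 n M S \<and> \<not> some_arm 0 n N S, \<lambda>S. some_arm z n M S \<and> \<not> some_arm z n ?N S] ! i))"
  proof (rule prob_half_union_bound)
    fix S assume "\<not> some_arm 0 ?m N S"
    then have "\<not> some_arm 0 n N S" "\<not> some_arm z n ?N S"
      using some_arm_nested[OF _ sub(1) order_refl N] some_arm_nested[OF _ sub(2,3) N] by blast+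
    then show "\<exists>i\<in>{0, 1, 2::nat}. ([\<lambda>S. \<not> some_arm 0 n M S \<and> \<not> some_arm z n M S,
      \<lambda>S. some_arm 0 n M S \<and> \<not> some_arm 0 n N S, \<lambda>S. some_arm z n M S \<and> \<not> some_arm z n ?N S] ! i) S"
      by auto
  qed simp
  also have "\<dots> = prob_half \<Omega> (\<lambda>S. \<not> some_arm 0 n M S \<and> \<not> some_arm z n M S)
    + prob_half \<Omega> (\<lambda>S. some_arm 0 n M S \<and> \<not> some_arm 0 n N S)
    + prob_half \<Omega> (\<lambda>S. some_arm z n M S \<and> \<not> some_arm z n ?N S)"
    by simp
  also have "prob_half \<Omega> (\<lambda>S. some_arm 0 n M S \<and> \<not> some_arm 0 n N S) = r n M - r n N"
    unfolding r(1,2)[symmetric]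
    by (rule diff) (use some_arm_nested[OF _ order_refl sub(4) assms(1)] in blast)
  also have "prob_half \<Omega> (\<lambda>S. some_arm z n M S \<and> \<not> some_arm z n ?N S) = r n M - r n ?N"
    unfolding r(3,4)[symmetric]
    by (rule diff) (use some_arm_nested[OF _ order_refl sub(5) assms(1)] in blast)
  also have "prob_half \<Omega> (\<lambda>S. \<not> some_arm 0 n M S \<and> \<not> some_arm z n M S) = (1 - r n M)\<^sup>2"
  proof -
    have loc: "some_arm 0 n M (S \<inter> (?A \<union> ?B)) = some_arm 0 n M S"
      "some_arm 0 n M (S \<inter> ?A) = some_arm 0 n M S"
      "some_arm z n M (S \<inter> (?A \<union> ?B)) = some_arm z n M S"
      "some_arm z n M (S \<inter> ?B) = some_arm z n M S" for S
      by (rule some_arm_cong; blast)+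
    have "prob_half \<Omega> (\<lambda>S. \<not> some_arm 0 n M S \<and> \<not> some_arm z n M S)
        = prob_half (?A \<union> ?B) (\<lambda>S. \<not> some_arm 0 n M S \<and> \<not> some_arm z n M S)"
      by (rule prob_half_local) (use fin sub loc in \<open>auto simp: \<Omega>_def\<close>)
    also have "\<dots> = prob_half ?A (\<lambda>S. \<not> some_arm 0 n M S) * prob_half ?B (\<lambda>S. \<not> some_arm z n M S)"
      unfolding bexp_indep[OF finite_hexagon finite_hexagon disj, symmetric]
      by (intro bexp_cong) (auto simp: loc)
    also have "\<dots> = (1 - r n M) * (1 - r n M)"
      unfolding prob_half_not[OF finite_hexagon] r_def
      by (simp add: prob_arm_translate(2)[of ?B z M n])
    finally show ?thesis by (simp add: power2_eq_square)
  qed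
  finally show "\<exists>N'>?m. M \<le> N \<and> M \<le> N' \<and>
      1 - r ?m N \<le> (1 - r n M)\<^sup>2 + (r n M - r n N) + (r n M - r n N')"
    using N by (intro exI[of _ ?N]) auto
qed

lemma prob_arm_rot:
  assumes "k < 6" "l < 6"
  shows "prob_half (hexagon 0 N) (arm 0 n N k) = prob_half (hexagon 0 N) (arm 0 n N l)"
proof -
  define p where "p k = prob_half (hexagon 0 N) (arm 0 n N k)" for k
  have hex: "rot ` hexagon 0 N = hexagon 0 N"
  proof (rule endo_inj_surj)
    show "rot ` hexagon 0 N \<subseteq> hexagon 0 N" by (auto simp: hexagon_def)
    show "inj_on rot (hexagon 0 N)" by (rule inj_on_subset[OF inj_rot subset_UNIV])
  qed simp
  \<comment> \<open>An inequality in one direction suffices: going once around the six sides closes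
    the cycle.\<close>
  have step: "p k \<le> p (Suc k mod 6)" if "k < 6" for k
  proof -
    have "p k \<le> prob_half (hexagon 0 N) (\<lambda>S. arm 0 n N (Suc k mod 6) (rot ` S))"
      unfolding p_def by (rule prob_half_mono) (rule arm_rot[OF that])
    also have "\<dots> = prob_half (rot ` hexagon 0 N) (arm 0 n N (Suc k mod 6))"
      by (rule bexp_image[symmetric]) (rule inj_on_subset[OF inj_rot subset_UNIV])
    finally show ?thesis unfolding hex p_def .
  qed
  have "p 0 \<le> p 1" "p 1 \<le> p 2" "p 2 \<le> p 3" "p 3 \<le> p 4" "p 4 \<le> p 5" "p 5 \<le> p 0"
    using step[of 0] step[of 1] step[of 2] step[of 3] step[of 4] step[of 5]
    by (simp_all add: numeral_2_eq_2[symmetric])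
  then have "p i = p 0" if "i < 6" for i using that unfolding less_6 by (elim disjE) simp_all
  from this[OF assms(1)] this[OF assms(2)] show ?thesis by (simp add: p_def)
qed

text \<open>Square-root trick: missing the arm to side \<open>l\<close> is a decreasing event, so by
  Harris all six are missed with probability at least the product of six equal factors. This is at
  most \<open>(1/12) ^ 6\<close>, hence each factor is at most \<open>1/12\<close>.\<close>

lemma prob_no_arm_le:
  assumes "prob_half (hexagon 0 N) (some_arm 0 n N) \<ge> 1 - (1/12) ^ 6" "k < 6"
  shows "1 - prob_half (hexagon 0 N) (arm 0 n N k) \<le> 1/12"
proof -
  let ?f = "\<lambda>k S. of_bool (\<not> arm 0 n N k S) :: real"
  let ?p = "bexp (1/2) (hexagon 0 N) (?f k)"
  have eq: "bexp (1/2) (hexagon 0 N) (?f l) = ?p" if "l < 6" for l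
    unfolding prob_half_not[OF finite_hexagon] using prob_arm_rot[OF that assms(2)] by simp
  have "?p ^ 6 = (\<Prod>l<6. bexp (1/2) (hexagon 0 N) (?f l))"
    using eq by simp
  also have "\<dots> \<le> bexp (1/2) (hexagon 0 N) (\<lambda>S. \<Prod>l<6. ?f l S)"
    by (rule harris_prod) (auto simp: antimono_def intro: arm_mono)
  also have "\<dots> = prob_half (hexagon 0 N) (\<lambda>S. \<not> some_arm 0 n N S)"
    by (rule bexp_cong) (auto simp: some_arm_def of_bool_def)
  also have "\<dots> \<le> (1/12) ^ 6"
    unfolding prob_half_not[OF finite_hexagon] using assms by simp
  finally have "?p \<le> 1/12" by (rule power_le_imp_le_base[of _ 5, simplified]) simp_all
  then show ?thesis unfolding prob_half_not[OF finite_hexagon] .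
qed

section \<open>Six alternating arms make a trifurcation\<close>

definition alternating_arms :: "int \<times> int \<Rightarrow> nat \<Rightarrow> nat \<Rightarrow> (int \<times> int) set \<Rightarrow> bool"
  where "alternating_arms z n N \<omega> \<longleftrightarrow> (\<forall>k<6. arm z n N k (if even k then \<omega> else - \<omega>))"

lemma alternating_arms_cong:
  assumes "\<omega> \<inter> (hexagon z N - hexagon z n) = \<omega>' \<inter> (hexagon z N - hexagon z n)"
  shows "alternating_arms z n N \<omega> \<longleftrightarrow> alternating_arms z n N \<omega>'"
proof -
  have "- \<omega> \<inter> (hexagon z N - hexagon z n) = - \<omega>' \<inter> (hexagon z N - hexagon z n)"
    using assms by blast
  then show ?thesis using arm_cong[OF assms] arm_cong[of "- \<omega>" z N n "- \<omega>'"]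
    unfolding alternating_arms_def by auto
qed

text \<open>A closed arm is as likely as an open one, so a union bound over six failures of
  probability at most \<open>1/12\<close> leaves 1/2. The mixture of increasing and decreasing
  events therefore causes no difficulty.\<close>

lemma prob_alternating_arms:
  assumes "prob_half (hexagon 0 N) (some_arm 0 n N) \<ge> 1 - (1/12) ^ 6"
  shows "prob_half (hexagon z N) (alternating_arms z n N) \<ge> 1/2"
proof -
  let ?A = "hexagon z N"
  let ?a = "\<lambda>k S. arm z n N k (if even k then S else - S)"
  have p: "prob_half ?A (?a k) = prob_half (hexagon 0 N) (arm 0 n N k)" for k
  proof (cases "even k")
    case True
    then show ?thesis using prob_arm_translate(1)[of ?A z N n k] by simp
  next
    case False
    \<comment> \<open>Inside the hexagon the complement in the plane agrees with the complement in
      \<open>?A\<close>, the one that preserves the weights.\<close>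
    have "prob_half ?A (\<lambda>S. arm z n N k (- S)) = prob_half ?A (\<lambda>S. arm z n N k (?A - S))"
      by (intro bexp_cong arg_cong[of _ _ of_bool] arm_cong) auto
    also have "\<dots> = prob_half ?A (arm z n N k)" by (rule bexp_half_compl) simp
    finally show ?thesis using False prob_arm_translate(1)[of ?A z N n k] by simp
  qed
  have "1 - prob_half ?A (alternating_arms z n N) = prob_half ?A (\<lambda>S. \<not> alternating_arms z n N S)"
    by (simp only: prob_half_not[OF finite_hexagon])
  also have "\<dots> \<le> (\<Sum>k<6. prob_half ?A (\<lambda>S. \<not> ?a k S))"
  proof (rule prob_half_union_bound)
    show "\<exists>k\<in>{..<6}. \<not> ?a k S" if "\<not> alternating_arms z n N S" for S
      using that unfolding alternating_arms_def by blast
  qed simp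
  also have "\<dots> \<le> (\<Sum>k<6::nat. 1/12)"
    unfolding prob_half_not[OF finite_hexagon] p
    using prob_no_arm_le[OF assms] by (intro sum_mono) auto
  finally show ?thesis by simp
qed

lemma hexagon_cross_translate:
  assumes "k < 6"
    and X: "conn tadj X x x'" "X \<subseteq> hexagon z n" "lf k (x - z) = int n"
      "lf ((k + 2) mod 6) (x' - z) = int n"
    and Y: "conn tadj Y y y'" "Y \<subseteq> hexagon z n" "lf ((k + 1) mod 6) (y - z) = int n"
      "lf ((k + 3) mod 6) (y' - z) = int n"
  shows "X \<inter> Y \<noteq> {}"
proof -
  let ?h = "\<lambda>w. w - z"
  have sub: "?h ` A \<subseteq> hexagon 0 n" if "A \<subseteq> hexagon z n" for A
    using that by (auto simp: hexagon_def)
  have "?h ` X \<inter> ?h ` Y \<noteq> {}"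
  proof (rule hexagon_cross[OF assms(1)])
    show "conn tadj (?h ` X) (?h x) (?h x')" "conn tadj (?h ` Y) (?h y) (?h y')"
      using X Y by (auto intro: conn_image)
  qed (use X Y sub in auto)
  then show ?thesis by auto
qed

text \<open>The two closed arms, joined through the inner hexagon, link sides \<open>k + 1\<close>
  and \<open>k + 3\<close>. They would have to meet the open path between sides \<open>k\<close> and
  \<open>k + 2\<close>, which avoids closed sites and the inner hexagon.\<close>

lemma arms_separated:
  assumes "k < 6" and n: "n \<le> N"
    and X: "conn tadj (\<omega> \<inter> hexagon z N - hexagon z n) x x'" "lf k (x - z) = int N"
      "lf ((k + 2) mod 6) (x' - z) = int N"
    and Y: "arm z n N ((k + 1) mod 6) (- \<omega>)" "arm z n N ((k + 3) mod 6) (- \<omega>)"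
  shows False
proof -
  let ?Y = "(- \<omega> \<inter> hexagon z N) \<union> hexagon z n"
  have sub: "hexagon z n \<subseteq> hexagon z N" using n by (simp add: hexagon_def) force
  obtain u v y where 1: "u \<in> hexagon z n" "tadj u v"
    "conn tadj (- \<omega> \<inter> hexagon z N - hexagon z n) v y" "lf ((k + 1) mod 6) (y - z) = int N"
    using Y(1) unfolding arm_def by blast
  obtain u' v' y' where 2: "u' \<in> hexagon z n" "tadj u' v'"
    "conn tadj (- \<omega> \<inter> hexagon z N - hexagon z n) v' y'" "lf ((k + 3) mod 6) (y' - z) = int N"
    using Y(2) unfolding arm_def by blast
  have uy: "conn tadj ?Y u y" if "u \<in> hexagon z n" "tadj u v"
    "conn tadj (- \<omega> \<inter> hexagon z N - hexagon z n) v y" for u v y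
  proof -
    have "conn tadj ?Y u v" using that conn_left[OF that(3)] by (intro conn_edge) auto
    also have "conn tadj ?Y v y" using that(3) by (rule conn_mono) auto
    finally show ?thesis .
  qed
  have "conn tadj ?Y y u" using conn_sym[OF symp_tadj uy] 1 by blast
  also have "conn tadj ?Y u u'"
    using hexagon_connected[OF 1(1) 2(1)] by (rule conn_mono) auto
  also have "conn tadj ?Y u' y'" using uy 2 by blast
  finally have "(\<omega> \<inter> hexagon z N - hexagon z n) \<inter> ?Y \<noteq> {}"
    using hexagon_cross_translate[OF assms(1) X(1) _ X(2,3)] 1(4) 2(4) sub by blast
  then show False by blast
qed

text \<open>The open arms to sides 0, 2 and 4 are cut where they first reach radius \<open>R\<close>
  around 0, a boundary shared by all centres \<open>z\<close>. A connection between two cut points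
  would extend along the arms to one between two sides, which \<open>arms_separated\<close>
  excludes.\<close>

lemma alternating_arms_trifurcates:
  assumes "alternating_arms z n M \<omega>" "n \<le> M" and R: "hnorm z + int n < int R"
    and RM: "hexagon 0 R \<subseteq> hexagon z M"
  shows "trifurcates tadj (\<omega> \<inter> hexagon 0 R) {w. hnorm w = int R} (hexagon z n)"
proof -
  let ?T = "\<omega> \<inter> hexagon z M - hexagon z n"
  let ?W = "\<omega> \<inter> hexagon 0 R - hexagon z n"
  have arms: "arm z n M k \<omega>" if "k < 6" "even k" for k
    using that assms(1) unfolding alternating_arms_def by auto
  have arms': "arm z n M k (- \<omega>)" if "k < 6" "odd k" for k
    using that assms(1) unfolding alternating_arms_def by auto
  have "\<exists>y w. lf k (y - z) = int M \<and> conn tadj ?T y w \<and> hnorm w = int R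
      \<and> touches tadj (\<omega> \<inter> hexagon 0 R) (hexagon z n) w" if k: "k < 6" "even k" for k
  proof -
    obtain u x y where uxy: "u \<in> hexagon z n" "tadj u x" "conn tadj ?T x y" "lf k (y - z) = int M"
      using arms[OF k] unfolding arm_def by blast
    have "hnorm x \<le> int R"
    proof -
      have "hnorm (x - z) \<le> int n + 1"
        using hnorm_tadj'[OF uxy(2), of z] uxy(1) by (simp add: hexagon_def)
      then show ?thesis using hnorm_triangle[of "x - z" z] R by simp
    qed
    moreover have "int R \<le> hnorm (y - 0)"
      using boundary_outside[OF k(1) uxy(4) RM] by simp
    ultimately obtain w where w: "hnorm w = int R" "conn tadj (?T \<inter> hexagon 0 R) x w"
      using conn_truncate[OF uxy(3), of 0 R] by auto
    have "conn tadj ?T x w" using w(2) by (rule conn_mono) auto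
    then have "conn tadj ?T y w" using conn_sym[OF symp_tadj uxy(3)] by (rule conn_trans[rotated])
    moreover have "conn tadj ?W x w" using w(2) by (rule conn_mono) auto
    ultimately show ?thesis using uxy w unfolding touches_def by blast
  qed
  then obtain y w where yw: "\<And>k. k < 6 \<Longrightarrow> even k \<Longrightarrow> lf k (y k - z) = int M \<and> conn tadj ?T (y k) (w k)
      \<and> hnorm (w k) = int R \<and> touches tadj (\<omega> \<inter> hexagon 0 R) (hexagon z n) (w k)"
    by metis
  \<comment> \<open>Among three even sides every pair is of the form \<open>k\<close>,
    \<open>k + 2\<close> modulo 6, so one cyclic statement covers all pairs.\<close>
  have sep: "\<not> conn tadj ?W (w k) (w ((k + 2) mod 6))" if k: "k < 6" "even k" for k
  proof
    let ?l = "(k + 2) mod 6"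
    have l: "?l < 6" "even ?l" using k by (auto simp: less_6)
    assume "conn tadj ?W (w k) (w ?l)"
    then have "conn tadj ?T (w k) (w ?l)" by (rule conn_mono) (use RM in auto)
    then have "conn tadj ?T (y k) (y ?l)"
      using yw[OF k] conn_sym[OF symp_tadj] yw[OF l] by (meson conn_trans)
    then show False
      by (rule arms_separated[OF k(1) assms(2)]) (use yw[OF k] yw[OF l] k in \<open>auto intro!: arms' simp: less_6\<close>)
  qed
  have sep': "\<not> conn tadj ?W (w 0) (w 2)" "\<not> conn tadj ?W (w 0) (w 4)" "\<not> conn tadj ?W (w 2) (w 4)"
  proof -
    show "\<not> conn tadj ?W (w 0) (w 2)" "\<not> conn tadj ?W (w 2) (w 4)"
      using sep[of 0] sep[of 2] by (simp_all add: numeral_2_eq_2[symmetric])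
    have "\<not> conn tadj ?W (w 4) (w 0)" using sep[of 4] by simp
    then show "\<not> conn tadj ?W (w 0) (w 4)" using conn_sym[OF symp_tadj] by blast
  qed
  show ?thesis unfolding trifurcates_def
    using yw[of 0] yw[of 2] yw[of 4] sep'
    by (intro exI[of _ "w 0"] exI[of _ "w 2"] exI[of _ "w 4"]) simp
qed

lemma bexp_all_open: "finite B \<Longrightarrow> bexp p B (\<lambda>S. of_bool (B \<subseteq> S)) = p ^ card B"
proof -
  assume "finite B"
  then have "bexp p B (\<lambda>S. of_bool (B \<subseteq> S))
      = (\<Sum>S\<in>{B}. p ^ card S * (1 - p) ^ card (B - S) * of_bool (B \<subseteq> S))"
    unfolding bexp_def by (intro sum.mono_neutral_right) auto
  then show ?thesis by simp
qed

text \<open>The arms depend on the annulus and openness on the inner hexagon, so the probabilities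
  multiply: 1/2 from the arms and a factor 1/2 per inner site.\<close>

lemma prob_open_alternating_arms:
  assumes "prob_half (hexagon 0 N) (some_arm 0 n N) \<ge> 1 - (1/12) ^ 6" "n \<le> N"
    and "finite \<Omega>" "hexagon z N \<subseteq> \<Omega>"
  shows "prob_half \<Omega> (\<lambda>S. alternating_arms z n N S \<and> hexagon z n \<subseteq> S)
    \<ge> (1/2) ^ (card (hexagon 0 n) + 1)"
proof -
  let ?B = "hexagon z n" and ?A = "hexagon z N - hexagon z n"
  have sub: "?B \<subseteq> hexagon z N" using assms(2) by (auto simp: hexagon_def)
  then have AB: "?A \<union> ?B = hexagon z N" by blast
  have loc: "alternating_arms z n N (S \<inter> ?A) = alternating_arms z n N S"
    "alternating_arms z n N (S \<inter> hexagon z N) = alternating_arms z n N S" for S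
    by (rule alternating_arms_cong; blast)+
  have "prob_half \<Omega> (\<lambda>S. alternating_arms z n N S \<and> ?B \<subseteq> S)
      = prob_half (?A \<union> ?B) (\<lambda>S. alternating_arms z n N S \<and> ?B \<subseteq> S)"
    unfolding AB by (rule prob_half_local[OF assms(3,4)]) (use sub in \<open>auto simp: loc\<close>)
  also have "\<dots> = prob_half ?A (alternating_arms z n N) * prob_half ?B (\<lambda>S. ?B \<subseteq> S)"
    by (subst bexp_indep[symmetric]) (auto intro!: bexp_cong simp: loc)
  also have "prob_half ?A (alternating_arms z n N) = prob_half (hexagon z N) (alternating_arms z n N)"
    by (rule prob_half_local[symmetric]) (auto simp: loc)
  also have "prob_half ?B (\<lambda>S. ?B \<subseteq> S) = (1/2) ^ card (hexagon 0 n)"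
    using bexp_all_open[of ?B "1/2"]
    by (simp add: hexagon_translate[of z] card_image inj_on_def)
  also have "(1/2) * (1/2) ^ card (hexagon 0 n)
      \<le> prob_half (hexagon z N) (alternating_arms z n N) * (1/2) ^ card (hexagon 0 n)"
    using prob_alternating_arms[OF assms(1)] by (intro mult_right_mono) auto
  finally show ?thesis by simp
qed

lemma card_boundary: "card {w. hnorm w = int R} \<le> 6 * (2 * R + 1)" "finite {w. hnorm w = int R}"
proof -
  let ?I = "{- int R..int R}"
  \<comment> \<open>Parametrisations of the lines through the six sides, in the order of
    \<open>lf\<close>; the range of \<open>t\<close> overcounts harmlessly.\<close>
  let ?fs = "[\<lambda>t. (int R, t), \<lambda>t. (t, int R - t), \<lambda>t. (t, int R), \<lambda>t. (- int R, t),
    \<lambda>t. (t, - int R - t), \<lambda>t. (t, - int R)] :: (int \<Rightarrow> int \<times> int) list"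
  have sub: "{w. hnorm w = int R} \<subseteq> (\<Union>i<6. (?fs ! i) ` ?I)"
  proof
    fix w assume "w \<in> {w. hnorm w = int R}"
    then have w: "hnorm w = int R" by simp
    obtain a b where ab: "w = (a, b)" by fastforce
    have I: "a \<in> ?I" "b \<in> ?I"
      using w order_refl[of "hnorm w"] unfolding hnorm_le_iff by (simp_all add: ab)
    obtain k where k: "k < 6" "lf k w = int R" using hnorm_attained[of w] w by auto
    define t where "t = (if k = 0 \<or> k = 3 then b else a)"
    have "w = (?fs ! k) t"
      using k unfolding less_6 by (elim disjE) (simp_all add: t_def ab)
    moreover have "t \<in> ?I" using I by (simp add: t_def)
    ultimately show "w \<in> (\<Union>i<6. (?fs ! i) ` ?I)" using k(1) by blast
  qed
  have "card {w. hnorm w = int R} \<le> card (\<Union>i<6. (?fs ! i) ` ?I)"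
    by (rule card_mono) (use sub in auto)
  also have "\<dots> \<le> (\<Sum>i<6. card ((?fs ! i) ` ?I))" by (rule card_UN_le) simp
  also have "\<dots> \<le> (\<Sum>i<6::nat. 2 * R + 1)"
  proof (rule sum_mono)
    fix i :: nat
    have "card ((?fs ! i) ` ?I) \<le> card ?I" by (rule card_image_le) simp
    then show "card ((?fs ! i) ` ?I) \<le> 2 * R + 1" by simp
  qed
  finally show "card {w. hnorm w = int R} \<le> 6 * (2 * R + 1)" by simp
  show "finite {w. hnorm w = int R}" by (rule finite_subset[OF sub]) auto
qed

theorem no_percolation_triangular:
  assumes "\<epsilon> > 0"
  shows "\<exists>N>0. prob_half (hexagon 0 N) (escapes tadj (hexagon 0 N) 0) < \<epsilon>"
proof (rule ccontr)
  assume "\<not> ?thesis"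
  then have neg: "\<epsilon> \<le> prob_half (hexagon 0 N) (escapes tadj (hexagon 0 N) 0)" if "N > 0" for N
    using that by (meson not_le)
  let ?r = "\<lambda>n N. prob_half (hexagon 0 N) (some_arm 0 n N)"
  have "\<exists>n. \<forall>N>n. 1 - (1/12) ^ 6 \<le> ?r n N"
  proof (rule zero_one_limit[OF assms])
    show "\<epsilon> \<le> ?r n N" if "n < N" for n N
      using order.trans[OF neg prob_half_mono[of _ _ "some_arm 0 n N"]] escapes_some_arm that
      by (metis gr_zeroI less_zeroE)
    show "?r n N \<le> 1" for n N by (rule prob_half_le_1) simp
    show "?r n N' \<le> ?r n N" if "n < N" "N \<le> N'" for n N N'
    proof -
      have sub: "hexagon 0 N \<subseteq> hexagon 0 N'" using that by (auto simp: hexagon_def)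
      have "?r n N' \<le> prob_half (hexagon 0 N') (some_arm 0 n N)"
        by (rule prob_half_mono) (rule some_arm_nested[OF _ order_refl sub that(1)])
      also have "\<dots> = ?r n N"
        by (rule prob_arm_translate(2)) (use sub in auto)
      finally show ?thesis .
    qed
    show "\<exists>m. \<forall>N>m. \<exists>N'>m. M \<le> N \<and> M \<le> N' \<and>
      1 - ?r m N \<le> (1 - ?r n M)\<^sup>2 + (?r n M - ?r n N) + (?r n M - ?r n N')" if "n < M" for n M
      by (rule prob_some_arm_two[OF that])
  qed simp
  then obtain n where n: "\<And>N. N > n \<Longrightarrow> 1 - (1/12) ^ 6 \<le> ?r n N" by blast
  \<comment> \<open>A lower bound for the chance that a given hexagon of radius \<open>n\<close>
    trifurcates. It does not depend on the outer radius, which may therefore grow with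
    \<open>m\<close>.\<close>
  define c :: real where "c = (1/2) ^ (card (hexagon 0 n) + 1)"
  have bound: "real m * c \<le> 6 * (12 * real n + 7)" if "m > 0" for m :: nat
  proof -
    \<comment> \<open>Spacing \<open>2 * n + 1\<close> keeps hexagons of radius \<open>n\<close>
      around different grid points disjoint. \<open>R\<close> exceeds the norm of every centre by
      more than \<open>n\<close>, and \<open>M\<close> is large enough that radius \<open>M\<close>
      around any centre covers radius \<open>R\<close> around 0.\<close>
    define L where "L = 2 * n + 1"
    define g where "g = (\<lambda>(i, j). (int L * int i, int L * int j))"
    define Z where "Z = g ` ({..<m} \<times> {..<m})"
    define R where "R = 2 * L * m + n + 1"
    define M where "M = 2 * R + n + 1"
    define Y where "Y = {w. hnorm w = int R}"
    have inj: "inj_on g ({..<m} \<times> {..<m})" by (auto simp: inj_on_def g_def L_def)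
    have cardZ: "card Z = m * m" unfolding Z_def by (simp add: card_image[OF inj])
    have finZ: "finite Z" by (simp add: Z_def)
    have Zn: "hnorm z \<le> 2 * int L * int m" if z: "z \<in> Z" for z
    proof -
      obtain i j where ij: "i < m" "j < m" "z = (int L * int i, int L * int j)"
        using z by (auto simp: Z_def g_def)
      have "int L * int i \<le> int L * int m" "int L * int j \<le> int L * int m"
        using ij by (auto intro!: mult_left_mono)
      then show ?thesis by (simp add: ij(3) hnorm_def)
    qed
    have Zd: "int L \<le> hnorm (z - z')" if z: "z \<in> Z" "z' \<in> Z" "z \<noteq> z'" for z z'
    proof -
      obtain i j i' j' where ij: "z = (int L * int i, int L * int j)" "z' = (int L * int i', int L * int j')"
        using z by (auto simp: Z_def g_def)
      have far: "int L \<le> \<bar>int L * int a - int L * int b\<bar>" if "a \<noteq> b" for a b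
      proof -
        have "int L * 1 \<le> int L * \<bar>int a - int b\<bar>" using that by (intro mult_left_mono) auto
        then show ?thesis by (simp add: abs_mult[symmetric] right_diff_distrib[symmetric])
      qed
      have "i \<noteq> i' \<or> j \<noteq> j'" using z ij by auto
      then show ?thesis using far[of i i'] far[of j j'] by (auto simp: ij hnorm_def)
    qed
    have RM: "hexagon 0 R \<subseteq> hexagon z M" if "z \<in> Z" for z
      using Zn[OF that] hnorm_minus[of z] by (intro hexagon_subset) (simp add: R_def M_def)
    have zR: "hnorm z + int n < int R" if "z \<in> Z" for z
      using Zn[OF that] by (simp add: R_def)
    define \<Omega> where "\<Omega> = (\<Union>z\<in>Z. hexagon z M)"
    have fin: "finite \<Omega>" using finZ by (simp add: \<Omega>_def)
    let ?ev = "\<lambda>z S. alternating_arms z n M S \<and> hexagon z n \<subseteq> S"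
    have nM: "n < M" by (simp add: M_def)
    \<comment> \<open>The expected number of trifurcating hexagons is at least
      \<open>m * m * c\<close>, while every configuration has at most \<open>card Y\<close> of them,
      which is only linear in \<open>m\<close>.\<close>
    have "real (m * m) * c = (\<Sum>z\<in>Z. c)" by (simp add: cardZ)
    also have "\<dots> \<le> (\<Sum>z\<in>Z. prob_half \<Omega> (?ev z))"
      unfolding c_def
      by (intro sum_mono prob_open_alternating_arms n) (use nM fin in \<open>auto simp: \<Omega>_def\<close>)
    also have "\<dots> = bexp (1/2) \<Omega> (\<lambda>S. \<Sum>z\<in>Z. of_bool (?ev z S))" by (simp add: bexp_sum)
    also have "\<dots> \<le> bexp (1/2) \<Omega> (\<lambda>S. real (card Y))"
    proof (rule bexp_mono)
      fix S
      define I where "I = {z \<in> Z. ?ev z S}"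
      have "card I \<le> card Y"
      proof (rule card_trifurcations_le[OF symp_tadj, where W = "S \<inter> hexagon 0 R" and B = "\<lambda>z. hexagon z n"])
        show "finite (S \<inter> hexagon 0 R)" "finite I" "finite Y"
          using finZ card_boundary by (auto simp: I_def Y_def)
        show "hexagon z n \<noteq> {}" if "z \<in> I" for z using center_in_hexagon by blast
        show "hexagon z n \<subseteq> S \<inter> hexagon 0 R" if "z \<in> I" for z
          using that zR[of z] hexagon_subset[of z 0 n R] by (auto simp: I_def)
        show "conn tadj (hexagon z n) a b" if "a \<in> hexagon z n" "b \<in> hexagon z n" for z a b
          using that by (rule hexagon_connected)
        show "hexagon z n \<inter> hexagon z' n = {}" if "z \<in> I" "z' \<in> I" "z \<noteq> z'" for z z'
          using Zd[of z z'] that by (intro hexagon_disjoint) (auto simp: I_def L_def)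
        show "trifurcates tadj (S \<inter> hexagon 0 R) Y (hexagon z n)" if "z \<in> I" for z
          unfolding Y_def
          by (rule alternating_arms_trifurcates[of z n M]) (use that nM zR RM in \<open>auto simp: I_def\<close>)
      qed
      moreover have "(\<Sum>z\<in>Z. of_bool (?ev z S) :: real) = real (card I)"
        using finZ by (simp add: I_def sum_of_bool_eq Int_def)
      ultimately show "(\<Sum>z\<in>Z. of_bool (?ev z S)) \<le> real (card Y)" by simp
    qed auto
    also have "\<dots> = real (card Y)" using fin by simp
    also have "\<dots> \<le> 6 * (2 * real R + 1)"
      using card_boundary(1)[of R] unfolding Y_def by (metis (mono_tags) of_nat_1 of_nat_add of_nat_le_iff of_nat_mult of_nat_numeral)
    also have "\<dots> = 6 * (4 * real L * real m + (2 * real n + 3))" by (simp add: R_def algebra_simps)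
    also have "\<dots> \<le> 6 * (4 * real L * real m + (2 * real n + 3) * real m)"
    proof -
      have "2 * real n + 3 = (2 * real n + 3) * 1" by simp
      also have "\<dots> \<le> (2 * real n + 3) * real m"
        using that by (intro mult_left_mono) auto
      finally have "2 * real n + 3 \<le> (2 * real n + 3) * real m" .
      then show ?thesis by (intro mult_left_mono add_left_mono) simp_all
    qed
    also have "\<dots> \<le> real m * (6 * (12 * real n + 7))" by (simp add: L_def algebra_simps)
    finally have "real m * (real m * c) \<le> real m * (6 * (12 * real n + 7))" by (simp add: mult.assoc)
    then show ?thesis using that by simp
  qed
  have "c > 0" by (simp add: c_def)
  then obtain m :: nat where m: "6 * (12 * real n + 7) < real m * c"
    using reals_Archimedean3 by blast
  moreover have "m > 0" using m \<open>c > 0\<close> by (intro gr0I) auto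
  ultimately show False using bound[of m] by simp
qed

section \<open>Cayley graphs of the integer plane\<close>

lemma int_square_less_4:
  fixes x :: int
  assumes "x * x < 4" shows "x \<in> {-1, 0, 1}"
proof -
  have "\<not> 2 \<le> \<bar>x\<bar>"
    using assms mult_mono[of 2 "\<bar>x\<bar>" 2 "\<bar>x\<bar>"] by (auto simp: abs_mult_self_eq)
  then show ?thesis by auto
qed

text \<open>Completing the square: four times the form is \<open>(2 * x + y)\<close> squared plus
  three times \<open>y\<close> squared, and symmetrically. This leaves finitely many cases.\<close>

lemma int_quadratic_form_eq_1:
  fixes x y :: int
  assumes "x * x + x * y + y * y = 1"
  shows "(x, y) \<in> {(1, 0), (-1, 0), (0, 1), (0, -1), (1, -1), (-1, 1)}"
proof -
  have "(2 * x + y) * (2 * x + y) + 3 * (y * y) = 4" "(2 * y + x) * (2 * y + x) + 3 * (x * x) = 4"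
    using assms by (simp_all add: algebra_simps)
  then have "x * x < 4" "y * y < 4"
    using zero_le_square[of "2 * x + y"] zero_le_square[of "2 * y + x"] by linarith+
  then have "x \<in> {-1, 0, 1}" "y \<in> {-1, 0, 1}" by (simp_all only: int_square_less_4)
  then show ?thesis using assms by auto
qed

lemma int_circle_eq_1:
  fixes x y :: int
  assumes "x * x + y * y = 1"
  shows "(x, y) \<in> {(1, 0), (-1, 0), (0, 1), (0, -1)}"
proof -
  have "x * x < 4" "y * y < 4"
    using assms zero_le_square[of x] zero_le_square[of y] by linarith+
  then have "x \<in> {-1, 0, 1}" "y \<in> {-1, 0, 1}" by (simp_all only: int_square_less_4)
  then show ?thesis using assms by auto
qed

definition lattice_point :: "complex \<Rightarrow> int \<times> int \<Rightarrow> complex"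
  where "lattice_point \<omega> w = of_int (fst w) + of_int (snd w) * \<omega>"

lemma lattice_point_diff: "lattice_point \<omega> v - lattice_point \<omega> u = lattice_point \<omega> (v - u)"
  by (simp add: lattice_point_def algebra_simps)

lemma inj_lattice_point: "Im \<omega> \<noteq> 0 \<Longrightarrow> inj (lattice_point \<omega>)"
  by (rule injI) (auto simp: lattice_point_def complex_eq_iff prod_eq_iff)

lemma cmod_lattice_point:
  "(cmod (lattice_point \<i> (x, y)))\<^sup>2 = of_int (x * x + y * y)"
  "(cmod (lattice_point (cis (pi / 3)) (x, y)))\<^sup>2 = of_int (x * x + x * y + y * y)"
proof -
  show "(cmod (lattice_point \<i> (x, y)))\<^sup>2 = of_int (x * x + y * y)"
    unfolding lattice_point_def cmod_power2 by (simp add: power2_eq_square)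
  have "(sqrt 3)\<^sup>2 = 3" by simp
  then show "(cmod (lattice_point (cis (pi / 3)) (x, y)))\<^sup>2 = of_int (x * x + x * y + y * y)"
    unfolding lattice_point_def cmod_power2 by (simp add: cos_60 sin_60 power2_eq_square algebra_simps)
qed

text \<open>Squared distances are the two integral quadratic forms above, and for both the vectors
  of norm 1 are among the six directions of \<open>tadj\<close>.\<close>

lemma dist_lattice_point_tadj:
  assumes "\<omega> = \<i> \<or> \<omega> = cis (pi / 3)" "dist (lattice_point \<omega> u) (lattice_point \<omega> v) = 1"
  shows "tadj u v"
proof -
  obtain x y where xy: "v - u = (x, y)" by fastforce
  have "cmod (lattice_point \<omega> (x, y)) = 1"
    using assms(2) unfolding dist_commute[of _ "lattice_point \<omega> v"]
    unfolding dist_norm lattice_point_diff xy .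
  then have "(cmod (lattice_point \<omega> (x, y)))\<^sup>2 = 1" by simp
  then have "of_int (x * x + y * y) = (1 :: real) \<or> of_int (x * x + x * y + y * y) = (1 :: real)"
    using assms(1) cmod_lattice_point[of x y] by auto
  then have "x * x + y * y = 1 \<or> x * x + x * y + y * y = 1"
    by (metis of_int_eq_1_iff)
  then show ?thesis
    using int_quadratic_form_eq_1[of x y] int_circle_eq_1[of x y] unfolding tadj_def xy by auto
qed

definition cayley_adj :: "('a::plus) set \<Rightarrow> 'a \<Rightarrow> 'a \<Rightarrow> bool"
  where "cayley_adj S x y \<longleftrightarrow> (\<exists>s\<in>S. y = x + s)"

lemma Z2_simps [simp]:
  "carrier Z2 = UNIV" "x \<otimes>\<^bsub>Z2\<^esub> y = x + y"
  by (simp_all add: DirProd_def case_prod_unfold prod_eq_iff)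

lemma pair_zero [simp]: "(0::int, 0::int) = 0"
  by (simp add: zero_prod_def)

lemma one_Z2 [simp]: "\<one>\<^bsub>Z2\<^esub> = 0"
  by (simp add: DirProd_def)

lemma group_Z2: "group Z2"
  by (intro DirProd_group group_integer_group)

lemma inv_Z2 [simp]: "inv\<^bsub>Z2\<^esub> x = - x"
  by (rule group.inv_equality[OF group_Z2]) (simp_all only: Z2_simps one_Z2 left_minus UNIV_I)

text \<open>The graph isomorphism is read in lattice coordinates. For the square lattice the image
  is a proper subgraph of \<open>tadj\<close>; preserving edges in this one direction is enough to
  compare clusters.\<close>

lemma cayley_graph_embeds:
  assumes "graph_isomorphic (cayley_graph Z2 S) square_lattice \<or>
         graph_isomorphic (cayley_graph Z2 S) triangular_lattice"
  obtains h where "bij h" "\<And>x y. cayley_adj S x y \<Longrightarrow> tadj (h x) (h y)"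
proof -
  obtain \<omega> where \<omega>: "\<omega> = \<i> \<or> \<omega> = cis (pi / 3)"
    "graph_isomorphic (cayley_graph Z2 S) (unit_distance_lattice \<omega>)"
    using assms unfolding square_lattice_def triangular_lattice_def by blast
  have "Im \<omega> \<noteq> 0" using \<omega>(1) by (auto simp: sin_60)
  note inj = inj_lattice_point[OF this]
  define V where "V = range (lattice_point \<omega>)"
  have V: "V = {of_int a + of_int b * \<omega> | a b. True}"
    unfolding V_def lattice_point_def by (auto simp: image_iff) blast
  obtain f where f: "bij_betw f UNIV V"
    "(\<lambda>e. f ` e) ` snd (cayley_graph Z2 S) = {{u, v} | u v. u \<in> V \<and> v \<in> V \<and> dist u v = 1}"
    using \<omega>(2) unfolding graph_isomorphic_def unit_distance_lattice_def Let_def V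
    by (auto simp: cayley_graph_def)
  define h where "h = inv_into UNIV (lattice_point \<omega>) \<circ> f"
  have bij: "bij_betw (inv_into UNIV (lattice_point \<omega>)) V UNIV"
    unfolding V_def using bij_betw_inv_into[OF inj_on_imp_bij_betw[OF inj]] .
  have hf: "lattice_point \<omega> (h x) = f x" for x
    using f(1) unfolding h_def V_def by (auto simp: bij_betw_def intro!: f_inv_into_f)
  show ?thesis
  proof
    show "bij h" unfolding h_def using bij_betw_trans[OF f(1) bij] .
    show "tadj (h x) (h y)" if adj: "cayley_adj S x y" for x y
    proof -
      have "{x, y} \<in> snd (cayley_graph Z2 S)"
        using adj unfolding cayley_graph_def cayley_adj_def snd_conv Z2_simps by blast
      then have "f ` {x, y} \<in> {{u, v} | u v. u \<in> V \<and> v \<in> V \<and> dist u v = 1}"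
        unfolding f(2)[symmetric] by (rule imageI)
      then obtain u v where "{f x, f y} = {u, v}" "dist u v = 1" by auto
      then have "dist (f x) (f y) = 1" by (auto simp: doubleton_eq_iff dist_commute)
      then show ?thesis using dist_lattice_point_tadj[OF \<omega>(1)] hf by metis
    qed
  qed
qed

lemma escapes_mono: "escapes R A x S \<Longrightarrow> S \<subseteq> T \<Longrightarrow> escapes R A x T"
  unfolding escapes_def by (meson conn_mono)

text \<open>\<open>A\<close> is the preimage of a hexagon under the embedding, shifted so that
  \<open>g\<close> goes to 0. Raising the density to 1/2 and passing to the larger edge set both
  increase the chance to escape.\<close>

theorem no_percolation_cayley:
  assumes "graph_isomorphic (cayley_graph Z2 S) square_lattice \<or>
         graph_isomorphic (cayley_graph Z2 S) triangular_lattice"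
    and p: "0 \<le> p" "p \<le> 1/2" and "\<epsilon> > 0"
  obtains A where "finite A" "g \<in> A" "bexp p A (\<lambda>T. of_bool (escapes (cayley_adj S) A g T)) < \<epsilon>"
proof -
  obtain h where h: "bij h" "\<And>x y. cayley_adj S x y \<Longrightarrow> tadj (h x) (h y)"
    using cayley_graph_embeds[OF assms(1)] by blast
  obtain N where N: "prob_half (hexagon 0 N) (escapes tadj (hexagon 0 N) 0) < \<epsilon>"
    using no_percolation_triangular[OF assms(4)] by blast
  define k where "k x = h x - h g" for x
  have "bij (\<lambda>w. w - h g)" by (rule bij_betwI[of _ _ _ "\<lambda>w. w + h g"]) auto
  then have k: "bij k" using bij_betw_trans[OF h(1)] by (simp add: k_def[abs_def] o_def)
  have kadj: "tadj (k x) (k y)" if "cayley_adj S x y" for x y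
    using h(2)[OF that] by (simp add: k_def)
  have kg: "k g = 0" by (simp add: k_def)
  define A where "A = k -` hexagon 0 N"
  have kA: "k ` A = hexagon 0 N"
    unfolding A_def using k by (simp add: bij_is_surj surj_image_vimage_eq)
  have fin: "finite A" unfolding A_def using k by (intro finite_vimageI) (auto simp: bij_def)
  have "bexp p A (\<lambda>T. of_bool (escapes (cayley_adj S) A g T))
      \<le> prob_half A (escapes (cayley_adj S) A g)"
    using p fin by (intro bexp_mono_prob) (auto simp: mono_def intro: escapes_mono)
  also have "\<dots> \<le> prob_half A (\<lambda>T. escapes tadj (k ` A) 0 (k ` T))"
  proof (rule prob_half_mono)
    fix T assume "escapes (cayley_adj S) A g T"
    then obtain c v where "conn (cayley_adj S) T g c" "cayley_adj S c v" "v \<notin> A"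
      unfolding escapes_def by blast
    then have "conn tadj (k ` T) (k g) (k c)" "tadj (k c) (k v)" "k v \<notin> k ` A"
      using kadj k by (auto intro: conn_image simp: bij_def inj_image_mem_iff)
    then show "escapes tadj (k ` A) 0 (k ` T)" unfolding escapes_def kg by blast
  qed
  also have "\<dots> = prob_half (k ` A) (escapes tadj (k ` A) 0)"
    by (rule bexp_image[symmetric]) (use k in \<open>auto simp: bij_def intro: inj_on_subset\<close>)
  also have "\<dots> < \<epsilon>" using N by (simp add: kA)
  finally have "bexp p A (\<lambda>T. of_bool (escapes (cayley_adj S) A g T)) < \<epsilon>" .
  moreover have "g \<in> A" by (simp add: A_def kg)
  ultimately show ?thesis using that fin by blast
qed

section \<open>Self-adjoint finite-range operators\<close>

text \<open>More unknowns than equations. A pivot \<open>a j c\<close> eliminates unknown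
  \<open>j\<close> together with equation \<open>c\<close>, and the smaller system is solved by
  induction.\<close>

lemma homogeneous_system_nontrivial:
  fixes a :: "'i \<Rightarrow> 'c \<Rightarrow> 'k::field"
  assumes "finite C" "finite I" "card C < card I"
  shows "\<exists>b. (\<exists>i\<in>I. b i \<noteq> 0) \<and> (\<forall>c\<in>C. (\<Sum>i\<in>I. b i * a i c) = 0)"
  using assms
proof (induction C arbitrary: I a rule: finite_induct)
  case empty
  then have "I \<noteq> {}" by auto
  then show ?case by (intro exI[of _ "\<lambda>_. 1"]) auto
next
  case (insert c C)
  show ?case
  proof (cases "\<forall>i\<in>I. a i c = 0")
    case True
    have "card C < card I" using insert by simp
    then obtain b where "\<exists>i\<in>I. b i \<noteq> 0" "\<forall>c\<in>C. (\<Sum>i\<in>I. b i * a i c) = 0"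
      using insert.IH[OF insert.prems(1), of a] by blast
    then show ?thesis using True by auto
  next
    case False
    then obtain j where j: "j \<in> I" "a j c \<noteq> 0" by blast
    define I' where "I' = I - {j}"
    have I: "I = insert j I'" "j \<notin> I'" "finite I'" using j insert by (auto simp: I'_def)
    then have "card C < card I'" using insert by simp
    then obtain b where b: "\<exists>i\<in>I'. b i \<noteq> 0"
      "\<And>d. d \<in> C \<Longrightarrow> (\<Sum>i\<in>I'. b i * (a i d - a i c / a j c * a j d)) = 0"
      using insert.IH[of I' "\<lambda>i d. a i d - a i c / a j c * a j d"] I by auto
    \<comment> \<open>Unknown \<open>j\<close> gets the value that makes equation \<open>c\<close>
      hold.\<close>
    define b' where "b' i = (if i = j then - (\<Sum>i\<in>I'. b i * a i c / a j c) else b i)" for i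
    have sum_I: "(\<Sum>i\<in>I. b' i * a i d) = (\<Sum>i\<in>I'. b i * (a i d - a i c / a j c * a j d))" for d
    proof -
      have "(\<Sum>i\<in>I. b' i * a i d) = b' j * a j d + (\<Sum>i\<in>I'. b' i * a i d)"
        using I by simp
      also have "(\<Sum>i\<in>I'. b' i * a i d) = (\<Sum>i\<in>I'. b i * a i d)"
        using I by (intro sum.cong) (auto simp: b'_def)
      also have "b' j * a j d = (\<Sum>i\<in>I'. - (b i * (a i c / a j c * a j d)))"
        by (simp add: b'_def sum_distrib_right sum_negf mult.assoc)
      finally show ?thesis by (simp add: sum.distrib[symmetric] right_diff_distrib)
    qed
    have "(\<Sum>i\<in>I. b' i * a i d) = 0" if "d \<in> insert c C" for d
      using that b(2) j(2) unfolding sum_I by auto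
    moreover have "\<exists>i\<in>I. b' i \<noteq> 0" using b(1) I by (auto simp: b'_def)
    ultimately show ?thesis by blast
  qed
qed

section \<open>Finitely supported functions and symmetric kernels\<close>

definition fin_supp :: "'a set \<Rightarrow> ('a \<Rightarrow> complex) \<Rightarrow> bool"
  where "fin_supp X F \<longleftrightarrow> finite {x. F x \<noteq> 0} \<and> {x. F x \<noteq> 0} \<subseteq> X"

text \<open>A plain finite sum, meaningful when the left argument has finite support; over an
  infinite support the value is the default 0.\<close>

definition dot :: "('a \<Rightarrow> complex) \<Rightarrow> ('a \<Rightarrow> complex) \<Rightarrow> complex"
  where "dot F G = (\<Sum>x | F x \<noteq> 0. F x * cnj (G x))"

lemma fin_suppI: "finite S \<Longrightarrow> S \<subseteq> X \<Longrightarrow> (\<And>x. x \<notin> S \<Longrightarrow> F x = 0) \<Longrightarrow> fin_supp X F"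
  unfolding fin_supp_def by (metis (mono_tags, lifting) finite_subset mem_Collect_eq order.trans subsetI)

lemma fin_supp_zero [simp]: "fin_supp X (\<lambda>_. 0)" by (simp add: fin_supp_def)

lemma fin_supp_lin:
  assumes "fin_supp X F" "fin_supp X G"
  shows "fin_supp X (\<lambda>x. a * F x + b * G x)"
  using assms
  by (intro fin_suppI[of "{x. F x \<noteq> 0} \<union> {x. G x \<noteq> 0}"]) (auto simp: fin_supp_def)

lemma fin_supp_add: "fin_supp X F \<Longrightarrow> fin_supp X G \<Longrightarrow> fin_supp X (\<lambda>x. F x + G x)"
  using fin_supp_lin[of X F G 1 1] by simp

lemma fin_supp_diff: "fin_supp X F \<Longrightarrow> fin_supp X G \<Longrightarrow> fin_supp X (\<lambda>x. F x - G x)"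
  using fin_supp_lin[of X F G 1 "-1"] by simp

lemma fin_supp_cmult: "fin_supp X F \<Longrightarrow> fin_supp X (\<lambda>x. a * F x)"
  using fin_supp_lin[of X F F a 0] by simp

lemma fin_supp_sum:
  "(\<And>i. i \<in> I \<Longrightarrow> fin_supp X (f i)) \<Longrightarrow> fin_supp X (\<lambda>x. \<Sum>i\<in>I. f i x)"
  by (induction I rule: infinite_finite_induct) (auto intro: fin_supp_add)

lemma dot_eq_sum:
  assumes "finite S" "\<And>x. x \<notin> S \<Longrightarrow> F x = 0 \<or> G x = 0"
    and "finite {x. F x \<noteq> 0}"
  shows "dot F G = (\<Sum>x\<in>S. F x * cnj (G x))"
proof -
  have "dot F G = (\<Sum>x\<in>S \<union> {x. F x \<noteq> 0}. F x * cnj (G x))"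
    unfolding dot_def using assms by (intro sum.mono_neutral_left) auto
  also have "\<dots> = (\<Sum>x\<in>S. F x * cnj (G x))"
    using assms by (intro sum.mono_neutral_right) auto
  finally show ?thesis .
qed

lemma dot_lin_left:
  assumes "fin_supp X F" "fin_supp X G"
  shows "dot (\<lambda>x. a * F x + b * G x) K = a * dot F K + b * dot G K"
proof -
  let ?S = "{x. F x \<noteq> 0} \<union> {x. G x \<noteq> 0}"
  have fin: "finite ?S" "finite {x. a * F x + b * G x \<noteq> 0}"
    using assms fin_supp_lin[OF assms, of a b] by (simp_all only: fin_supp_def finite_Un)
  have "dot (\<lambda>x. a * F x + b * G x) K = (\<Sum>x\<in>?S. (a * F x + b * G x) * cnj (K x))"
    "dot F K = (\<Sum>x\<in>?S. F x * cnj (K x))" "dot G K = (\<Sum>x\<in>?S. G x * cnj (K x))"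
    using fin by (intro dot_eq_sum; auto)+
  then show ?thesis by (simp add: sum.distrib sum_distrib_left algebra_simps)
qed

lemma dot_commute:
  assumes "fin_supp X F" "fin_supp X G"
  shows "dot G F = cnj (dot F G)"
proof -
  let ?S = "{x. F x \<noteq> 0} \<union> {x. G x \<noteq> 0}"
  have fin: "finite ?S" using assms by (auto simp: fin_supp_def)
  have "dot F G = (\<Sum>x\<in>?S. F x * cnj (G x))" "dot G F = (\<Sum>x\<in>?S. G x * cnj (F x))"
    using fin by (intro dot_eq_sum; auto)+
  then show ?thesis by (simp add: mult.commute)
qed

lemma dot_self: "dot F F = of_real (\<Sum>x | F x \<noteq> 0. (cmod (F x))\<^sup>2)"
  unfolding dot_def of_real_sum complex_norm_square ..

lemma dot_self_eq_0:
  assumes "fin_supp X F" "dot F F = 0" shows "F = (\<lambda>_. 0)"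
proof
  fix x
  have "finite {x. F x \<noteq> 0}" using assms by (simp add: fin_supp_def)
  moreover have "(\<Sum>x | F x \<noteq> 0. (cmod (F x))\<^sup>2) = 0" using assms(2) unfolding dot_self of_real_eq_0_iff .
  ultimately show "F x = 0" by (subst (asm) sum_nonneg_eq_0_iff) auto
qed

definition kernel_op :: "'a set \<Rightarrow> ('a \<Rightarrow> 'a \<Rightarrow> real) \<Rightarrow> ('a \<Rightarrow> complex) \<Rightarrow> 'a \<Rightarrow> complex"
  where "kernel_op X k F = (\<lambda>x. if x \<in> X then \<Sum>\<^sub>\<infinity>y\<in>X. F y * of_real (k x y) else 0)"

text \<open>A real symmetric matrix with finite rows maps finitely supported functions to such
  functions, so self-adjointness is an exchange of finite sums.\<close>

locale symmetric_kernel =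
  fixes X :: "'a set" and k :: "'a \<Rightarrow> 'a \<Rightarrow> real"
  assumes k_sym: "x \<in> X \<Longrightarrow> y \<in> X \<Longrightarrow> k x y = k y x"
    and k_fin: "x \<in> X \<Longrightarrow> finite {y \<in> X. k x y \<noteq> 0}"
begin

abbreviation "T \<equiv> kernel_op X k"

lemma T_eq_sum:
  assumes "finite S" "S \<subseteq> X" "\<And>x. x \<notin> S \<Longrightarrow> F x = 0"
  shows "T F x = (if x \<in> X then \<Sum>y\<in>S. F y * of_real (k x y) else 0)"
proof -
  have "(\<Sum>\<^sub>\<infinity>y\<in>X. F y * of_real (k x y)) = (\<Sum>\<^sub>\<infinity>y\<in>S. F y * of_real (k x y))"
    using assms by (intro infsum_cong_neutral) auto
  then show ?thesis using assms by (simp add: kernel_op_def)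
qed

lemma fin_supp_T:
  assumes "fin_supp X F" shows "fin_supp X (T F)"
proof (rule fin_suppI)
  let ?S = "{x. F x \<noteq> 0}"
  let ?U = "\<Union>y\<in>?S. {x \<in> X. k y x \<noteq> 0}"
  have S: "finite ?S" "?S \<subseteq> X" using assms by (auto simp: fin_supp_def)
  then show "finite ?U" using k_fin by auto
  show "?U \<subseteq> X" by auto
  fix x assume "x \<notin> ?U"
  then show "T F x = 0"
  proof (subst T_eq_sum[OF S])
    have "F y * of_real (k x y) = 0" if "x \<in> X" "y \<in> ?S" for y
    proof -
      have "y \<in> X" using that S by blast
      then show ?thesis using \<open>x \<notin> ?U\<close> that k_sym[of x y] by auto
    qed
    then show "(if x \<in> X then \<Sum>y\<in>?S. F y * of_real (k x y) else 0) = 0"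
      by (simp add: sum.neutral del: mult_eq_0_iff)
  qed auto
qed

lemma T_lin:
  assumes "fin_supp X F" "fin_supp X G"
  shows "T (\<lambda>x. a * F x + b * G x) = (\<lambda>x. a * T F x + b * T G x)"
proof
  fix x
  let ?S = "{x. F x \<noteq> 0} \<union> {x. G x \<noteq> 0}"
  have S: "finite ?S" "?S \<subseteq> X" using assms by (auto simp: fin_supp_def)
  show "T (\<lambda>x. a * F x + b * G x) x = a * T F x + b * T G x"
    by (subst (1 2 3) T_eq_sum[OF S])
       (auto simp: sum.distrib sum_distrib_left algebra_simps)
qed

lemma T_zero [simp]: "T (\<lambda>_. 0) = (\<lambda>_. 0)"
  by (auto simp: kernel_op_def)

lemma T_cmult: "fin_supp X F \<Longrightarrow> T (\<lambda>x. a * F x) = (\<lambda>x. a * T F x)"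
  using T_lin[of F F a 0] by simp

lemma T_add: "fin_supp X F \<Longrightarrow> fin_supp X G \<Longrightarrow> T (\<lambda>x. F x + G x) = (\<lambda>x. T F x + T G x)"
  using T_lin[of F G 1 1] by simp

lemma T_sum:
  assumes "\<And>i. i \<in> I \<Longrightarrow> fin_supp X (f i)"
  shows "T (\<lambda>x. \<Sum>i\<in>I. f i x) = (\<lambda>x. \<Sum>i\<in>I. T (f i) x)"
  using assms
  by (induction I rule: infinite_finite_induct) (auto simp: T_add fin_supp_sum)

lemma T_selfadjoint:
  assumes "fin_supp X F" "fin_supp X G"
  shows "dot (T F) G = dot F (T G)"
proof -
  let ?S = "{x. F x \<noteq> 0} \<union> {x. G x \<noteq> 0}"
  have S: "finite ?S" "?S \<subseteq> X" using assms by (auto simp: fin_supp_def)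
  have "finite {x. T F x \<noteq> 0}" "finite {x. F x \<noteq> 0}"
    using fin_supp_T assms by (auto simp: fin_supp_def)
  then have "dot (T F) G = (\<Sum>x\<in>?S. T F x * cnj (G x))" "dot F (T G) = (\<Sum>x\<in>?S. F x * cnj (T G x))"
    using S by (intro dot_eq_sum; auto)+
  moreover have "(\<Sum>x\<in>?S. T F x * cnj (G x)) = (\<Sum>x\<in>?S. \<Sum>y\<in>?S. F y * of_real (k x y) * cnj (G x))"
    by (subst T_eq_sum[OF S]) (use S in \<open>auto simp: sum_distrib_right intro!: sum.cong\<close>)
  moreover have "(\<Sum>x\<in>?S. F x * cnj (T G x)) = (\<Sum>x\<in>?S. \<Sum>y\<in>?S. F x * of_real (k x y) * cnj (G y))"
    by (subst T_eq_sum[OF S]) (use S in \<open>auto simp: sum_distrib_left intro!: sum.cong\<close>)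
  moreover have "\<dots> = (\<Sum>y\<in>?S. \<Sum>x\<in>?S. F x * of_real (k x y) * cnj (G y))" by (rule sum.swap)
  moreover have "\<dots> = (\<Sum>x\<in>?S. \<Sum>y\<in>?S. F y * of_real (k x y) * cnj (G x))"
    using S k_sym by (intro sum.cong refl) auto
  ultimately show ?thesis by simp
qed

text \<open>The zero function is allowed for every \<open>c\<close>, so each \<open>eig c\<close> is
  a linear space; nonzero vectors are selected at the end.\<close>

definition eig :: "complex \<Rightarrow> ('a \<Rightarrow> complex) \<Rightarrow> bool"
  where "eig c F \<longleftrightarrow> fin_supp X F \<and> T F = (\<lambda>x. c * F x)"

text \<open>Lists let sums be formed by concatenation even when the same eigenvector occurs
  twice.\<close>

definition eigspan :: "('a \<Rightarrow> complex) \<Rightarrow> bool"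
  where "eigspan F \<longleftrightarrow> (\<exists>fs. (\<forall>f\<in>set fs. \<exists>c. eig c f) \<and> F = (\<lambda>x. \<Sum>f\<leftarrow>fs. f x))"

lemma eig_fin_supp: "eig c F \<Longrightarrow> fin_supp X F" by (simp add: eig_def)

lemma eig_zero: "eig c (\<lambda>_. 0)" by (simp add: eig_def)

lemma eig_cmult: "eig c F \<Longrightarrow> eig c (\<lambda>x. a * F x)"
  by (auto simp: eig_def fin_supp_cmult T_cmult)

lemma eig_add: "eig c F \<Longrightarrow> eig c G \<Longrightarrow> eig c (\<lambda>x. F x + G x)"
  by (auto simp: eig_def fin_supp_add T_add algebra_simps)

lemma eig_sum: "(\<And>i. i \<in> I \<Longrightarrow> eig c (f i)) \<Longrightarrow> eig c (\<lambda>x. \<Sum>i\<in>I. f i x)"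
  by (induction I rule: infinite_finite_induct) (auto intro: eig_add eig_zero)

lemma eig_real:
  assumes "eig c F" "F \<noteq> (\<lambda>_. 0)" shows "cnj c = c"
proof -
  have F: "fin_supp X F" and TF: "T F = (\<lambda>x. c * F x)" using assms by (auto simp: eig_def)
  have "c * dot F F = dot (T F) F"
    using dot_lin_left[OF F F, of c 0 F] by (simp add: TF)
  also have "\<dots> = dot F (T F)" by (rule T_selfadjoint[OF F F])
  also have "\<dots> = cnj c * dot F F"
    unfolding TF by (simp add: dot_def sum_distrib_left algebra_simps)
  finally have "c * dot F F = cnj c * dot F F" .
  moreover have "dot F F \<noteq> 0" using dot_self_eq_0[OF F] assms(2) by blast
  ultimately show ?thesis by simp
qed

lemma eig_orthogonal:
  assumes "eig c F" "eig d G" "c \<noteq> d" shows "dot F G = 0"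
proof (cases "G = (\<lambda>_. 0)")
  case True
  then show ?thesis by (simp add: dot_def)
next
  case False
  have F: "fin_supp X F" "T F = (\<lambda>x. c * F x)" and G: "fin_supp X G" "T G = (\<lambda>x. d * G x)"
    using assms by (auto simp: eig_def)
  have "c * dot F G = dot F (T G)"
    using T_selfadjoint[OF F(1) G(1)] dot_lin_left[OF F(1) F(1), of c 0 G] by (simp add: F(2))
  also have "\<dots> = cnj d * dot F G"
    unfolding G(2) by (simp add: dot_def sum_distrib_left algebra_simps)
  finally show ?thesis using eig_real[OF assms(2) False] assms(3) by simp
qed

lemma eigspan_zero: "eigspan (\<lambda>_. 0)"
  unfolding eigspan_def by (intro exI[of _ "[]"]) simp

lemma eigspan_add:
  assumes "eigspan F" "eigspan G" shows "eigspan (\<lambda>x. F x + G x)"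
proof -
  obtain fs gs where "\<forall>f\<in>set fs. \<exists>c. eig c f" "F = (\<lambda>x. \<Sum>f\<leftarrow>fs. f x)"
    "\<forall>f\<in>set gs. \<exists>c. eig c f" "G = (\<lambda>x. \<Sum>f\<leftarrow>gs. f x)"
    using assms unfolding eigspan_def by blast
  then show ?thesis unfolding eigspan_def by (intro exI[of _ "fs @ gs"]) auto
qed

lemma eig_eigspan: "eig c F \<Longrightarrow> eigspan F"
  unfolding eigspan_def by (intro exI[of _ "[F]"]) auto

lemma eigspan_sum:
  "(\<And>i. i \<in> I \<Longrightarrow> eigspan (f i)) \<Longrightarrow> eigspan (\<lambda>x. \<Sum>i\<in>I. f i x)"
  by (induction I rule: infinite_finite_induct) (auto intro: eigspan_zero eigspan_add)

text \<open>A self-adjoint operator has no Jordan blocks: if \<open>(T - \<kappa>) u\<close> is a sum of eigenvectors, then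
  subtracting the preimages of those with eigenvalue \<open>\<noteq> \<kappa>\<close> leaves \<open>(T - \<kappa>)\<^sup>2 u = 0\<close>.\<close>

lemma eigspan_lift:
  assumes "\<And>f. f \<in> set fs \<Longrightarrow> \<exists>c. eig c f" "eig \<kappa> g" "fin_supp X u"
    and "\<And>x. T u x - \<kappa> * u x = g x + (\<Sum>f\<leftarrow>fs. f x)"
  shows "eigspan u"
  using assms
proof (induction fs arbitrary: g u)
  case Nil
  note u = \<open>fin_supp X u\<close>
  have g: "fin_supp X g" "T g = (\<lambda>x. \<kappa> * g x)" using Nil by (auto simp: eig_def)
  have g_eq: "g = (\<lambda>x. T u x - \<kappa> * u x)" using Nil(4) by auto
  have "g = (\<lambda>_. 0)"
  proof (rule ccontr)
    assume "g \<noteq> (\<lambda>_. 0)"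
    then have real: "cnj \<kappa> = \<kappa>" using eig_real Nil by blast
    \<comment> \<open>Moving \<open>T\<close> to the other side of \<open>dot\<close> gives the
      pairing of \<open>u\<close> with \<open>(T - \<kappa>) g\<close>, which is 0. This uses that
      \<open>\<kappa>\<close> is real, as \<open>g\<close> is a nonzero eigenvector.\<close>
    have "dot g g = dot (\<lambda>x. 1 * T u x + (- \<kappa>) * u x) g"
      by (rule arg_cong[of _ _ "\<lambda>h. dot h g"]) (simp add: g_eq)
    also have "\<dots> = dot (T u) g - \<kappa> * dot u g"
      using dot_lin_left[OF fin_supp_T[OF u] u, of 1 "- \<kappa>" g] by simp
    also have "dot (T u) g = dot u (T g)" by (rule T_selfadjoint[OF u g(1)])
    also have "\<dots> = \<kappa> * dot u g"
      unfolding g(2) by (simp add: dot_def sum_distrib_left real algebra_simps)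
    finally have "dot g g = 0" by simp
    then show False using dot_self_eq_0[OF g(1)] \<open>g \<noteq> _\<close> by blast
  qed
  then have "T u = (\<lambda>x. \<kappa> * u x)" using Nil(4) by (auto simp: fun_eq_iff)
  then show ?case using u by (auto simp: eig_def intro: eig_eigspan)
next
  case (Cons f fs)
  obtain c where c: "eig c f" using Cons.prems(1) by auto
  show ?case
  proof (cases "c = \<kappa>")
    case True
    show ?thesis
    proof (rule Cons.IH)
      show "eig \<kappa> (\<lambda>x. g x + f x)" using eig_add Cons.prems(2) c True by blast
    qed (use Cons.prems in \<open>auto simp: algebra_simps\<close>)
  next
    case False
    \<comment> \<open>\<open>h\<close> solves \<open>(T - \<kappa>) h = f\<close>, so subtracting it
      from \<open>u\<close> removes \<open>f\<close> from the right-hand side.\<close>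
    define h where "h x = (1 / (c - \<kappa>)) * f x" for x
    have h: "eig c h" unfolding h_def by (rule eig_cmult[OF c])
    then have fh: "fin_supp X h" "T h = (\<lambda>x. c * h x)" by (auto simp: eig_def)
    have "eigspan (\<lambda>x. 1 * u x + (-1) * h x)"
    proof (rule Cons.IH)
      show "fin_supp X (\<lambda>x. 1 * u x + (-1) * h x)" by (rule fin_supp_lin[OF Cons.prems(3) fh(1)])
      fix x
      have "(c - \<kappa>) * h x = f x" using False by (simp add: h_def)
      then show "T (\<lambda>x. 1 * u x + (-1) * h x) x - \<kappa> * (1 * u x + (-1) * h x) = g x + (\<Sum>f\<leftarrow>fs. f x)"
        unfolding T_lin[OF Cons.prems(3) fh(1)] using Cons.prems(4)[of x]
        by (simp add: fh(2) algebra_simps)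
    qed (use Cons.prems in auto)
    from eigspan_add[OF this eig_eigspan[OF h]] show ?thesis by simp
  qed
qed

lemma fin_supp_funpow: "fin_supp X u \<Longrightarrow> fin_supp X ((T ^^ i) u)"
  by (induction i) (auto intro: fin_supp_T)

lemma funpow_lin:
  assumes "fin_supp X F" "fin_supp X G"
  shows "(T ^^ i) (\<lambda>x. a * F x + b * G x) = (\<lambda>x. a * (T ^^ i) F x + b * (T ^^ i) G x)"
  by (induction i) (auto simp: T_lin fin_supp_funpow assms)

text \<open>The hypothesis says \<open>p(T) u = 0\<close>. With a complex root
  \<open>\<kappa>\<close> of \<open>p\<close>, the quotient annihilates
  \<open>(T - \<kappa>) u\<close>, which is a sum of eigenvectors by induction on the degree bound;
  \<open>eigspan_lift\<close> passes from there to \<open>u\<close>.\<close>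

lemma eigspan_annihilated:
  assumes "p \<noteq> 0" "degree p \<le> N" "fin_supp X u"
    and "\<And>x. (\<Sum>i\<le>N. coeff p i * (T ^^ i) u x) = 0"
  shows "eigspan u"
  using assms
proof (induction N arbitrary: p u)
  case 0
  then have "coeff p 0 \<noteq> 0" by (metis le_zero_eq leading_coeff_0_iff)
  then have "u = (\<lambda>_. 0)" using 0(4) by (auto simp: fun_eq_iff)
  then show ?case by (simp add: eigspan_zero)
next
  case (Suc N)
  show ?case
  proof (cases "degree p = Suc N")
    case False
    then have "degree p \<le> N" "coeff p (Suc N) = 0" using Suc.prems by (auto intro: coeff_eq_0)
    then show ?thesis using Suc.IH[of p u] Suc.prems by simp
  next
    case True
    then have "\<not> constant (poly p)" by (simp add: constant_degree)
    then obtain \<kappa> where "poly p \<kappa> = 0" using fundamental_theorem_of_algebra by blast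
    then obtain q where q: "p = [:- \<kappa>, 1:] * q" by (auto simp: poly_eq_0_iff_dvd dvd_def)
    have q0: "q \<noteq> 0" using q Suc.prems(1) by auto
    have dq: "degree q = N" using True q0 unfolding q by (subst (asm) degree_mult_eq) auto
    let ?u = "\<lambda>x. 1 * T u x + (- \<kappa>) * u x"
    note Tu = fin_supp_T[OF Suc.prems(3)]
    have "eigspan ?u"
    proof (rule Suc.IH[OF q0])
      show "degree q \<le> N" using dq by simp
      show "fin_supp X ?u" by (rule fin_supp_lin[OF Tu Suc.prems(3)])
      fix x
      let ?t = "\<lambda>i. (T ^^ i) u x"
      have "(\<Sum>i\<le>N. coeff q i * (T ^^ i) ?u x)
          = (\<Sum>i\<le>N. coeff q i * ?t (Suc i)) - \<kappa> * (\<Sum>i\<le>N. coeff q i * ?t i)"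
        unfolding funpow_lin[OF Tu Suc.prems(3)]
        by (simp add: funpow_swap1 sum_subtractf sum_distrib_left algebra_simps)
      \<comment> \<open>Both sums are extended to \<open>Suc N\<close>, so that they combine into
        the coefficients of \<open>[:- \<kappa>, 1:] * q\<close>.\<close>
      also have "(\<Sum>i\<le>N. coeff q i * ?t i) = (\<Sum>i\<le>Suc N. coeff q i * ?t i)"
        using dq by (simp add: coeff_eq_0)
      also have "(\<Sum>i\<le>N. coeff q i * ?t (Suc i)) = (\<Sum>i\<le>Suc N. coeff (pCons 0 q) i * ?t i)"
        by (simp add: sum.atMost_Suc_shift del: sum.atMost_Suc)
      also have "(\<Sum>i\<le>Suc N. coeff (pCons 0 q) i * ?t i) - \<kappa> * (\<Sum>i\<le>Suc N. coeff q i * ?t i)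
          = (\<Sum>i\<le>Suc N. coeff p i * ?t i)"
        unfolding q by (simp add: sum_distrib_left sum_subtractf[symmetric] algebra_simps del: sum.atMost_Suc)
      finally show "(\<Sum>i\<le>N. coeff q i * (T ^^ i) ?u x) = 0" using Suc.prems(4) by simp
    qed
    then obtain fs where fs: "\<forall>f\<in>set fs. \<exists>c. eig c f" "?u = (\<lambda>x. \<Sum>f\<leftarrow>fs. f x)"
      unfolding eigspan_def by blast
    show ?thesis
    proof (rule eigspan_lift[OF _ eig_zero Suc.prems(3)])
      show "\<exists>c. eig c f" if "f \<in> set fs" for f using fs that by blast
      show "T u x - \<kappa> * u x = 0 + (\<Sum>f\<leftarrow>fs. f x)" for x
        using fun_cong[OF fs(2), of x] by simp
    qed
  qed
qed

text \<open>The first \<open>card C + 1\<close> iterates of \<open>\<phi> c\<close> have formal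
  coordinate vectors with \<open>card C\<close> entries, so they are linearly dependent; the
  dependence is a polynomial annihilating \<open>\<phi> c\<close>.\<close>

lemma eigspan_invariant_family:
  assumes "finite C" and \<phi>: "\<And>c. c \<in> C \<Longrightarrow> fin_supp X (\<phi> c)"
    and T\<phi>: "\<And>c. c \<in> C \<Longrightarrow> T (\<phi> c) = (\<lambda>x. \<Sum>d\<in>C. P c d * \<phi> d x)" and "c \<in> C"
  shows "eigspan (\<phi> c)"
proof -
  \<comment> \<open>\<open>a i\<close> holds the coordinates of the \<open>i\<close>-th iterate,
    starting from the unit vector at \<open>c\<close> and multiplied by the matrix \<open>P\<close>
    each time.\<close>
  define a where "a = rec_nat (\<lambda>d. of_bool (d = c)) (\<lambda>i r d. \<Sum>e\<in>C. r e * P e d)"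
  have a_Suc: "a (Suc i) d = (\<Sum>e\<in>C. a i e * P e d)" for i d by (simp add: a_def)
  have pow: "(T ^^ i) (\<phi> c) = (\<lambda>x. \<Sum>d\<in>C. a i d * \<phi> d x)" for i
  proof (induction i)
    case 0
    then show ?case using assms by (auto simp: a_def of_bool_def if_distrib[of "\<lambda>t. t * _"] cong: if_cong)
  next
    case (Suc i)
    have "(T ^^ Suc i) (\<phi> c) = (\<lambda>x. \<Sum>d\<in>C. T (\<lambda>x. a i d * \<phi> d x) x)"
      using \<phi> by (simp add: Suc T_sum fin_supp_cmult)
    also have "\<dots> = (\<lambda>x. \<Sum>e\<in>C. a i e * (\<Sum>d\<in>C. P e d * \<phi> d x))"
      using \<phi> T\<phi> by (intro ext sum.cong) (auto simp: T_cmult)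
    also have "\<dots> = (\<lambda>x. \<Sum>d\<in>C. a (Suc i) d * \<phi> d x)"
    proof
      fix x
      have "(\<Sum>e\<in>C. a i e * (\<Sum>d\<in>C. P e d * \<phi> d x)) = (\<Sum>e\<in>C. \<Sum>d\<in>C. a i e * P e d * \<phi> d x)"
        by (simp add: sum_distrib_left mult.assoc)
      also have "\<dots> = (\<Sum>d\<in>C. \<Sum>e\<in>C. a i e * P e d * \<phi> d x)" by (rule sum.swap)
      finally show "(\<Sum>e\<in>C. a i e * (\<Sum>d\<in>C. P e d * \<phi> d x)) = (\<Sum>d\<in>C. a (Suc i) d * \<phi> d x)"
        by (simp add: a_Suc sum_distrib_right)
    qed
    finally show ?case .
  qed
  let ?n = "card C"
  obtain b where b: "\<exists>i\<in>{..?n}. b i \<noteq> 0" "\<And>d. d \<in> C \<Longrightarrow> (\<Sum>i\<le>?n. b i * a i d) = 0"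
    using homogeneous_system_nontrivial[OF assms(1), of "{..?n}" a] by auto
  define p where "p = (\<Sum>i\<le>?n. monom (b i) i)"
  have coeff: "coeff p i = (if i \<le> ?n then b i else 0)" for i
    by (auto simp: p_def coeff_sum)
  show ?thesis
  proof (rule eigspan_annihilated)
    show "p \<noteq> 0" using b(1) coeff by (metis atMost_iff coeff_0)
    show "degree p \<le> ?n" using coeff by (intro degree_le) auto
    show "fin_supp X (\<phi> c)" using \<phi> assms(4) by blast
    fix x
    have "(\<Sum>i\<le>?n. coeff p i * (T ^^ i) (\<phi> c) x) = (\<Sum>i\<le>?n. \<Sum>d\<in>C. b i * a i d * \<phi> d x)"
      unfolding pow by (simp add: coeff sum_distrib_left mult.assoc)
    also have "\<dots> = (\<Sum>d\<in>C. \<Sum>i\<le>?n. b i * a i d * \<phi> d x)" by (rule sum.swap)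
    also have "\<dots> = (\<Sum>d\<in>C. (\<Sum>i\<le>?n. b i * a i d) * \<phi> d x)" by (simp add: sum_distrib_right)
    also have "\<dots> = 0" using b(2) by simp
    finally show "(\<Sum>i\<le>?n. coeff p i * (T ^^ i) (\<phi> c) x) = 0" .
  qed
qed

end

section \<open>Approximation and orthonormalisation in the space of square-summable
  functions\<close>

definition sqnorm :: "'a set \<Rightarrow> ('a \<Rightarrow> complex) \<Rightarrow> real"
  where "sqnorm X F = (\<Sum>\<^sub>\<infinity>x\<in>X. (cmod (F x))\<^sup>2)"

lemma fin_supp_summable:
  assumes "fin_supp X F" shows "(\<lambda>x. (cmod (F x))\<^sup>2) summable_on X"
proof -
  have "(\<lambda>x. (cmod (F x))\<^sup>2) summable_on X \<longleftrightarrow> (\<lambda>x. (cmod (F x))\<^sup>2) summable_on {x. F x \<noteq> 0}"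
    using assms by (intro summable_on_cong_neutral) (auto simp: fin_supp_def)
  then show ?thesis using assms by (simp add: fin_supp_def)
qed

lemma fin_supp_ell2: "fin_supp X F \<Longrightarrow> F \<in> ell2 X"
  unfolding ell2_def using fin_supp_summable by (auto simp: fin_supp_def)

lemma fin_supp_inner: "fin_supp X F \<Longrightarrow> ell2_inner X F G = dot F G"
proof -
  assume F: "fin_supp X F"
  have "ell2_inner X F G = (\<Sum>\<^sub>\<infinity>x\<in>{x. F x \<noteq> 0}. F x * cnj (G x))"
    unfolding ell2_inner_def using F by (intro infsum_cong_neutral) (auto simp: fin_supp_def)
  then show ?thesis using F by (simp add: fin_supp_def dot_def)
qed

definition lin_span :: "('a \<Rightarrow> complex) set \<Rightarrow> ('a \<Rightarrow> complex) \<Rightarrow> bool"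
  where "lin_span B F \<longleftrightarrow> (\<exists>A c. finite A \<and> A \<subseteq> B \<and> F = (\<lambda>x. \<Sum>b\<in>A. c b * b x))"

lemma lin_span_zero: "lin_span B (\<lambda>_. 0)"
  unfolding lin_span_def by (intro exI[of _ "{}"]) simp

lemma lin_span_base: "b \<in> B \<Longrightarrow> lin_span B (\<lambda>x. a * b x)"
  unfolding lin_span_def by (intro exI[of _ "{b}"] exI[of _ "\<lambda>_. a"]) simp

lemma lin_span_add:
  assumes "lin_span B F" "lin_span B G" shows "lin_span B (\<lambda>x. F x + G x)"
proof -
  obtain A c where 1: "finite A" "A \<subseteq> B" "F = (\<lambda>x. \<Sum>b\<in>A. c b * b x)"
    using assms(1) unfolding lin_span_def by blast
  obtain A' c' where 2: "finite A'" "A' \<subseteq> B" "G = (\<lambda>x. \<Sum>b\<in>A'. c' b * b x)"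
    using assms(2) unfolding lin_span_def by blast
  note * = 1 2
  define d where "d b = (if b \<in> A then c b else 0) + (if b \<in> A' then c' b else 0)" for b
  have "F x + G x = (\<Sum>b\<in>A \<union> A'. d b * b x)" for x
  proof -
    have "F x = (\<Sum>b\<in>A \<union> A'. (if b \<in> A then c b else 0) * b x)"
      unfolding *(3) using * by (intro sum.mono_neutral_cong_left) auto
    moreover have "G x = (\<Sum>b\<in>A \<union> A'. (if b \<in> A' then c' b else 0) * b x)"
      unfolding *(6) using * by (intro sum.mono_neutral_cong_left) auto
    ultimately show ?thesis by (simp only: sum.distrib[symmetric] d_def distrib_right)
  qed
  then show ?thesis using * unfolding lin_span_def by (intro exI[of _ "A \<union> A'"] exI[of _ d]) auto
qed

lemma lin_span_cmult:
  assumes "lin_span B F" shows "lin_span B (\<lambda>x. a * F x)"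
proof -
  obtain A c where *: "finite A" "A \<subseteq> B" "F = (\<lambda>x. \<Sum>b\<in>A. c b * b x)"
    using assms unfolding lin_span_def by blast
  then show ?thesis unfolding lin_span_def
    by (intro exI[of _ A] exI[of _ "\<lambda>b. a * c b"]) (auto simp: sum_distrib_left mult.assoc)
qed

lemma lin_span_sum:
  "(\<And>i. i \<in> I \<Longrightarrow> lin_span B (f i)) \<Longrightarrow> lin_span B (\<lambda>x. \<Sum>i\<in>I. f i x)"
  by (induction I rule: infinite_finite_induct) (auto intro: lin_span_zero lin_span_add)

lemma lin_span_sum_list:
  "(\<And>f. f \<in> set fs \<Longrightarrow> lin_span B f) \<Longrightarrow> lin_span B (\<lambda>x. \<Sum>f\<leftarrow>fs. f x)"
  by (induction fs) (auto intro: lin_span_zero lin_span_add)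

text \<open>Without normalisation: a vector depending on its predecessors yields the zero function,
  whose later terms vanish, and it is discarded only at the end.\<close>

fun gram_schmidt :: "(nat \<Rightarrow> 'a \<Rightarrow> complex) \<Rightarrow> nat \<Rightarrow> 'a \<Rightarrow> complex" where
  "gram_schmidt v n = (\<lambda>x. v n x -
    (\<Sum>m<n. dot (v n) (gram_schmidt v m) / dot (gram_schmidt v m) (gram_schmidt v m)
      * gram_schmidt v m x))"

declare gram_schmidt.simps [simp del]

lemma has_sum_finite_sum:
  fixes f :: "'i \<Rightarrow> 'a \<Rightarrow> 'b::topological_comm_monoid_add"
  assumes "\<And>i. i \<in> I \<Longrightarrow> (f i has_sum s i) X"
  shows "((\<lambda>x. \<Sum>i\<in>I. f i x) has_sum (\<Sum>i\<in>I. s i)) X"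
  using assms by (induction I rule: infinite_finite_induct) (auto intro: has_sum_add)

text \<open>Point masses suffice: truncate \<open>F\<close> to a finite set \<open>K\<close>, then
  replace each of the finitely many point masses by its approximation.\<close>

lemma complete_systemI:
  assumes B: "\<And>b. b \<in> B \<Longrightarrow> fin_supp X b"
    and approx: "\<And>x \<epsilon>. x \<in> X \<Longrightarrow> \<epsilon> > 0 \<Longrightarrow>
      \<exists>G. lin_span B G \<and> sqnorm X (\<lambda>y. of_bool (y = x) - G y) < \<epsilon>"
  shows "complete_system X B"
  unfolding complete_system_def
proof (intro ballI allI impI)
  fix F and \<epsilon> :: real
  assume F: "F \<in> ell2 X" and "\<epsilon> > 0"
  let ?N = "\<lambda>F x. (cmod (F x))\<^sup>2"
  have sum_F: "?N F summable_on X" using F by (simp add: ell2_def)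
  \<comment> \<open>Truncation and replacement each cost at most \<open>\<delta>\<close>; the
    parallelogram bound doubles both, giving \<open>4 * \<delta>\<close>, half of the square of
    \<open>\<epsilon>\<close>.\<close>
  define \<delta> where "\<delta> = \<epsilon>\<^sup>2 / 8"
  have "\<delta> > 0" using \<open>\<epsilon> > 0\<close> by (simp add: \<delta>_def)
  then obtain K where K: "finite K" "K \<subseteq> X" "dist (sum (?N F) K) (infsum (?N F) X) \<le> \<delta>"
    using infsum_finite_approximation[OF sum_F] by blast
  define M where "M = (\<Sum>x\<in>K. ?N F x)"
  have "M \<ge> 0" by (simp add: M_def sum_nonneg)
  \<comment> \<open>Cauchy-Schwarz multiplies the error per point by \<open>M * card K\<close>; the
    added ones keep the denominator positive.\<close>
  define \<delta>' where "\<delta>' = \<delta> / ((M + 1) * (card K + 1))"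
  have "\<delta>' > 0" using \<open>\<delta> > 0\<close> \<open>M \<ge> 0\<close> by (simp add: \<delta>'_def)
  then have "\<forall>x\<in>K. \<exists>G. lin_span B G \<and> sqnorm X (\<lambda>y. of_bool (y = x) - G y) < \<delta>'"
    using approx K(2) by blast
  then obtain G where G: "\<And>x. x \<in> K \<Longrightarrow> lin_span B (G x)"
    "\<And>x. x \<in> K \<Longrightarrow> sqnorm X (\<lambda>y. of_bool (y = x) - G x y) < \<delta>'" by metis
  have finG: "fin_supp X (G x)" if x: "x \<in> K" for x
  proof -
    obtain A c where "finite A" "A \<subseteq> B" "G x = (\<lambda>y. \<Sum>b\<in>A. c b * b y)"
      using G(1)[OF x] unfolding lin_span_def by blast
    then show ?thesis using B by (auto intro!: fin_supp_sum fin_supp_cmult)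
  qed
  define D where "D x y = of_bool (y = x) - G x y" for x y
  have finD: "fin_supp X (D x)" if "x \<in> K" for x
    unfolding D_def using finG[OF that] K that
    by (intro fin_supp_diff) (auto intro: fin_suppI[of "{x}"])
  define L where "L y = (\<Sum>x\<in>K. F x * G x y)" for y
  define F1 where "F1 y = (if y \<in> K then 0 else F y)" for y
  define F2 where "F2 y = (\<Sum>x\<in>K. F x * D x y)" for y
  have split: "F y - L y = F1 y + F2 y" for y
  proof -
    have "(\<Sum>x\<in>K. F x * of_bool (y = x)) = (if y \<in> K then F y else 0)"
      using K(1) by (simp add: of_bool_def if_distrib[of "\<lambda>t. _ * t"] cong: if_cong)
    then show ?thesis by (simp add: L_def F1_def F2_def D_def right_diff_distrib sum_subtractf)
  qed
  have "fin_supp X F2" unfolding F2_def using finD by (intro fin_supp_sum fin_supp_cmult)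
  note sF2 = fin_supp_summable[OF this]
  have eq1: "infsum (?N F1) X = infsum (?N F) (X - K)"
    by (rule infsum_cong_neutral) (auto simp: F1_def)
  have "?N F1 summable_on X \<longleftrightarrow> ?N F summable_on (X - K)"
    by (rule summable_on_cong_neutral) (auto simp: F1_def)
  then have sF1: "?N F1 summable_on X" using summable_on_subset_banach[OF sum_F] by blast
  have n1: "sqnorm X F1 \<le> \<delta>"
  proof -
    have "infsum (?N F) (X - K) = infsum (?N F) X - infsum (?N F) K"
      using K sum_F by (intro infsum_Diff) auto
    then show ?thesis using K unfolding sqnorm_def eq1 by (simp add: dist_real_def)
  qed
  have n2: "sqnorm X F2 \<le> \<delta>"
  proof -
    have "?N F2 y \<le> (\<Sum>x\<in>K. M * ?N (D x) y)" for y
    proof -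
      have "cmod (F2 y) \<le> (\<Sum>x\<in>K. cmod (F x) * cmod (D x y))"
        unfolding F2_def by (rule order.trans[OF norm_sum]) (simp add: norm_mult)
      then have "?N F2 y \<le> (\<Sum>x\<in>K. cmod (F x) * cmod (D x y))\<^sup>2" by (rule power_mono) simp
      also have "\<dots> \<le> M * (\<Sum>x\<in>K. ?N (D x) y)"
        unfolding M_def by (rule Cauchy_Schwarz_ineq_sum)
      finally show ?thesis by (simp add: sum_distrib_left)
    qed
    moreover have hs: "((\<lambda>y. \<Sum>x\<in>K. M * ?N (D x) y) has_sum (\<Sum>x\<in>K. M * sqnorm X (D x))) X"
      unfolding sqnorm_def
      by (intro has_sum_finite_sum has_sum_cmult_right has_sum_infsum fin_supp_summable finD)
    ultimately have "sqnorm X F2 \<le> (\<Sum>x\<in>K. M * sqnorm X (D x))"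
      using infsum_mono[OF sF2 has_sum_imp_summable[OF hs]] infsumI[OF hs] by (simp add: sqnorm_def)
    also have "\<dots> \<le> (\<Sum>x\<in>K. M * \<delta>')"
      using G(2) \<open>M \<ge> 0\<close> unfolding D_def by (intro sum_mono mult_left_mono) (auto intro: less_imp_le)
    also have "\<dots> = \<delta>' * (M * card K)" by simp
    also have "\<dots> \<le> \<delta>' * ((M + 1) * (card K + 1))"
      using \<open>M \<ge> 0\<close> \<open>\<delta>' > 0\<close> by (intro mult_left_mono mult_mono) auto
    also have "\<dots> = \<delta>" using \<open>M \<ge> 0\<close> by (simp add: \<delta>'_def add_nonneg_eq_0_iff)
    finally show ?thesis .
  qed
  have bound: "?N (\<lambda>y. F y - L y) y \<le> 2 * ?N F1 y + 2 * ?N F2 y" for y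
  proof -
    have "?N (\<lambda>y. F y - L y) y \<le> (cmod (F1 y) + cmod (F2 y))\<^sup>2"
      unfolding split by (intro power_mono norm_triangle_ineq) simp
    also have "\<dots> \<le> 2 * ?N F1 y + 2 * ?N F2 y"
      using zero_le_power2[of "cmod (F1 y) - cmod (F2 y)"] by (simp add: power2_sum power2_diff)
    finally show ?thesis .
  qed
  have s12: "(\<lambda>y. 2 * ?N F1 y + 2 * ?N F2 y) summable_on X"
    using sF1 sF2 by (intro summable_on_add summable_on_cmult_right)
  have "sqnorm X (\<lambda>y. F y - L y) \<le> (\<Sum>\<^sub>\<infinity>y\<in>X. 2 * ?N F1 y + 2 * ?N F2 y)"
    unfolding sqnorm_def
  proof (rule infsum_mono[OF _ s12])
    show "?N (\<lambda>y. F y - L y) summable_on X"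
      by (rule summable_on_comparison_test[OF s12]) (use bound in auto)
  qed (rule bound)
  also have "\<dots> = 2 * sqnorm X F1 + 2 * sqnorm X F2"
    unfolding sqnorm_def using sF1 sF2
    by (subst infsum_add) (auto intro: summable_on_cmult_right simp: infsum_cmult_right)
  also have "\<dots> \<le> 4 * \<delta>" using n1 n2 by simp
  also have "\<dots> < \<epsilon>\<^sup>2" using \<open>\<epsilon> > 0\<close> by (simp add: \<delta>_def)
  finally have "ell2_norm X (\<lambda>y. F y - L y) < \<epsilon>"
    unfolding ell2_norm_def sqnorm_def using \<open>\<epsilon> > 0\<close> by (intro real_less_lsqrt) auto
  moreover have "lin_span B L"
    unfolding L_def using G(1) by (intro lin_span_sum lin_span_cmult)
  ultimately show "\<exists>A c. finite A \<and> A \<subseteq> B \<and> ell2_norm X (\<lambda>x. F x - (\<Sum>b\<in>A. c b * b x)) < \<epsilon>"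
    unfolding lin_span_def by auto
qed

context symmetric_kernel
begin

text \<open>Orthogonalising all eigenspaces in one sequence keeps eigenvectors: a projection onto an
  earlier vector with another eigenvalue is 0, and the remaining ones stay in the same
  eigenspace.\<close>

lemma eig_gram_schmidt:
  assumes "\<And>i. eig (c i) (v i)"
  shows "eig (c n) (gram_schmidt v n)"
proof (induction n rule: less_induct)
  case (less n)
  let ?w = "gram_schmidt v"
  have "eig (c n) (\<lambda>x. dot (v n) (?w m) / dot (?w m) (?w m) * ?w m x)" if "m < n" for m
  proof (cases "c n = c m")
    case True
    show ?thesis unfolding True by (rule eig_cmult[OF less[OF that]])
  next
    case False
    then have "dot (v n) (?w m) = 0" using eig_orthogonal assms less[OF that] by blast
    then show ?thesis by (simp add: eig_zero)
  qed
  then have "eig (c n) (\<lambda>x. \<Sum>m<n. dot (v n) (?w m) / dot (?w m) (?w m) * ?w m x)"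
    by (intro eig_sum) auto
  from eig_add[OF assms eig_cmult[OF this, of "-1"]] show ?case
    by (subst gram_schmidt.simps) simp
qed

lemma gram_schmidt_orthogonal:
  assumes "\<And>i. fin_supp X (v i)" and w: "\<And>i. fin_supp X (gram_schmidt v i)"
  shows "m < n \<Longrightarrow> dot (gram_schmidt v n) (gram_schmidt v m) = 0"
proof (induction n arbitrary: m rule: less_induct)
  case (less n)
  let ?w = "gram_schmidt v"
  let ?c = "\<lambda>m. dot (v n) (?w m) / dot (?w m) (?w m)"
  have orth: "dot (?w i) (?w j) = 0" if "i < n" "j < n" "i \<noteq> j" for i j
  proof (cases "j < i")
    case True
    then show ?thesis using less.IH that by blast
  next
    case False
    then have "dot (?w j) (?w i) = 0" using less.IH[of j i] that by auto
    then show ?thesis using dot_commute[OF w w, of j i] by simp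
  qed
  have fs: "fin_supp X (\<lambda>x. \<Sum>i\<in>I. ?c i * ?w i x)" for I
    using w by (intro fin_supp_sum fin_supp_cmult)
  have lin: "dot (\<lambda>x. \<Sum>i\<in>I. ?c i * ?w i x) (?w m) = (\<Sum>i\<in>I. ?c i * dot (?w i) (?w m))"
    if "finite I" for I
    using that
  proof (induction I rule: finite_induct)
    case empty
    then show ?case by (simp add: dot_def)
  next
    case (insert i I)
    then show ?case using dot_lin_left[OF w[of i] fs[of I], of "?c i" 1 "?w m"] by simp
  qed
  have "dot (?w n) (?w m) = dot (\<lambda>x. 1 * v n x + (-1) * (\<Sum>i<n. ?c i * ?w i x)) (?w m)"
    by (subst gram_schmidt.simps) simp
  also have "\<dots> = dot (v n) (?w m) - (\<Sum>i<n. ?c i * dot (?w i) (?w m))"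
    using dot_lin_left[OF assms(1)[of n] fs[of "{..<n}"], of 1 "-1"] lin[of "{..<n}"] by simp
  also have "(\<Sum>i<n. ?c i * dot (?w i) (?w m)) = (\<Sum>i\<in>{m}. ?c i * dot (?w i) (?w m))"
    using less.prems orth by (intro sum.mono_neutral_right) auto
  also have "\<dots> = dot (v n) (?w m)"
  proof (cases "dot (?w m) (?w m) = 0")
    case True
    then have "?w m = (\<lambda>_. 0)" using dot_self_eq_0[OF w] by blast
    then show ?thesis by (simp add: dot_def)
  qed simp
  finally show ?case by simp
qed

text \<open>For each point mass and each accuracy \<open>1 / (n + 1)\<close> one list of
  eigenvectors is chosen. Together these are countably many; their orthonormalisation spans them all
  and hence approximates every point mass.\<close>

theorem pure_point_spectrumI:
  assumes "countable X"
    and approx: "\<And>x \<epsilon>. x \<in> X \<Longrightarrow> \<epsilon> > 0 \<Longrightarrow>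
      \<exists>G. eigspan G \<and> sqnorm X (\<lambda>y. of_bool (y = x) - G y) < \<epsilon>"
  shows "pure_point_spectrum X T"
proof -
  have "\<exists>fs :: 'a \<Rightarrow> nat \<Rightarrow> ('a \<Rightarrow> complex) list. \<forall>x\<in>X. \<forall>n::nat. (\<forall>f\<in>set (fs x n). \<exists>c. eig c f) \<and>
      sqnorm X (\<lambda>y. of_bool (y = x) - (\<Sum>f\<leftarrow>fs x n. f y)) < 1 / (real n + 1)"
  proof (intro choice bchoice ballI allI)
    fix x and n :: nat
    assume x: "x \<in> X"
    obtain G where "eigspan G" "sqnorm X (\<lambda>y. of_bool (y = x) - G y) < 1 / (real n + 1)"
      using approx[OF x, of "1 / (real n + 1)"] by auto
    then show "\<exists>fs. (\<forall>f\<in>set fs. \<exists>c. eig c f) \<and>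
        sqnorm X (\<lambda>y. of_bool (y = x) - (\<Sum>f\<leftarrow>fs. f y)) < 1 / (real n + 1)"
      unfolding eigspan_def by auto
  qed
  then obtain fs where fs: "\<And>x n f. x \<in> X \<Longrightarrow> f \<in> set (fs x n) \<Longrightarrow> \<exists>c. eig c f"
    "\<And>x n. x \<in> X \<Longrightarrow> sqnorm X (\<lambda>y. of_bool (y = x) - (\<Sum>f\<leftarrow>fs x n. f y)) < 1 / (real n + 1)"
    by blast
  \<comment> \<open>The zero function makes \<open>V\<close> nonempty, so that it has an enumeration
    indexed by all naturals.\<close>
  define V where "V = insert (\<lambda>_. 0) (\<Union>x\<in>X. \<Union>n. set (fs x n))"
  have "countable V"
    unfolding V_def using assms(1) by (intro countable_insert countable_UN) (auto intro: countable_finite)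
  define v where "v = from_nat_into V"
  have V: "range v = V" unfolding v_def using \<open>countable V\<close> by (intro range_from_nat_into) (auto simp: V_def)
  have "\<exists>c. eig c f" if "f \<in> V" for f using that fs(1) eig_zero by (auto simp: V_def)
  then have "\<exists>c. eig c (v i)" for i using V by blast
  then obtain c where c: "\<And>i. eig (c i) (v i)" by metis
  define w where "w = gram_schmidt v"
  have w: "eig (c i) (w i)" for i unfolding w_def by (rule eig_gram_schmidt[OF c])
  have fw: "fin_supp X (w i)" for i using w eig_fin_supp by blast
  have orth: "dot (w i) (w j) = 0" if "i \<noteq> j" for i j
  proof -
    have lt: "dot (w n) (w m) = 0" if "m < n" for m n
      unfolding w_def using gram_schmidt_orthogonal[of v m n] c fw that eig_fin_supp
      unfolding w_def by blast
    show ?thesis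
      using lt[of i j] lt[of j i] dot_commute[OF fw fw, of j i] that
      by (cases "i < j") auto
  qed
  define nw where "nw i = (\<lambda>x. of_real (1 / sqrt (\<Sum>x | w i x \<noteq> 0. (cmod (w i x))\<^sup>2)) * w i x)" for i
  define B where "B = nw ` {i. w i \<noteq> (\<lambda>_. 0)}"
  have enw: "eig (c i) (nw i)" for i unfolding nw_def by (rule eig_cmult[OF w])
  have fnw: "fin_supp X (nw i)" for i using enw eig_fin_supp by blast
  have norm_pos: "(\<Sum>x | w i x \<noteq> 0. (cmod (w i x))\<^sup>2) > 0" if "w i \<noteq> (\<lambda>_. 0)" for i
    using dot_self_eq_0[OF fw] that unfolding dot_self of_real_eq_0_iff
    by (metis (no_types, lifting) order_less_le sum_nonneg zero_le_power2)
  have dot_nw: "dot (nw i) (nw j) = of_real (1 / sqrt (\<Sum>x | w i x \<noteq> 0. (cmod (w i x))\<^sup>2))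
      * of_real (1 / sqrt (\<Sum>x | w j x \<noteq> 0. (cmod (w j x))\<^sup>2)) * dot (w i) (w j)" for i j
  proof -
    let ?a = "of_real (1 / sqrt (\<Sum>x | w i x \<noteq> 0. (cmod (w i x))\<^sup>2)) :: complex"
    let ?b = "of_real (1 / sqrt (\<Sum>x | w j x \<noteq> 0. (cmod (w j x))\<^sup>2)) :: complex"
    have "dot (nw i) (nw j) = ?a * dot (w i) (nw j)"
      using dot_lin_left[OF fw[of i] fw[of i], of ?a 0 "nw j"] unfolding nw_def[of i] by simp
    also have "dot (w i) (nw j) = ?b * dot (w i) (w j)"
      unfolding dot_def nw_def[of j] sum_distrib_left
      by (intro sum.cong refl) (simp only: complex_cnj_mult complex_cnj_complex_of_real mult_ac)
    finally show ?thesis by (simp only: mult.assoc)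
  qed
  have dot_diff: "dot (nw i) (nw j) = 0" if "i \<noteq> j" for i j
    unfolding dot_nw using orth[OF that] by simp
  have dot_same: "dot (nw i) (nw i) = 1" if "w i \<noteq> (\<lambda>_. 0)" for i
  proof -
    let ?s = "\<Sum>x | w i x \<noteq> 0. (cmod (w i x))\<^sup>2"
    have "dot (nw i) (nw i) = of_real (1 / sqrt ?s * (1 / sqrt ?s) * ?s)"
      by (subst dot_nw) (simp only: dot_self of_real_mult)
    also have "1 / sqrt ?s * (1 / sqrt ?s) * ?s = 1"
      using norm_pos[OF that] by simp
    finally show ?thesis by simp
  qed
  have B_fin: "fin_supp X b" if "b \<in> B" for b using that fnw by (auto simp: B_def)
  have "orthonormal_system X B"
    unfolding orthonormal_system_def
  proof (intro conjI ballI)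
    show "B \<subseteq> ell2 X" using B_fin fin_supp_ell2 by blast
    fix F F' assume FF': "F \<in> B" "F' \<in> B"
    then obtain i j where ij: "F = nw i" "F' = nw j" "w i \<noteq> (\<lambda>_. 0)" by (auto simp: B_def)
    have "ell2_inner X F F' = dot F F'" using fin_supp_inner B_fin FF' by blast
    also have "\<dots> = (if F = F' then 1 else 0)"
      using dot_same[OF ij(3)] dot_diff[of i j] by (auto simp: ij)
    finally show "ell2_inner X F F' = (if F = F' then 1 else 0)" .
  qed
  moreover have "eigenvector_on X T F" if "F \<in> B" for F
  proof -
    obtain i where i: "F = nw i" "w i \<noteq> (\<lambda>_. 0)" using \<open>F \<in> B\<close> by (auto simp: B_def)
    have "F \<noteq> (\<lambda>_. 0)" using dot_same[OF i(2)] by (auto simp: i(1)[symmetric] dot_def)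
    then show ?thesis
      unfolding eigenvector_on_def using fin_supp_ell2[OF fnw] enw[of i] i by (auto simp: eig_def)
  qed
  moreover have "complete_system X B"
  proof (rule complete_systemI[OF B_fin])
    have w_span: "lin_span B (w i)" for i
    proof (cases "w i = (\<lambda>_. 0)")
      case True
      then show ?thesis by (simp add: lin_span_zero)
    next
      case False
      let ?s = "\<Sum>x | w i x \<noteq> 0. (cmod (w i x))\<^sup>2"
      have "w i = (\<lambda>x. of_real (sqrt ?s) * nw i x)"
        using norm_pos[OF False] by (simp add: nw_def)
      moreover have "lin_span B (\<lambda>x. of_real (sqrt ?s) * nw i x)"
        by (rule lin_span_base) (use False in \<open>auto simp: B_def\<close>)
      ultimately show ?thesis by simp
    qed
    have v_span: "lin_span B (v i)" for i
    proof -
      let ?c = "\<lambda>m. dot (v i) (w m) / dot (w m) (w m)"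
      have "w i x = v i x - (\<Sum>m<i. ?c m * w m x)" for x
        unfolding w_def by (subst gram_schmidt.simps) (rule refl)
      then have "v i = (\<lambda>x. w i x + (\<Sum>m<i. ?c m * w m x))" by (intro ext) simp
      moreover have "lin_span B (\<lambda>x. w i x + (\<Sum>m<i. ?c m * w m x))"
        by (intro lin_span_add lin_span_sum lin_span_cmult w_span)
      ultimately show ?thesis by simp
    qed
    fix x and \<epsilon> :: real
    assume x: "x \<in> X" and "\<epsilon> > 0"
    then obtain n where n: "1 / (real n + 1) < \<epsilon>" by (metis add.commute nat_approx_posE of_nat_Suc)
    have "lin_span B (\<lambda>y. \<Sum>f\<leftarrow>fs x n. f y)"
    proof (rule lin_span_sum_list)
      fix f assume "f \<in> set (fs x n)"
      then have "f \<in> range v" unfolding V V_def using x by blast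
      then show "lin_span B f" using v_span by auto
    qed
    then show "\<exists>G. lin_span B G \<and> sqnorm X (\<lambda>y. of_bool (y = x) - G y) < \<epsilon>"
      using fs(2)[OF x, of n] n by (meson less_trans)
  qed
  ultimately show ?thesis unfolding pure_point_spectrum_def by blast
qed

end

section \<open>The walk on the lamplighter group\<close>

text \<open>\<open>no_loop\<close> guarantees that the lamps switched before and after a move stand
  at different sites. For the lattices in question it holds because they have no loops.\<close>

locale lamplighter_walk = H: group H
  for H :: "('h, 'm) monoid_scheme" (structure) and \<mu> :: "(int \<times> int) pmf" +
  assumes finite_H: "finite (carrier H)"
    and sym_\<mu>: "symmetric_pmf Z2 \<mu>" and finite_\<mu>: "finite (set_pmf \<mu>)"
    and no_loop: "0 \<notin> set_pmf \<mu>"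
begin

abbreviation "W \<equiv> lamplighter_group H Z2"
abbreviation "p \<equiv> switch_walk_switch H Z2 \<mu>"

definition configs :: "(int \<times> int \<Rightarrow> 'h) set"
  where "configs = {\<eta>. (\<forall>x. \<eta> x \<in> carrier H) \<and> finite {x. \<eta> x \<noteq> \<one>}}"

lemma group_W: "group W"
  by (rule group_lamplighter_group) (rule group_Z2, rule H.is_group)

lemma carrier_W: "carrier W = configs \<times> UNIV"
proof -
  have "carrier (configurations H Z2) = configs"
    unfolding carrier_configurations[OF H.is_group] by (auto simp: configs_def)
  then show ?thesis unfolding lamplighter_group_def partial_object.simps Z2_simps(1) by simp
qed

lemma mult_W: "(\<eta>, g) \<otimes>\<^bsub>W\<^esub> (\<eta>', g') = (\<lambda>z. \<eta> z \<otimes> \<eta>' (z - g), g + g')"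
  by (auto simp: lamplighter_group_def shift_def restrict_def)

lemma one_W: "\<one>\<^bsub>W\<^esub> = (\<lambda>_. \<one>, 0)"
  unfolding lamplighter_group_def one_Z2 monoid.simps one_sum_group Z2_simps restrict_UNIV ..

definition step :: "('h \<times> (int \<times> int)) \<times> 'h \<Rightarrow> (int \<times> int \<Rightarrow> 'h) \<times> (int \<times> int)"
  where "step = (\<lambda>((h, s), h').
    embed_lamp H Z2 h \<otimes>\<^bsub>W\<^esub> embed_base H Z2 s \<otimes>\<^bsub>W\<^esub> embed_lamp H Z2 h')"

definition steps :: "(('h \<times> (int \<times> int)) \<times> 'h) pmf"
  where "steps = pair_pmf (pair_pmf (pmf_of_set (carrier H)) \<mu>) (pmf_of_set (carrier H))"

lemma p_eq: "p = map_pmf step steps"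
  unfolding switch_walk_switch_def convolution_def steps_def step_def Let_def
  by (simp add: map_pair[symmetric] map_pmf_comp case_prod_unfold)

lemma carrier_nonempty: "carrier H \<noteq> {}" by auto

lemma set_steps: "set_pmf steps = (carrier H \<times> set_pmf \<mu>) \<times> carrier H"
  by (simp add: steps_def set_pmf_of_set[OF carrier_nonempty finite_H])

lemma finite_p: "finite (set_pmf p)"
  unfolding p_eq using finite_H finite_\<mu> by (simp add: set_steps)

lemma embed_lamp_W: "h \<in> carrier H \<Longrightarrow> embed_lamp H Z2 h \<in> carrier W"
  by (auto simp: embed_lamp_def carrier_W configs_def intro: finite_subset[of _ "{0}"])

lemma embed_base_W: "embed_base H Z2 s \<in> carrier W"
  by (auto simp: embed_base_def carrier_W configs_def)

lemma step_W: "q \<in> set_pmf steps \<Longrightarrow> step q \<in> carrier W"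
proof -
  interpret W: group W by (rule group_W)
  assume "q \<in> set_pmf steps"
  then obtain h s h' where "q = ((h, s), h')" "h \<in> carrier H" "h' \<in> carrier H"
    unfolding set_steps by blast
  then show ?thesis by (simp add: step_def embed_lamp_W embed_base_W)
qed

lemma set_p: "set_pmf p \<subseteq> carrier W"
  unfolding p_eq using step_W by auto

lemma inv_embed_lamp: "h \<in> carrier H \<Longrightarrow> inv\<^bsub>W\<^esub> (embed_lamp H Z2 h) = embed_lamp H Z2 (inv h)"
proof (rule group.inv_equality[OF group_W])
  assume h: "h \<in> carrier H"
  then show "embed_lamp H Z2 (inv h) \<otimes>\<^bsub>W\<^esub> embed_lamp H Z2 h = \<one>\<^bsub>W\<^esub>"
    unfolding embed_lamp_def one_Z2 by (simp add: mult_W one_W restrict_def fun_eq_iff)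
qed (auto intro: embed_lamp_W)

lemma inv_embed_base: "inv\<^bsub>W\<^esub> (embed_base H Z2 s) = embed_base H Z2 (- s)"
proof (rule group.inv_equality[OF group_W])
  show "embed_base H Z2 (- s) \<otimes>\<^bsub>W\<^esub> embed_base H Z2 s = \<one>\<^bsub>W\<^esub>"
    unfolding embed_base_def by (simp add: mult_W one_W restrict_def fun_eq_iff)
qed (auto intro: embed_base_W)

text \<open>Inverting a switch-walk-switch word reverses it and inverts each letter. Off the carrier
  \<open>i\<close> is the identity, which makes \<open>flip\<close> an involution on the whole
  type.\<close>

definition flip :: "('h \<times> (int \<times> int)) \<times> 'h \<Rightarrow> ('h \<times> (int \<times> int)) \<times> 'h"
  where "flip = (let i = (\<lambda>h. if h \<in> carrier H then inv h else h)
    in (\<lambda>((h, s), h'). ((i h', - s), i h)))"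

lemma flip_flip [simp]: "flip (flip q) = q"
  by (auto simp: flip_def Let_def split: prod.split)

lemma pmf_flip: "pmf steps (flip q) = pmf steps q"
proof -
  obtain h s h' where q: "q = ((h, s), h')" by (metis prod.exhaust)
  have "pmf \<mu> (- s) = pmf \<mu> s" 
    using sym_\<mu> unfolding symmetric_pmf_def Z2_simps inv_Z2 by (rule bspec) simp
  then show ?thesis
    by (simp add: q flip_def Let_def steps_def pmf_pair pmf_of_set[OF carrier_nonempty finite_H]
        indicator_def)
qed

lemma map_flip: "map_pmf flip steps = steps"
proof (rule pmf_eqI)
  fix q
  have "inj flip" by (metis flip_flip injI)
  then have "pmf (map_pmf flip steps) (flip (flip q)) = pmf steps (flip q)"
    by (rule pmf_map_inj')
  then show "pmf (map_pmf flip steps) q = pmf steps q" by (simp add: pmf_flip)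
qed

lemma inv_step: "q \<in> set_pmf steps \<Longrightarrow> inv\<^bsub>W\<^esub> (step q) = step (flip q)"
proof -
  assume "q \<in> set_pmf steps"
  then obtain h s h' where q: "q = ((h, s), h')" "h \<in> carrier H" "h' \<in> carrier H"
    by (auto simp: set_steps)
  interpret W: group W by (rule group_W)
  show ?thesis
    unfolding q(1) step_def flip_def Let_def
    using q by (simp add: W.inv_mult_group embed_lamp_W embed_base_W inv_embed_lamp inv_embed_base W.m_assoc)
qed

lemma map_inv_p: "map_pmf (\<lambda>w. inv\<^bsub>W\<^esub> w) p = p"
proof -
  have "map_pmf (\<lambda>w. inv\<^bsub>W\<^esub> w) p = map_pmf (\<lambda>q. step (flip q)) steps"
    unfolding p_eq map_pmf_comp by (rule map_pmf_cong) (auto simp: inv_step)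
  also have "\<dots> = map_pmf step (map_pmf flip steps)" by (simp add: map_pmf_comp)
  finally show ?thesis by (simp add: map_flip p_eq)
qed

lemma pmf_inv_p:
  assumes "w \<in> carrier W" shows "pmf p (inv\<^bsub>W\<^esub> w) = pmf p w"
proof -
  interpret W: group W by (rule group_W)
  have inj: "inj_on (\<lambda>w. inv\<^bsub>W\<^esub> w) (set_pmf p)"
  proof (rule inj_onI)
    fix v w assume "v \<in> set_pmf p" "w \<in> set_pmf p" and eq: "inv\<^bsub>W\<^esub> v = inv\<^bsub>W\<^esub> w"
    then have "v \<in> carrier W" "w \<in> carrier W" using set_p by blast+
    then show "v = w" using W.inv_inv[of v] W.inv_inv[of w] unfolding eq by simp
  qed
  have 1: "pmf p (inv\<^bsub>W\<^esub> w) = pmf p w" if "w \<in> set_pmf p" for w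
    using pmf_map_inj[OF inj that] unfolding map_inv_p .
  show ?thesis
  proof (cases "inv\<^bsub>W\<^esub> w \<in> set_pmf p")
    case True
    then show ?thesis using 1[OF True] assms by simp
  next
    case False
    then have "w \<notin> set_pmf p" using 1[of w] by (auto simp: set_pmf_iff)
    with False show ?thesis by (simp add: set_pmf_iff)
  qed
qed

definition K :: "(int \<times> int \<Rightarrow> 'h) \<times> (int \<times> int) \<Rightarrow> (int \<times> int \<Rightarrow> 'h) \<times> (int \<times> int) \<Rightarrow> real"
  where "K x y = pmf p (inv\<^bsub>W\<^esub> y \<otimes>\<^bsub>W\<^esub> x)"

lemma convolution_operator_eq: "convolution_operator W p = kernel_op (carrier W) K"
  by (rule ext) (simp add: convolution_operator_def kernel_op_def K_def cong: if_cong)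

lemma K_sym: "x \<in> carrier W \<Longrightarrow> y \<in> carrier W \<Longrightarrow> K x y = K y x"
proof -
  interpret W: group W by (rule group_W)
  assume xy: "x \<in> carrier W" "y \<in> carrier W"
  then have "inv\<^bsub>W\<^esub> (inv\<^bsub>W\<^esub> y \<otimes>\<^bsub>W\<^esub> x) = inv\<^bsub>W\<^esub> x \<otimes>\<^bsub>W\<^esub> y" by (simp add: W.inv_mult_group)
  with xy show ?thesis using pmf_inv_p[of "inv\<^bsub>W\<^esub> y \<otimes>\<^bsub>W\<^esub> x"] by (simp add: K_def)
qed

sublocale symmetric_kernel "carrier W" K
proof
  interpret W: group W by (rule group_W)
  fix x y assume x: "x \<in> carrier W"
  show "K x y = K y x" if "y \<in> carrier W" using K_sym x that by blast
  have "{y \<in> carrier W. K x y \<noteq> 0} \<subseteq> (\<lambda>w. x \<otimes>\<^bsub>W\<^esub> w) ` set_pmf p"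
  proof
    fix y assume "y \<in> {y \<in> carrier W. K x y \<noteq> 0}"
    then have y: "y \<in> carrier W" and "K y x \<noteq> 0" using K_sym[OF x, of y] by simp_all
    then have y': "inv\<^bsub>W\<^esub> x \<otimes>\<^bsub>W\<^esub> y \<in> set_pmf p" by (simp add: K_def set_pmf_iff)
    moreover note y'
    moreover have "y = x \<otimes>\<^bsub>W\<^esub> (inv\<^bsub>W\<^esub> x \<otimes>\<^bsub>W\<^esub> y)"
      using x y by (simp add: W.m_assoc[symmetric])
    ultimately show "y \<in> (\<lambda>w. x \<otimes>\<^bsub>W\<^esub> w) ` set_pmf p" by blast
  qed
  then show "finite {y \<in> carrier W. K x y \<noteq> 0}"
    using finite_p by (meson finite_imageI finite_subset)
qed

text \<open>Symmetry of the law turns the convolution at \<open>x\<close> into the average of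
  \<open>F\<close> over the position after one further step, a finite sum over triples.\<close>

lemma T_eq_steps:
  assumes x: "x \<in> carrier W"
  shows "T F x = (\<Sum>q\<in>set_pmf steps. of_real (pmf steps q) * F (x \<otimes>\<^bsub>W\<^esub> step q))"
proof -
  interpret W: group W by (rule group_W)
  have "T F x = (\<Sum>\<^sub>\<infinity>y\<in>carrier W. F y * of_real (pmf p (inv\<^bsub>W\<^esub> x \<otimes>\<^bsub>W\<^esub> y)))"
    unfolding kernel_op_def using x by (auto intro!: infsum_cong simp: K_sym[OF x]) (simp add: K_def)
  also have "\<dots> = (\<Sum>\<^sub>\<infinity>w\<in>carrier W. F (x \<otimes>\<^bsub>W\<^esub> w) * of_real (pmf p w))"
  proof (rule infsum_reindex_bij_witness[of _ "\<lambda>w. x \<otimes>\<^bsub>W\<^esub> w" "\<lambda>y. inv\<^bsub>W\<^esub> x \<otimes>\<^bsub>W\<^esub> y"])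
  qed (use x in \<open>simp_all add: W.m_assoc[symmetric]\<close>)
  also have "\<dots> = (\<Sum>\<^sub>\<infinity>w\<in>set_pmf p. F (x \<otimes>\<^bsub>W\<^esub> w) * of_real (pmf p w))"
    using set_p by (intro infsum_cong_neutral) (auto simp: set_pmf_iff)
  also have "\<dots> = measure_pmf.expectation p (\<lambda>w. F (x \<otimes>\<^bsub>W\<^esub> w))"
    using finite_p
    by (subst integral_measure_pmf[of "set_pmf p"]) (auto simp: scaleR_conv_of_real mult.commute)
  also have "\<dots> = measure_pmf.expectation steps (\<lambda>q. F (x \<otimes>\<^bsub>W\<^esub> step q))"
    unfolding p_eq by simp
  also have "\<dots> = (\<Sum>q\<in>set_pmf steps. of_real (pmf steps q) * F (x \<otimes>\<^bsub>W\<^esub> step q))"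
    using finite_H finite_\<mu>
    by (subst integral_measure_pmf[of "set_pmf steps"]) (auto simp: scaleR_conv_of_real set_steps)
  finally show ?thesis .
qed

lemma mult_step:
  assumes "(\<eta>, g) \<in> carrier W" "h \<in> carrier H" "h' \<in> carrier H" "s \<noteq> 0"
  shows "(\<eta>, g) \<otimes>\<^bsub>W\<^esub> step ((h, s), h') = (\<eta>(g := \<eta> g \<otimes> h, g + s := \<eta> (g + s) \<otimes> h'), g + s)"
proof -
  have "\<eta> x \<in> carrier H" for x using assms by (cases x) (simp add: carrier_W configs_def)
  then show ?thesis
    using assms(2-)
    by (auto simp: step_def embed_lamp_def embed_base_def mult_W restrict_def fun_eq_iff
        simp del: one_sum_group simp: one_sum_group)
qed

definition localized :: "((int \<times> int \<Rightarrow> 'h) \<Rightarrow> real) \<Rightarrow> int \<times> int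
    \<Rightarrow> (int \<times> int \<Rightarrow> 'h) \<times> (int \<times> int) \<Rightarrow> complex"
  where "localized \<phi> c = (\<lambda>(\<zeta>, y). if \<zeta> \<in> configs \<and> y = c then of_real (\<phi> \<zeta>) else 0)"

lemma sum_translate:
  assumes "a \<in> carrier H" shows "(\<Sum>h\<in>carrier H. f (a \<otimes> h)) = (\<Sum>h\<in>carrier H. f h)"
  by (rule sum.reindex_bij_witness[of _ "\<lambda>h. inv a \<otimes> h" "\<lambda>h. a \<otimes> h"])
     (use assms in \<open>simp_all add: H.m_assoc[symmetric]\<close>)

lemma configs_upd: "\<eta> \<in> configs \<Longrightarrow> h \<in> carrier H \<Longrightarrow> \<eta>(x := h) \<in> configs"
  by (auto simp: configs_def intro: finite_subset[of _ "insert x {x. \<eta> x \<noteq> \<one>}"])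

text \<open>Only the jump by \<open>c - x\<close> contributes. It multiplies the lamps at
  \<open>x\<close> and \<open>c\<close> by independent uniform elements, and translation invariance
  turns this into averaging both lamps.\<close>

lemma T_localized:
  assumes "\<eta> \<in> configs"
  shows "T (localized \<phi> c) (\<eta>, x) = of_real (pmf \<mu> (c - x) / (card (carrier H))\<^sup>2 *
    (\<Sum>u\<in>carrier H. \<Sum>v\<in>carrier H. \<phi> (\<eta>(x := u, c := v))))"
proof (cases "c - x \<in> set_pmf \<mu>")
  case False
  have "T (localized \<phi> c) (\<eta>, x) = 0"
  proof (subst T_eq_steps)
    show W: "(\<eta>, x) \<in> carrier W" using assms by (simp add: carrier_W)
    have "localized \<phi> c ((\<eta>, x) \<otimes>\<^bsub>W\<^esub> step q) = 0" if q: "q \<in> set_pmf steps" for q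
    proof -
      obtain h s h' where hs: "q = ((h, s), h')" "h \<in> carrier H" "h' \<in> carrier H" "s \<in> set_pmf \<mu>"
        using q unfolding set_steps by blast
      have s: "s \<noteq> 0" "x + s \<noteq> c" using hs(4) no_loop False by auto
      show ?thesis
        unfolding hs(1) mult_step[OF W hs(2,3) s(1)] using s(2) by (simp add: localized_def)
    qed
    then show "(\<Sum>q\<in>set_pmf steps. of_real (pmf steps q) * localized \<phi> c ((\<eta>, x) \<otimes>\<^bsub>W\<^esub> step q)) = 0"
      by (simp add: sum.neutral del: mult_eq_0_iff)
  qed
  then show ?thesis using False by (simp add: set_pmf_iff)
next
  case True
  let ?n = "card (carrier H)"
  have W: "(\<eta>, x) \<in> carrier W" using assms by (simp add: carrier_W)
  have ne: "c - x \<noteq> 0" using True no_loop by auto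
  have \<eta>: "\<eta> z \<in> carrier H" for z using assms by (cases z) (simp add: configs_def)
  have "T (localized \<phi> c) (\<eta>, x)
      = (\<Sum>q\<in>set_pmf steps. of_real (pmf steps q) * localized \<phi> c ((\<eta>, x) \<otimes>\<^bsub>W\<^esub> step q))"
    by (rule T_eq_steps[OF W])
  also have "\<dots> = (\<Sum>q\<in>(carrier H \<times> {c - x}) \<times> carrier H.
      of_real (pmf steps q) * localized \<phi> c ((\<eta>, x) \<otimes>\<^bsub>W\<^esub> step q))"
  proof (rule sum.mono_neutral_right)
    show "finite (set_pmf steps)" using finite_H finite_\<mu> by (simp add: set_steps)
    show "(carrier H \<times> {c - x}) \<times> carrier H \<subseteq> set_pmf steps" using True by (auto simp: set_steps)
    show "\<forall>q\<in>set_pmf steps - (carrier H \<times> {c - x}) \<times> carrier H.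
        of_real (pmf steps q) * localized \<phi> c ((\<eta>, x) \<otimes>\<^bsub>W\<^esub> step q) = 0"
    proof
      fix q assume "q \<in> set_pmf steps - (carrier H \<times> {c - x}) \<times> carrier H"
      then obtain h s h' where hs: "q = ((h, s), h')" "h \<in> carrier H" "h' \<in> carrier H"
        "s \<in> set_pmf \<mu>" "s \<noteq> c - x"
        unfolding set_steps by blast
      have s: "s \<noteq> 0" "x + s \<noteq> c" using hs(4,5) no_loop by auto
      show "of_real (pmf steps q) * localized \<phi> c ((\<eta>, x) \<otimes>\<^bsub>W\<^esub> step q) = 0"
        unfolding hs(1) mult_step[OF W hs(2,3) s(1)] using s(2) by (simp add: localized_def)
    qed
  qed
  also have "\<dots> = (\<Sum>h\<in>carrier H. \<Sum>h'\<in>carrier H. of_real (pmf steps ((h, c - x), h'))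
      * localized \<phi> c ((\<eta>, x) \<otimes>\<^bsub>W\<^esub> step ((h, c - x), h')))"
    by (simp add: sum.cartesian_product' sum.cartesian_product[symmetric])
  also have "\<dots> = (\<Sum>h\<in>carrier H. \<Sum>h'\<in>carrier H. of_real (pmf \<mu> (c - x) / ?n\<^sup>2
      * \<phi> (\<eta>(x := \<eta> x \<otimes> h, c := \<eta> c \<otimes> h'))))"
  proof (intro sum.cong refl)
    fix h h' assume h: "h \<in> carrier H" "h' \<in> carrier H"
    have "pmf steps ((h, c - x), h') = pmf \<mu> (c - x) / ?n\<^sup>2"
      using h by (simp add: steps_def pmf_pair pmf_of_set[OF carrier_nonempty finite_H] power2_eq_square)
    moreover have "\<eta>(x := \<eta> x \<otimes> h, c := \<eta> c \<otimes> h') \<in> configs"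
      using assms h \<eta> by (intro configs_upd H.m_closed)
    ultimately show "of_real (pmf steps ((h, c - x), h'))
        * localized \<phi> c ((\<eta>, x) \<otimes>\<^bsub>W\<^esub> step ((h, c - x), h'))
      = of_real (pmf \<mu> (c - x) / ?n\<^sup>2 * \<phi> (\<eta>(x := \<eta> x \<otimes> h, c := \<eta> c \<otimes> h')))"
      unfolding mult_step[OF W h ne] by (simp add: localized_def)
  qed
  also have "\<dots> = of_real (pmf \<mu> (c - x) / ?n\<^sup>2 *
      (\<Sum>h\<in>carrier H. \<Sum>h'\<in>carrier H. \<phi> (\<eta>(x := \<eta> x \<otimes> h, c := \<eta> c \<otimes> h'))))"
    by (simp only: of_real_sum[symmetric] sum_distrib_left)
  also have "(\<Sum>h\<in>carrier H. \<Sum>h'\<in>carrier H. \<phi> (\<eta>(x := \<eta> x \<otimes> h, c := \<eta> c \<otimes> h')))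
      = (\<Sum>h\<in>carrier H. \<Sum>v\<in>carrier H. \<phi> (\<eta>(x := \<eta> x \<otimes> h, c := v)))"
    by (intro sum.cong refl sum_translate \<eta>)
  also have "\<dots> = (\<Sum>u\<in>carrier H. \<Sum>v\<in>carrier H. \<phi> (\<eta>(x := u, c := v)))"
    by (rule sum_translate[OF \<eta>])
  finally show ?thesis .
qed

end

section \<open>Percolation decomposition of a point mass\<close>

context lamplighter_walk
begin

text \<open>At each site of \<open>A\<close> the point mass at the lamp state is split orthogonally into its mean (on \<open>S\<close>)
  and the mean-free rest (on \<open>A - S\<close>). The squared norms of the two parts, \<open>1/|H|\<close> and
  \<open>1 - 1/|H|\<close>, are the weights of site percolation.\<close>

definition site :: "(int \<times> int) set \<Rightarrow> 'h \<Rightarrow> int \<times> int \<Rightarrow> 'h \<Rightarrow> real"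
  where "site S a x h = (if x \<in> S then 1 / card (carrier H) else of_bool (h = a) - 1 / card (carrier H))"

definition component :: "(int \<times> int \<Rightarrow> 'h) \<Rightarrow> (int \<times> int) set \<Rightarrow> (int \<times> int) set
    \<Rightarrow> (int \<times> int \<Rightarrow> 'h) \<Rightarrow> real"
  where "component \<eta> A S \<zeta> = of_bool (\<forall>x. x \<notin> A \<longrightarrow> \<zeta> x = \<eta> x) * (\<Prod>x\<in>A. site S (\<eta> x) x (\<zeta> x))"

lemma card_H_pos: "card (carrier H) > 0"
  using finite_H carrier_nonempty by (simp add: card_gt_0_iff)

lemma sum_of_bool_eq_carrier: "a \<in> carrier H \<Longrightarrow> (\<Sum>h\<in>carrier H. of_bool (h = a)) = (1 :: real)"
  using finite_H by (simp add: of_bool_def)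

lemma sum_site_mult:
  assumes "a \<in> carrier H"
  shows "(\<Sum>h\<in>carrier H. site S a x h * site S' a x h)
    = (if (x \<in> S) \<noteq> (x \<in> S') then 0
       else if x \<in> S then 1 / card (carrier H) else 1 - 1 / card (carrier H))"
proof -
  let ?n = "real (card (carrier H))"
  have n: "?n > 0" using card_H_pos by simp
  have s: "(\<Sum>h\<in>carrier H. of_bool (h = a) - 1 / ?n) = 0"
    using sum_of_bool_eq_carrier[OF assms] n by (simp add: sum_subtractf)
  have sq: "(\<Sum>h\<in>carrier H. (of_bool (h = a) - 1 / ?n) * (of_bool (h = a) - 1 / ?n)) = 1 - 1 / ?n"
  proof -
    have "(\<Sum>h\<in>carrier H. (of_bool (h = a) - 1 / ?n) * (of_bool (h = a) - 1 / ?n))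
        = (\<Sum>h\<in>carrier H. (1 - 2 / ?n) * of_bool (h = a) + (1 / ?n) * (1 / ?n))"
      by (intro sum.cong) (auto simp: algebra_simps)
    also have "\<dots> = (1 - 2 / ?n) * 1 + ?n * ((1 / ?n) * (1 / ?n))"
      unfolding sum.distrib sum_distrib_left[symmetric] sum_of_bool_eq_carrier[OF assms] by simp
    also have "\<dots> = 1 - 1 / ?n" using n by (simp add: field_simps)
    finally show ?thesis .
  qed
  consider "x \<in> S" "x \<in> S'" | "x \<in> S" "x \<notin> S'" | "x \<notin> S" "x \<in> S'" | "x \<notin> S" "x \<notin> S'" by blast
  then show ?thesis
  proof cases
    case 1
    then show ?thesis using n by (simp add: site_def)
  next
    case 2
    have "(\<Sum>h\<in>carrier H. (1 / ?n) * (of_bool (h = a) - 1 / ?n)) = 0"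
      unfolding sum_distrib_left[symmetric] s by simp
    then show ?thesis using 2 by (simp add: site_def)
  next
    case 3
    have "(\<Sum>h\<in>carrier H. (of_bool (h = a) - 1 / ?n) * (1 / ?n)) = 0"
      unfolding sum_distrib_right[symmetric] s by simp
    then show ?thesis using 3 by (simp add: site_def)
  next
    case 4
    then show ?thesis using sq by (simp add: site_def)
  qed
qed

lemma component_upd:
  assumes "finite A" "c \<in> A"
  shows "component \<eta> A S (\<zeta>(c := v))
    = site S (\<eta> c) c v * (of_bool (\<forall>x. x \<notin> A \<longrightarrow> \<zeta> x = \<eta> x) * (\<Prod>x\<in>A - {c}. site S (\<eta> x) x (\<zeta> x)))"
proof -
  have "(\<Prod>x\<in>A. site S (\<eta> x) x ((\<zeta>(c := v)) x))
      = site S (\<eta> c) c v * (\<Prod>x\<in>A - {c}. site S (\<eta> x) x (\<zeta> x))"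
    using assms by (subst prod.remove[of A c]) (auto intro!: prod.cong)
  moreover have "(\<forall>x. x \<notin> A \<longrightarrow> (\<zeta>(c := v)) x = \<eta> x) \<longleftrightarrow> (\<forall>x. x \<notin> A \<longrightarrow> \<zeta> x = \<eta> x)"
    using assms(2) by auto
  ultimately show ?thesis by (simp only: component_def mult_ac)
qed

text \<open>Averaging the lamp at \<open>c\<close> fixes the mean part and annihilates the mean-free
  part.\<close>

lemma sum_component_upd:
  assumes "finite A" "c \<in> A" "\<eta> \<in> configs"
  shows "(\<Sum>v\<in>carrier H. component \<eta> A S (\<zeta>(c := v)))
    = (if c \<in> S then card (carrier H) * component \<eta> A S \<zeta> else 0)"
proof (cases "c \<in> S")
  case True
  have "component \<eta> A S (\<zeta>(c := v)) = component \<eta> A S \<zeta>" for v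
    using component_upd[OF assms(1,2), of \<eta> S \<zeta> v] component_upd[OF assms(1,2), of \<eta> S \<zeta> "\<zeta> c"] True
    by (simp add: site_def)
  then show ?thesis using True by simp
next
  case False
  have "\<eta> c \<in> carrier H" using assms(3) by (cases c) (simp add: configs_def)
  then have "(\<Sum>v\<in>carrier H. site S (\<eta> c) c v) = 0"
    using False card_H_pos sum_of_bool_eq_carrier by (simp add: site_def sum_subtractf)
  then show ?thesis
    using False unfolding component_upd[OF assms(1,2)] sum_distrib_right[symmetric] by simp
qed

text \<open>Expanding the product over \<open>A\<close> of mean plus rest gives one term for each
  \<open>S\<close>; each factor itself is the point mass at the lamp state of
  \<open>\<eta>\<close>.\<close>

lemma sum_components:
  assumes "finite A"
  shows "(\<Sum>S\<in>Pow A. component \<eta> A S \<zeta>) = of_bool (\<zeta> = \<eta>)"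
proof -
  let ?n = "real (card (carrier H))"
  have "(\<Sum>S\<in>Pow A. \<Prod>x\<in>A. site S (\<eta> x) x (\<zeta> x))
      = (\<Sum>S\<in>Pow A. (\<Prod>x\<in>S. 1 / ?n) * (\<Prod>x\<in>A - S. of_bool (\<zeta> x = \<eta> x) - 1 / ?n))"
  proof (intro sum.cong refl)
    fix S assume "S \<in> Pow A"
    then have "A = S \<union> (A - S)" "finite S" using assms finite_subset by auto
    then have "(\<Prod>x\<in>A. site S (\<eta> x) x (\<zeta> x))
        = (\<Prod>x\<in>S. site S (\<eta> x) x (\<zeta> x)) * (\<Prod>x\<in>A - S. site S (\<eta> x) x (\<zeta> x))"
      using assms prod.subset_diff[of S A "\<lambda>x. site S (\<eta> x) x (\<zeta> x)"] \<open>S \<in> Pow A\<close>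
      by (simp only: Pow_iff mult.commute)
    then show "(\<Prod>x\<in>A. site S (\<eta> x) x (\<zeta> x))
        = (\<Prod>x\<in>S. 1 / ?n) * (\<Prod>x\<in>A - S. of_bool (\<zeta> x = \<eta> x) - 1 / ?n)"
      by (simp add: site_def)
  qed
  also have "\<dots> = (\<Prod>x\<in>A. 1 / ?n + (of_bool (\<zeta> x = \<eta> x) - 1 / ?n))"
    by (rule prod_add[OF assms, symmetric])
  also have "\<dots> = (\<Prod>x\<in>A. of_bool (\<zeta> x = \<eta> x))" by simp
  also have "\<dots> = of_bool (\<forall>x\<in>A. \<zeta> x = \<eta> x)"
    using assms by (induction A rule: finite_induct) auto
  finally show ?thesis
    unfolding component_def sum_distrib_left[symmetric] by (auto simp: of_bool_def fun_eq_iff)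
qed

definition agreeing :: "(int \<times> int \<Rightarrow> 'h) \<Rightarrow> (int \<times> int) set \<Rightarrow> (int \<times> int \<Rightarrow> 'h) set"
  where "agreeing \<eta> A = {\<zeta>. (\<forall>x\<in>A. \<zeta> x \<in> carrier H) \<and> (\<forall>x. x \<notin> A \<longrightarrow> \<zeta> x = \<eta> x)}"

lemma agreeing_bij:
  "bij_betw (\<lambda>\<xi> x. if x \<in> A then \<xi> x else \<eta> x) (PiE A (\<lambda>_. carrier H)) (agreeing \<eta> A)"
proof (rule bij_betw_byWitness[where f' = "\<lambda>\<zeta>. restrict \<zeta> A"])
  show "\<forall>\<xi>\<in>A \<rightarrow>\<^sub>E carrier H. restrict (\<lambda>x. if x \<in> A then \<xi> x else \<eta> x) A = \<xi>"
    by (auto simp: fun_eq_iff restrict_def PiE_def extensional_def)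
  show "\<forall>\<zeta>\<in>agreeing \<eta> A. (\<lambda>x. if x \<in> A then restrict \<zeta> A x else \<eta> x) = \<zeta>"
    by (auto simp: fun_eq_iff agreeing_def)
qed (auto simp: agreeing_def)

lemma finite_agreeing: "finite A \<Longrightarrow> finite (agreeing \<eta> A)"
  using bij_betw_finite[OF agreeing_bij] finite_H by (metis finite_PiE)

lemma agreeing_configs:
  assumes "finite A" "\<eta> \<in> configs" shows "agreeing \<eta> A \<subseteq> configs"
proof
  fix \<zeta> assume \<zeta>: "\<zeta> \<in> agreeing \<eta> A"
  then have "{x. \<zeta> x \<noteq> \<one>} \<subseteq> A \<union> {x. \<eta> x \<noteq> \<one>}" by (auto simp: agreeing_def)
  moreover have "\<zeta> x \<in> carrier H" for x
  proof -
    have "\<eta> x \<in> carrier H" using assms(2) by (cases x) (simp add: configs_def)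
    then show ?thesis using \<zeta> unfolding agreeing_def mem_Collect_eq by metis
  qed
  ultimately show "\<zeta> \<in> configs"
    using assms unfolding configs_def by (auto intro: finite_subset)
qed

lemma component_outside:
  assumes "\<zeta> \<in> configs" "\<zeta> \<notin> agreeing \<eta> A" shows "component \<eta> A S \<zeta> = 0"
proof -
  have "\<zeta> x \<in> carrier H" for x using assms(1) by (cases x) (simp add: configs_def)
  then have "\<not> (\<forall>x. x \<notin> A \<longrightarrow> \<zeta> x = \<eta> x)" using assms(2) by (simp add: agreeing_def)
  then show ?thesis by (simp only: component_def of_bool_eq mult_zero_left)
qed

text \<open>The inner product factorises over the sites of \<open>A\<close>; a site where
  \<open>S\<close> and \<open>S'\<close> differ contributes 0. The diagonal values are the weights
  of \<open>bexp\<close> at density \<open>1 / card (carrier H)\<close>.\<close>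

lemma sum_component_mult:
  assumes "finite A" "\<eta> \<in> configs" "S \<subseteq> A" "S' \<subseteq> A"
  shows "(\<Sum>\<zeta>\<in>agreeing \<eta> A. component \<eta> A S \<zeta> * component \<eta> A S' \<zeta>)
    = (if S = S' then (1 / card (carrier H)) ^ card S * (1 - 1 / card (carrier H)) ^ card (A - S) else 0)"
proof -
  let ?n = "real (card (carrier H))"
  have \<eta>: "\<eta> x \<in> carrier H" for x using assms(2) by (cases x) (simp add: configs_def)
  have "(\<Sum>\<zeta>\<in>agreeing \<eta> A. component \<eta> A S \<zeta> * component \<eta> A S' \<zeta>)
      = (\<Sum>\<xi>\<in>PiE A (\<lambda>_. carrier H). \<Prod>x\<in>A. site S (\<eta> x) x (\<xi> x) * site S' (\<eta> x) x (\<xi> x))"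
    unfolding sum.reindex_bij_betw[OF agreeing_bij, symmetric]
    by (intro sum.cong refl) (simp add: component_def prod.distrib[symmetric])
  also have "\<dots> = (\<Prod>x\<in>A. \<Sum>h\<in>carrier H. site S (\<eta> x) x h * site S' (\<eta> x) x h)"
    by (rule prod_sum_PiE[symmetric]) (use assms finite_H in auto)
  also have "\<dots> = (\<Prod>x\<in>A. if (x \<in> S) \<noteq> (x \<in> S') then 0 else if x \<in> S then 1 / ?n else 1 - 1 / ?n)"
    by (simp only: sum_site_mult[OF \<eta>])
  also have "\<dots> = (if S = S' then (1 / ?n) ^ card S * (1 - 1 / ?n) ^ card (A - S) else 0)"
  proof (cases "S = S'")
    case False
    then obtain x where "x \<in> A" "(x \<in> S) \<noteq> (x \<in> S')" using assms(3,4) by blast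
    then have "\<exists>x\<in>A. (if (x \<in> S) \<noteq> (x \<in> S') then 0 else if x \<in> S then 1 / ?n else 1 - 1 / ?n) = 0"
      by (intro bexI[of _ x]) simp
    then show ?thesis using False assms(1) by (simp only: prod_zero if_False)
  next
    case True
    have "finite S" using assms finite_subset by blast
    have "(\<Prod>x\<in>A. if x \<in> S then 1 / ?n else 1 - 1 / ?n)
        = (\<Prod>x\<in>A \<inter> {x. x \<in> S}. 1 / ?n) * (\<Prod>x\<in>A \<inter> - {x. x \<in> S}. 1 - 1 / ?n)"
      by (rule prod.If_cases[OF assms(1)])
    also have "A \<inter> {x. x \<in> S} = S" using assms(3) by auto
    also have "A \<inter> - {x. x \<in> S} = A - S" by auto
    finally show ?thesis using True by simp
  qed
  finally show ?thesis .
qed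

text \<open>On these vectors \<open>T\<close> is the base walk killed at closed sites: a mean-free
  lamp at either end of the jump averages to 0. The condition \<open>nbrs\<close> ensures that the
  lamp at \<open>x\<close> is among those that were split.\<close>

lemma T_component:
  assumes "finite A" "\<eta> \<in> configs" "c \<in> A" "\<zeta> \<in> configs"
    and nbrs: "c \<in> S \<Longrightarrow> pmf \<mu> (c - x) \<noteq> 0 \<Longrightarrow> x \<in> A"
  shows "T (localized (component \<eta> A S) c) (\<zeta>, x)
    = of_real (of_bool (c \<in> S \<and> x \<in> S) * pmf \<mu> (c - x) * component \<eta> A S \<zeta>)"
proof (cases "c \<in> S \<and> pmf \<mu> (c - x) \<noteq> 0")
  case False
  have "(\<Sum>u\<in>carrier H. \<Sum>v\<in>carrier H. component \<eta> A S (\<zeta>(x := u, c := v))) = 0" if "c \<notin> S"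
    unfolding sum_component_upd[OF assms(1,3,2)] using that by simp
  then have zero: "pmf \<mu> (c - x) / (card (carrier H))\<^sup>2
      * (\<Sum>u\<in>carrier H. \<Sum>v\<in>carrier H. component \<eta> A S (\<zeta>(x := u, c := v))) = 0"
    using False by (cases "c \<in> S") simp_all
  show ?thesis unfolding T_localized[OF assms(4)] zero using False by auto
next
  case True
  then have "x \<in> A" using nbrs by blast
  have n: "card (carrier H) > 0" by (rule card_H_pos)
  have "(\<Sum>u\<in>carrier H. \<Sum>v\<in>carrier H. component \<eta> A S (\<zeta>(x := u, c := v)))
      = card (carrier H) * (\<Sum>u\<in>carrier H. component \<eta> A S (\<zeta>(x := u)))"
    unfolding sum_component_upd[OF assms(1,3,2)] using True by (simp add: sum_distrib_left)
  also have "\<dots> = (card (carrier H))\<^sup>2 * (of_bool (x \<in> S) * component \<eta> A S \<zeta>)"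
    unfolding sum_component_upd[OF assms(1) \<open>x \<in> A\<close> assms(2)] by (simp add: power2_eq_square)
  finally show ?thesis
    unfolding T_localized[OF assms(4)] using n True by simp
qed

lemma fin_supp_component:
  assumes "finite A" "\<eta> \<in> configs"
  shows "fin_supp (carrier W) (localized (component \<eta> A S) c)"
proof (rule fin_suppI)
  show "finite (agreeing \<eta> A \<times> {c})" using finite_agreeing[OF assms(1)] by simp
  show "agreeing \<eta> A \<times> {c} \<subseteq> carrier W" using agreeing_configs[OF assms] by (auto simp: carrier_W)
  show "localized (component \<eta> A S) c y = 0" if "y \<notin> agreeing \<eta> A \<times> {c}" for y
    using that component_outside by (cases y) (auto simp: localized_def)
qed

lemma cayley_adj_pmf: "pmf \<mu> (c - x) \<noteq> 0 \<longleftrightarrow> cayley_adj (set_pmf \<mu>) c x"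
proof -
  have "pmf \<mu> (inv\<^bsub>Z2\<^esub> (c - x)) = pmf \<mu> (c - x)" 
    using sym_\<mu> unfolding symmetric_pmf_def Z2_simps by (rule bspec) simp
  then have "pmf \<mu> (x - c) = pmf \<mu> (c - x)" unfolding inv_Z2 by simp
  moreover have "cayley_adj (set_pmf \<mu>) c x \<longleftrightarrow> x - c \<in> set_pmf \<mu>"
    unfolding cayley_adj_def by (auto intro: bexI[of _ "x - c"])
  ultimately show ?thesis by (simp add: set_pmf_iff)
qed

text \<open>If the percolation cluster of \<open>g\<close> and its outer boundary lie in \<open>A\<close>, the walk started
  from this component never leaves the cluster.\<close>

lemma eigspan_component:
  assumes "finite A" "\<eta> \<in> configs" "S \<subseteq> A" "g \<in> A"
    and esc: "\<not> escapes (cayley_adj (set_pmf \<mu>)) A g S"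
  shows "eigspan (localized (component \<eta> A S) g)"
proof -
  let ?R = "cayley_adj (set_pmf \<mu>)"
  \<comment> \<open>If \<open>g\<close> is closed, \<open>T\<close> annihilates the vector, so it
    spans an invariant space by itself.\<close>
  define C where "C = (if g \<in> S then {c. conn ?R S g c} else {g})"
  have CA: "C \<subseteq> A" using assms(3,4) by (auto simp: C_def dest: conn_right)
  have CS: "C \<subseteq> S" "\<And>c. c \<in> C \<Longrightarrow> conn ?R S g c" if "g \<in> S" using that by (auto simp: C_def dest: conn_right)
  have gC: "g \<in> C" by (simp add: C_def)
  show ?thesis
  proof (rule eigspan_invariant_family[OF _ fin_supp_component[OF assms(1,2)] _ gC])
    show "finite C" using CA assms(1) finite_subset by blast
    fix c assume c: "c \<in> C"
    show "T (localized (component \<eta> A S) c) = (\<lambda>y. \<Sum>d\<in>C. of_real (of_bool (c \<in> S \<and> d \<in> S) * pmf \<mu> (c - d))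
        * localized (component \<eta> A S) d y)"
    proof
      fix y :: "(int \<times> int \<Rightarrow> 'h) \<times> (int \<times> int)"
      obtain \<zeta> x where y: "y = (\<zeta>, x)" by (rule prod.exhaust)
      let ?s = "\<Sum>d\<in>C. (of_real (of_bool (c \<in> S \<and> d \<in> S) * pmf \<mu> (c - d)) :: complex) * localized (component \<eta> A S) d (\<zeta>, x)"
      show "T (localized (component \<eta> A S) c) y = (\<Sum>d\<in>C. of_real (of_bool (c \<in> S \<and> d \<in> S) * pmf \<mu> (c - d))
        * localized (component \<eta> A S) d y)"
      proof (cases "\<zeta> \<in> configs")
        case False
        then show ?thesis by (simp add: y kernel_op_def carrier_W localized_def)
      next
        case True
        have nb: "x \<in> A" if "c \<in> S" "pmf \<mu> (c - x) \<noteq> 0"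
        proof -
          have "conn ?R S g c" using CS(2) c that(1) by (cases "g \<in> S") (auto simp: C_def)
          then show ?thesis using esc that(2) unfolding cayley_adj_pmf escapes_def by blast
        qed
        have "?s = (\<Sum>d\<in>C. if d = x then of_real (of_bool (c \<in> S \<and> x \<in> S) * pmf \<mu> (c - x) * component \<eta> A S \<zeta>) else 0)"
          using True by (intro sum.cong) (auto simp: localized_def)
        also have "\<dots> = of_real (of_bool (c \<in> S \<and> x \<in> S) * pmf \<mu> (c - x) * component \<eta> A S \<zeta>)"
        proof (cases "x \<in> C")
          case False
          \<comment> \<open>An open neighbour of a cluster site belongs to the cluster, so outside
            \<open>C\<close> the right-hand side vanishes.\<close>
          have "x \<in> C" if "c \<in> S" "x \<in> S" "pmf \<mu> (c - x) \<noteq> 0"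
          proof -
            have "g \<in> S" using c that(1) by (auto simp: C_def split: if_splits)
            then show ?thesis
              using CS(2)[OF _ c] conn_step[of ?R S g c x] that unfolding cayley_adj_pmf by (simp add: C_def)
          qed
          moreover have "(\<Sum>d\<in>C. if d = x then t else 0) = 0" for t :: complex
            using False by (intro sum.neutral) auto
          ultimately show ?thesis using False by auto
        qed (use \<open>finite C\<close> in simp)
        also have "\<dots> = T (localized (component \<eta> A S) c) (\<zeta>, x)"
          by (rule T_component[OF assms(1,2) subsetD[OF CA c] True, symmetric]) (rule nb)
        finally show ?thesis unfolding y by (rule sym)
      qed
    qed
  qed
qed

text \<open>Pythagoras for the orthogonal components: the squared norm is the percolation
  probability that the open set lies in the family.\<close>

lemma sqnorm_components:
  assumes "finite A" "\<eta> \<in> configs" "\<B> \<subseteq> Pow A"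
  shows "sqnorm (carrier W) (\<lambda>y. \<Sum>S\<in>\<B>. localized (component \<eta> A S) g y)
    = (\<Sum>S\<in>\<B>. (1 / card (carrier H)) ^ card S * (1 - 1 / card (carrier H)) ^ card (A - S))"
proof -
  let ?F = "\<lambda>y. \<Sum>S\<in>\<B>. localized (component \<eta> A S) g y"
  have fin\<B>: "finite \<B>" using assms finite_subset by blast
  have "sqnorm (carrier W) ?F = (\<Sum>\<^sub>\<infinity>y\<in>agreeing \<eta> A \<times> {g}. (cmod (?F y))\<^sup>2)"
    unfolding sqnorm_def
  proof (rule infsum_cong_neutral)
    fix y assume "y \<in> carrier W - agreeing \<eta> A \<times> {g}"
    then have "?F y = 0"
      using component_outside by (cases y) (auto simp: localized_def carrier_W intro!: sum.neutral)
    then show "(cmod (?F y))\<^sup>2 = 0" by simp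
  qed (use agreeing_configs[OF assms(1,2)] in \<open>auto simp: carrier_W\<close>)
  also have "\<dots> = (\<Sum>y\<in>agreeing \<eta> A \<times> {g}. (cmod (?F y))\<^sup>2)"
    using finite_agreeing[OF assms(1)] by simp
  also have "\<dots> = (\<Sum>\<zeta>\<in>agreeing \<eta> A. (cmod (?F (\<zeta>, g)))\<^sup>2)"
    by (simp add: sum.cartesian_product[symmetric] sum.cartesian_product')
  also have "\<dots> = (\<Sum>\<zeta>\<in>agreeing \<eta> A. \<Sum>S\<in>\<B>. \<Sum>S'\<in>\<B>. component \<eta> A S \<zeta> * component \<eta> A S' \<zeta>)"
  proof (intro sum.cong refl)
    fix \<zeta> assume "\<zeta> \<in> agreeing \<eta> A"
    then have "?F (\<zeta>, g) = of_real (\<Sum>S\<in>\<B>. component \<eta> A S \<zeta>)"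
      using agreeing_configs[OF assms(1,2)] by (auto simp: localized_def)
    then have "(cmod (?F (\<zeta>, g)))\<^sup>2 = (\<Sum>S\<in>\<B>. component \<eta> A S \<zeta>)\<^sup>2"
      by (simp only: norm_of_real power2_abs)
    then show "(cmod (?F (\<zeta>, g)))\<^sup>2 = (\<Sum>S\<in>\<B>. \<Sum>S'\<in>\<B>. component \<eta> A S \<zeta> * component \<eta> A S' \<zeta>)"
      by (simp only: power2_eq_square sum_product)
  qed
  also have "\<dots> = (\<Sum>S\<in>\<B>. \<Sum>\<zeta>\<in>agreeing \<eta> A. \<Sum>S'\<in>\<B>. component \<eta> A S \<zeta> * component \<eta> A S' \<zeta>)"
    by (rule sum.swap)
  also have "\<dots> = (\<Sum>S\<in>\<B>. \<Sum>S'\<in>\<B>. \<Sum>\<zeta>\<in>agreeing \<eta> A. component \<eta> A S \<zeta> * component \<eta> A S' \<zeta>)"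
    by (intro sum.cong refl sum.swap)
  also have "\<dots> = (\<Sum>S\<in>\<B>. \<Sum>S'\<in>\<B>. if S = S' then
      (1 / card (carrier H)) ^ card S * (1 - 1 / card (carrier H)) ^ card (A - S) else 0)"
    using assms by (intro sum.cong refl sum_component_mult) auto
  also have "\<dots> = (\<Sum>S\<in>\<B>. (1 / card (carrier H)) ^ card S * (1 - 1 / card (carrier H)) ^ card (A - S))"
    using fin\<B> by simp
  finally show ?thesis .
qed

lemma countable_carrier_W: "countable (carrier W)"
proof -
  have "configs \<subseteq> (\<Union>A\<in>{A. finite A}. agreeing (\<lambda>_. \<one>) A)"
  proof
    fix \<eta> assume "\<eta> \<in> configs"
    then have "\<eta> \<in> agreeing (\<lambda>_. \<one>) {x. \<eta> x \<noteq> \<one>}" "finite {x. \<eta> x \<noteq> \<one>}"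
      by (auto simp: configs_def agreeing_def)
    then show "\<eta> \<in> (\<Union>A\<in>{A. finite A}. agreeing (\<lambda>_. \<one>) A)" by blast
  qed
  moreover have "countable (\<Union>A\<in>{A :: (int \<times> int) set. finite A}. agreeing (\<lambda>_. \<one>) A)"
    by (intro countable_UN countable_Collect_finite) (auto intro: countable_finite finite_agreeing)
  ultimately have "countable configs" by (rule countable_subset)
  then show ?thesis unfolding carrier_W by (intro countable_SIGMA) auto
qed

theorem pure_point:
  assumes "card (carrier H) \<ge> 2"
    and "graph_isomorphic (cayley_graph Z2 (set_pmf \<mu>)) square_lattice \<or>
         graph_isomorphic (cayley_graph Z2 (set_pmf \<mu>)) triangular_lattice"
  shows "pure_point_spectrum (carrier W) (convolution_operator W p)"
  unfolding convolution_operator_eq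
proof (rule pure_point_spectrumI[OF countable_carrier_W])
  fix y and \<epsilon> :: real
  assume y: "y \<in> carrier W" and "\<epsilon> > 0"
  obtain \<eta> g where \<eta>: "y = (\<eta>, g)" "\<eta> \<in> configs" using y by (auto simp: carrier_W)
  let ?q = "1 / real (card (carrier H))"
  let ?R = "cayley_adj (set_pmf \<mu>)"
  have "0 \<le> ?q" "?q \<le> 1 / 2" using assms(1) by (auto simp: field_simps)
  then obtain A where A: "finite A" "g \<in> A" "bexp ?q A (\<lambda>S. of_bool (escapes ?R A g S)) < \<epsilon>"
    using no_percolation_cayley[OF assms(2) _ _ \<open>\<epsilon> > 0\<close>, of ?q g] by blast
  \<comment> \<open>The good components sum to a combination of eigenvectors. The bad ones are the
    error, whose squared norm is exactly the escape probability.\<close>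
  define good where "good = {S \<in> Pow A. \<not> escapes ?R A g S}"
  define bad where "bad = {S \<in> Pow A. escapes ?R A g S}"
  have gb: "good \<union> bad = Pow A" "good \<inter> bad = {}" "finite good" "finite bad"
    using A(1) by (auto simp: good_def bad_def)
  let ?\<psi> = "\<lambda>S. localized (component \<eta> A S) g"
  have "eigspan (\<lambda>z. \<Sum>S\<in>good. ?\<psi> S z)"
    by (intro eigspan_sum eigspan_component) (use A \<eta> in \<open>auto simp: good_def\<close>)
  moreover have "sqnorm (carrier W) (\<lambda>z. of_bool (z = y) - (\<Sum>S\<in>good. ?\<psi> S z)) < \<epsilon>"
  proof -
    have "of_bool (z = y) = (\<Sum>S\<in>good. ?\<psi> S z) + (\<Sum>S\<in>bad. ?\<psi> S z)" for z
    proof -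
      obtain \<zeta> x where z: "z = (\<zeta>, x)" by (rule prod.exhaust)
      have "(\<Sum>S\<in>good. ?\<psi> S z) + (\<Sum>S\<in>bad. ?\<psi> S z) = (\<Sum>S\<in>Pow A. ?\<psi> S z)"
        using sum.union_disjoint[OF gb(3,4,2), of "\<lambda>S. ?\<psi> S z"] by (simp add: gb(1))
      also have "\<dots> = (if \<zeta> \<in> configs \<and> x = g then of_real (\<Sum>S\<in>Pow A. component \<eta> A S \<zeta>) else 0)"
        by (auto simp: z localized_def)
      also have "\<dots> = of_bool (z = y)"
        unfolding sum_components[OF A(1)] using \<eta> by (auto simp: z of_bool_def)
      finally show ?thesis by simp
    qed
    then have "sqnorm (carrier W) (\<lambda>z. of_bool (z = y) - (\<Sum>S\<in>good. ?\<psi> S z))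
        = sqnorm (carrier W) (\<lambda>z. \<Sum>S\<in>bad. ?\<psi> S z)" by simp
    also have "\<dots> = (\<Sum>S\<in>bad. ?q ^ card S * (1 - ?q) ^ card (A - S))"
      by (rule sqnorm_components[OF A(1) \<eta>(2)]) (auto simp: bad_def)
    also have "\<dots> = bexp ?q A (\<lambda>S. of_bool (escapes ?R A g S))"
      unfolding bexp_def bad_def using A(1) by (intro sum.mono_neutral_cong_left) auto
    also have "\<dots> < \<epsilon>" by (rule A(3))
    finally show ?thesis .
  qed
  ultimately show "\<exists>G. eigspan G \<and> sqnorm (carrier W) (\<lambda>z. of_bool (z = y) - G z) < \<epsilon>" by blast
qed

end

theorem mainTheorem4:
  fixes \<mu> :: "(int \<times> int) pmf" and H :: "('h, 'm) monoid_scheme"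
  assumes "symmetric_pmf Z2 \<mu>"
    and "finite (set_pmf \<mu>)"
    and "generate Z2 (set_pmf \<mu>) = carrier Z2"
    and "graph_isomorphic (cayley_graph Z2 (set_pmf \<mu>)) square_lattice \<or>
         graph_isomorphic (cayley_graph Z2 (set_pmf \<mu>)) triangular_lattice"
    and "group H" and "finite (carrier H)" and "card (carrier H) \<ge> 2"
  shows "pure_point_spectrum (carrier (lamplighter_group H Z2))
    (convolution_operator (lamplighter_group H Z2) (switch_walk_switch H Z2 \<mu>))"
proof -
  obtain h where "bij h" and h: "\<And>x y. cayley_adj (set_pmf \<mu>) x y \<Longrightarrow> tadj (h x) (h y)"
    using cayley_graph_embeds[OF assms(4)] by blast
  \<comment> \<open>A loop in the Cayley graph would be sent to a loop of the triangular
    lattice.\<close>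
  have "0 \<notin> set_pmf \<mu>"
  proof
    assume "0 \<in> set_pmf \<mu>"
    then have "cayley_adj (set_pmf \<mu>) 0 0" 
      unfolding cayley_adj_def by (intro bexI[of _ 0]) simp_all
    then have "tadj (h 0) (h 0)" by (rule h)
    then show False by (simp add: tadj_def prod_eq_iff)
  qed
  then interpret lamplighter_walk H \<mu>
    using assms by (intro lamplighter_walk.intro) (auto simp: lamplighter_walk_axioms_def)
  show ?thesis using assms by (intro pure_point)
qed

end
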